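(* Let $\Lambda=(\lambda_k)_{k=1}^\infty\subset \mathbb{R}_+=[0,\infty)$ be a strong Zygmund lacunary sequence and put $S=\bigcup_{k=1}^\infty[\lambda_k,\lambda_k+1]$. Then for a measurable set $E\subset\mathbb{R}$ the following are equivalent: (i) there exists a constant $C<\infty$ such that $$\int_{\mathbb{R}}|f|^2\le C\int_E|f|^2\qquad\text{for all } f\in L^2(\mathbb{R}) \text{ with } \widehat f=0 \text{ a.e. outside } S;$$ (ii) $E$ is thick, i.e. $(\Delta,\gamma)$-thick for some $\Delta,\gamma>0$. Moreover, for the fixed sequence $\Lambda$ and for all $\Delta,\gamma>0$, the constant in (i) can be taken to be a number $C=C(\gamma,\Delta)$ which is the same for all $(\Delta,\gamma)$-thick sets $E$.
   Context: Fourier transform: $\widehat f(\xi)=\int_{\mathbb{R}}f(x)e^{-2\pi i x\xi}\,dx$ (extended to $L^2(\mathbb{R})$). Thick set: a measurable set $E\subset\mathbb{R}$ is $(\Delta,\gamma)$-thick ($\Delta,\gamma>0$) if $|E\cap I|\ge\gamma|I|$ for every interval $I$ of length $\Delta$; it is thick if this holds for some $\Delta,\gamma>0$. Strong Zygmund lacunary: a real sequence $(\lambda_k)_{k=1}^\infty$ is $(M,N)$-strong Zygmund lacunary, where $M:\mathbb{N}\to\mathbb{N}$ is a function and $N<\infty$ is a constant, if for every $L\in\mathbb{N}=\{1,2,\dots\}$ and all $k\ne l$ with $k,l\ge M(L)$, $$\#\{(k',l'):\ k',l'\ge M(L),\ |\lambda_k-\lambda_l-(\lambda_{k'}-\lambda_{l'})|\le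 L\}\le N$$ (pairs with $k'=l'$ are included in the count). It is strong Zygmund lacunary if it is $(M,N)$-strong Zygmund lacunary for some such $M$ and $N$ (with $N$ independent of $L$). *)

theory Defs
  imports "HOL-Analysis.Analysis"
begin

definition L2 :: "(real \<Rightarrow> complex) set" where
  "L2 = {f. f \<in> borel_measurable lebesgue \<and> integrable lebesgue (\<lambda>x. (cmod (f x))\<^sup>2)}"

text \<open>The squared \<open>L\<^sup>2\<close>-distance is an extended nonnegative integral: a Bochner integral would be
  \<open>0\<close> for a difference that is not square-integrable.\<close>

definition tendsto_L2 :: "(nat \<Rightarrow> real \<Rightarrow> complex) \<Rightarrow> (real \<Rightarrow> complex) \<Rightarrow> bool" where
  "tendsto_L2 F f \<longleftrightarrow> (\<lambda>n. \<integral>\<^sup>+x. ennreal ((cmod (F n x - f x))\<^sup>2) \<partial>lebesgue) \<longlonglongrightarrow> 0"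

definition fourier :: "(real \<Rightarrow> complex) \<Rightarrow> real \<Rightarrow> complex" where
  "fourier f \<xi> = (LINT x|lebesgue. f x * exp (- 2 * of_real pi * \<i> * of_real x * of_real \<xi>))"

text \<open>Extension of \<^const>\<open>fourier\<close> by continuity from \<open>L\<^sup>1 \<inter> L\<^sup>2\<close> to \<open>L\<^sup>2\<close>. The transform is only
  determined up to null sets, hence a relation rather than a function. The approximants \<open>F n\<close> must be
  integrable, since \<^const>\<open>fourier\<close> takes the default value \<open>0\<close> on functions that are not.\<close>

definition has_fourier_L2 :: "(real \<Rightarrow> complex) \<Rightarrow> (real \<Rightarrow> complex) \<Rightarrow> bool" where
  "has_fourier_L2 f g \<longleftrightarrow> f \<in> L2 \<and> g \<in> L2 \<and>
     (\<exists>F. (\<forall>n. F n \<in> L2 \<and> integrable lebesgue (F n)) \<and>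
          tendsto_L2 F f \<and> tendsto_L2 (\<lambda>n. fourier (F n)) g)"

definition L2_spectrum_in :: "real set \<Rightarrow> (real \<Rightarrow> complex) set" where
  "L2_spectrum_in S =
     {f \<in> L2. \<exists>g. has_fourier_L2 f g \<and> (AE \<xi> in lebesgue. \<xi> \<notin> S \<longrightarrow> g \<xi> = 0)}"

text \<open>Closed intervals suffice, as the endpoints do not affect the measure.\<close>

definition thick_with :: "real \<Rightarrow> real \<Rightarrow> real set \<Rightarrow> bool" where
  "thick_with \<Delta> \<gamma> E \<longleftrightarrow> E \<in> sets lebesgue \<and> \<Delta> > 0 \<and> \<gamma> > 0 \<and>
     (\<forall>a. measure lebesgue (E \<inter> {a..a + \<Delta>}) \<ge> \<gamma> * \<Delta>)"

definition thick :: "real set \<Rightarrow> bool" where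
  "thick E \<longleftrightarrow> (\<exists>\<Delta> \<gamma>. thick_with \<Delta> \<gamma> E)"

text \<open>Sequences are indexed by \<open>k \<ge> 1\<close>; the value at \<open>0\<close> is irrelevant, because \<open>M L \<ge> 1\<close>.
  Finiteness is required explicitly since \<^const>\<open>card\<close> is \<open>0\<close> on infinite sets.\<close>

definition strong_Zygmund_lacunary_with ::
    "(nat \<Rightarrow> nat) \<Rightarrow> nat \<Rightarrow> (nat \<Rightarrow> real) \<Rightarrow> bool" where
  "strong_Zygmund_lacunary_with M N lam \<longleftrightarrow>
     (\<forall>L\<ge>1. M L \<ge> 1 \<and>
       (\<forall>k l. k \<noteq> l \<and> k \<ge> M L \<and> l \<ge> M L \<longrightarrow>
         (let P = {(k', l'). k' \<ge> M L \<and> l' \<ge> M L \<and>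
                     \<bar>lam k - lam l - (lam k' - lam l')\<bar> \<le> real L}
          in finite P \<and> card P \<le> N)))"

definition strong_Zygmund_lacunary :: "(nat \<Rightarrow> real) \<Rightarrow> bool" where
  "strong_Zygmund_lacunary lam \<longleftrightarrow> (\<exists>M N. strong_Zygmund_lacunary_with M N lam)"

text \<open>Both integrals are finite for \<open>f \<in> L\<^sup>2\<close> and
  Lebesgue measurable \<open>E\<close>.\<close>

definition norm_controlled :: "real set \<Rightarrow> real set \<Rightarrow> real \<Rightarrow> bool" where
  "norm_controlled S E C \<longleftrightarrow>
     (\<forall>f \<in> L2_spectrum_in S.
        (LINT x|lebesgue. (cmod (f x))\<^sup>2) \<le> C * (LINT x:E|lebesgue. (cmod (f x))\<^sup>2))"

end

theory Submission
  imports Defs "HOL-Probability.Probability" "HOL-Complex_Analysis.Complex_Analysis"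
    "HOL-Computational_Algebra.Fundamental_Theorem_Algebra"
begin

text \<open>
  That (i) implies (ii) is seen by testing the inequality on the translates of a single function whose
  spectrum is an interval of length 1.

  For the converse, only finitely many \<open>\<lambda>\<^sub>k\<close> fail to have large gaps and few coincidences among their
  differences; split \<open>f\<close> into the part with spectrum in those intervals and the remaining tail.
  Because the spectrum lies in a half-line, \<open>f\<close> extends to a Hardy space function on the upper half-plane,
  and log-subharmonicity bounds the weighted norm of its transform, hence the norm of the first
  part, by \<open>\<eta> \<parallel>f\<parallel>\<^sup>2 + C \<integral>\<^sub>E \<bar>f\<bar>\<^sup>2\<close>, where \<open>\<eta>\<close> is at our disposal.

  On a short window \<open>{y..y + r}\<close> the tail is close to an exponential sum with frequencies \<open>\<lambda>\<^sub>k\<close> and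
  coefficients depending on \<open>y\<close>. Exponential sums satisfy a lower bound on every subset \<open>X\<close> of the unit
  interval that depends only on \<open>\<bar>X\<bar>\<close>. If such a sum \<open>p\<close> with normalised coefficients were tiny on \<open>X\<close>, consider
  the shifts \<open>s\<close> for which \<open>p(x + s)\<close> is still tiny for most \<open>x \<in> X\<close>. By the Hilbert-Schmidt bound
  that expresses the Zygmund condition, the translates of \<open>p\<close> by these shifts span a space of bounded
  dimension, up to a small error, so a
  pigeonhole argument over scales makes the set of these shifts stable under extension. It is then the whole
  unit interval, against the fact that the average of \<open>\<bar>p(x + s)\<bar>\<^sup>2\<close> over the shifts is about 1.
\<close>

text \<open>The order in which the constants are fixed matters. The lower bound for exponential sums
  depends only on the density of \<open>X\<close> and the count \<open>N\<close>; it decides how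
  short the windows must be, and rescaling a window to the unit interval then decides which gap
  \<open>L\<close> the tail needs. This would be circular if \<open>N\<close> varied with
  \<open>L\<close>. Only after \<open>L\<close> is the finite set of exceptional frequencies known,
  and nothing controls how many they are or where they lie. Hence the first part needs an estimate
  whose error \<open>\<eta>\<close> can be chosen last: the error is a fraction of the full norm, it
  is magnified by the position of the exceptional intervals and by the tail estimate, and it must
  still be absorbed. Small powers of the modulus take the place of its logarithm in the Hardy space
  argument; unlike the logarithm they stay bounded at zeros.\<close>

section \<open>Characters, the transform \<open>ft\<close> and the class \<open>L12\<close>\<close>

definition expi :: "real \<Rightarrow> complex" where
  "expi x = cis (2 * pi * x)"

lemma norm_expi [simp]: "cmod (expi x) = 1"
  by (simp add: expi_def)

lemma expi_0 [simp]: "expi 0 = 1"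
  by (simp add: expi_def)

lemma expi_add: "expi (x + y) = expi x * expi y"
  by (simp add: expi_def cis_mult ring_distribs)

lemma cnj_expi [simp]: "cnj (expi x) = expi (- x)"
  by (simp add: expi_def cis_cnj)

lemma expi_diff: "expi (x - y) = expi x * cnj (expi y)"
  by (metis cnj_expi diff_conv_add_uminus expi_add)

lemma expi_diff_mult:
  "expi ((a - b) * x) = expi (a * x) * cnj (expi (b * x))"
  "expi (x * (a - b)) = expi (x * a) * cnj (expi (x * b))"
  by (simp_all add: left_diff_distrib right_diff_distrib expi_diff)

lemma continuous_on_expi [continuous_intros]:
  "continuous_on A f \<Longrightarrow> continuous_on A (\<lambda>x. expi (f x))"
  unfolding expi_def by (intro continuous_intros)

lemma isCont_expi [continuous_intros]: "isCont f x \<Longrightarrow> isCont (\<lambda>x. expi (f x)) x"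
proof -
  have "continuous_on UNIV expi" by (intro continuous_intros)
  then have "isCont expi (f x)" by (simp add: continuous_on_eq_continuous_at)
  then show "isCont f x \<Longrightarrow> isCont (\<lambda>x. expi (f x)) x" by (rule isCont_o2[rotated])
qed

lemma measurable_expi [measurable]: "expi \<in> borel_measurable borel"
  by (intro borel_measurable_continuous_onI continuous_intros)

lemma measurable_cnj [measurable]: "cnj \<in> borel_measurable borel"
  by (intro borel_measurable_continuous_onI continuous_intros)

lemma norm_expi_diff_le: "cmod (expi x - expi y) \<le> 2 * pi * \<bar>x - y\<bar>"
proof -
  have "expi x - expi y = expi y * (expi (x - y) - 1)"
    using expi_add[of y "x - y"] by (simp add: algebra_simps)
  then have "cmod (expi x - expi y) = cmod (expi (x - y) - 1)"
    by (simp add: norm_mult)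
  also have "\<dots> = 2 * \<bar>sin (2 * pi * (x - y) / 2)\<bar>"
    using dist_exp_i_1[of "2 * pi * (x - y)"] by (simp add: expi_def cis_conv_exp)
  also have "\<dots> \<le> 2 * \<bar>2 * pi * (x - y) / 2\<bar>"
    by (intro mult_left_mono abs_sin_x_le_abs_x) auto
  finally show ?thesis by (simp add: abs_mult)
qed

text \<open>The inverse Fourier transform: a function with spectrum in \<open>S\<close> is approximated by
  \<open>ft h\<close> with \<open>h\<close> supported in \<open>S\<close>.\<close>

definition ft :: "(real \<Rightarrow> complex) \<Rightarrow> real \<Rightarrow> complex" where
  "ft g x = (LINT \<xi>|lborel. g \<xi> * expi (x * \<xi>))"

text \<open>On this class \<open>ft\<close> is an honest integral and Plancherel applies; general
  square integrable functions are reached by approximation.\<close>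

definition L12 :: "(real \<Rightarrow> complex) \<Rightarrow> bool" where
  "L12 g \<longleftrightarrow> integrable lborel g \<and> integrable lborel (\<lambda>x. (cmod (g x))\<^sup>2)"

definition sqn :: "(real \<Rightarrow> complex) \<Rightarrow> real" where
  "sqn g = (LINT x|lborel. (cmod (g x))\<^sup>2)"

lemma sqn_nonneg [simp]: "0 \<le> sqn g"
  by (simp add: sqn_def)

lemma measurable_ft [measurable]:
  assumes [measurable]: "g \<in> borel_measurable borel"
  shows "ft g \<in> borel_measurable borel"
proof -
  have "(\<lambda>x. LINT \<xi>|lborel. g \<xi> * expi (x * \<xi>)) \<in> borel_measurable borel"
    by (rule lborel.borel_measurable_lebesgue_integral) measurable
  then show ?thesis by (simp add: ft_def[abs_def])
qed

lemma L12_measurable: "L12 g \<Longrightarrow> g \<in> borel_measurable borel"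
  by (auto simp: L12_def dest: borel_measurable_integrable)

lemma integrable_mult_bounded:
  fixes f k :: "real \<Rightarrow> complex"
  assumes "integrable lborel f" and [measurable]: "k \<in> borel_measurable borel"
    and "\<And>x. cmod (k x) \<le> C"
  shows "integrable lborel (\<lambda>x. f x * k x)"
proof (rule Bochner_Integration.integrable_bound)
  show "integrable lborel (\<lambda>x. C * norm (f x))" using assms by auto
  show "(\<lambda>x. f x * k x) \<in> borel_measurable lborel"
    using borel_measurable_integrable[OF assms(1)] by measurable
  show "AE x in lborel. norm (f x * k x) \<le> norm (C * norm (f x))"
  proof (intro AE_I2)
    fix x
    have "cmod (f x) * cmod (k x) \<le> cmod (f x) * \<bar>C\<bar>"
      by (intro mult_left_mono order_trans[OF assms(3) abs_ge_self]) auto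
    then show "norm (f x * k x) \<le> norm (C * norm (f x))"
      by (simp add: norm_mult abs_mult mult.commute)
  qed
qed

lemma norm_ft_le:
  assumes "integrable lborel g"
  shows "cmod (ft g x) \<le> (LINT \<xi>|lborel. cmod (g \<xi>))"
proof -
  have "cmod (ft g x) \<le> (LINT \<xi>|lborel. norm (g \<xi> * expi (x * \<xi>)))"
    unfolding ft_def by (rule integral_norm_bound)
  then show ?thesis by (simp add: norm_mult)
qed

lemma ft_integrand_integrable: "integrable lborel g \<Longrightarrow> integrable lborel (\<lambda>\<xi>. g \<xi> * expi (x * \<xi>))"
  by (rule integrable_mult_bounded[where C = 1]) auto

lemma isCont_ft:
  assumes "integrable lborel g"
  shows "isCont (ft g) x"
proof -
  have [measurable]: "g \<in> borel_measurable borel" using assms by (auto dest: borel_measurable_integrable)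
  have "(\<lambda>n. ft g (u n)) \<longlonglongrightarrow> ft g x" if "u \<longlonglongrightarrow> x" for u
    unfolding ft_def
  proof (rule integral_dominated_convergence[where w = "\<lambda>\<xi>. cmod (g \<xi>)"])
    show "AE \<xi> in lborel. (\<lambda>n. g \<xi> * expi (u n * \<xi>)) \<longlonglongrightarrow> g \<xi> * expi (x * \<xi>)"
      by (intro AE_I2 tendsto_intros isCont_tendsto_compose[where g = expi] that)
        (auto intro!: continuous_intros simp: continuous_ident)
  qed (use assms in \<open>auto simp: norm_mult\<close>)
  then show ?thesis by (auto simp: continuous_at_sequentially comp_def)
qed

lemma ft_add: "integrable lborel f \<Longrightarrow> integrable lborel g \<Longrightarrow> ft (\<lambda>x. f x + g x) y = ft f y + ft g y"
  unfolding ft_def by (subst Bochner_Integration.integral_add[symmetric])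
    (auto intro!: ft_integrand_integrable simp: ring_distribs)

lemma ft_diff: "integrable lborel f \<Longrightarrow> integrable lborel g \<Longrightarrow> ft (\<lambda>x. f x - g x) y = ft f y - ft g y"
  unfolding ft_def by (subst Bochner_Integration.integral_diff[symmetric])
    (auto intro!: ft_integrand_integrable simp: ring_distribs)

lemma ft_cmult: "ft (\<lambda>x. c * f x) y = c * ft f y"
  unfolding ft_def by (simp add: mult.assoc)

lemma ft_modulate: "ft (\<lambda>\<xi>. f \<xi> * expi (a * \<xi>)) y = ft f (y + a)"
  unfolding ft_def by (simp add: mult.assoc expi_add[symmetric] ring_distribs add.commute)

lemma ft_sum:
  assumes "finite K" "\<And>k. k \<in> K \<Longrightarrow> integrable lborel (f k)"
  shows "ft (\<lambda>x. \<Sum>k\<in>K. f k x) y = (\<Sum>k\<in>K. ft (f k) y)"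
  unfolding ft_def using assms
  by (simp add: sum_distrib_right Bochner_Integration.integral_sum ft_integrand_integrable)

lemma L12_cong_norm:
  assumes "L12 g" and [measurable]: "h \<in> borel_measurable borel" and "\<And>x. cmod (h x) \<le> cmod (g x)"
  shows "L12 h"
  unfolding L12_def
proof
  show "integrable lborel h"
    by (rule Bochner_Integration.integrable_bound[of _ g]) (use assms in \<open>auto simp: L12_def\<close>)
  show "integrable lborel (\<lambda>x. (cmod (h x))\<^sup>2)"
    by (rule Bochner_Integration.integrable_bound[of _ "\<lambda>x. (cmod (g x))\<^sup>2"])
      (use assms in \<open>auto simp: L12_def power_mono\<close>)
qed

lemma square_add_le: "(cmod (a + b))\<^sup>2 \<le> 2 * (cmod a)\<^sup>2 + 2 * (cmod b)\<^sup>2"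
proof -
  have "(cmod (a + b))\<^sup>2 \<le> (cmod a + cmod b)\<^sup>2"
    by (intro power_mono norm_triangle_ineq) auto
  also have "\<dots> \<le> 2 * (cmod a)\<^sup>2 + 2 * (cmod b)\<^sup>2"
    using sum_squares_bound[of "cmod a" "cmod b"] by (simp add: power2_sum)
  finally show ?thesis .
qed

lemma square_diff_le: "(cmod (a - b))\<^sup>2 \<le> 2 * (cmod a)\<^sup>2 + 2 * (cmod b)\<^sup>2"
  using square_add_le[of a "- b"] by simp

lemma integrable_sq_add:
  fixes f g :: "real \<Rightarrow> complex"
  assumes [measurable]: "f \<in> borel_measurable M" "g \<in> borel_measurable M"
    and "integrable M (\<lambda>x. (cmod (f x))\<^sup>2)" "integrable M (\<lambda>x. (cmod (g x))\<^sup>2)"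
  shows "integrable M (\<lambda>x. (cmod (f x + g x))\<^sup>2)"
  by (rule Bochner_Integration.integrable_bound[of _ "\<lambda>x. 2 * (cmod (f x))\<^sup>2 + 2 * (cmod (g x))\<^sup>2"])
    (use assms square_add_le in \<open>auto intro!: AE_I2\<close>)

lemma integrable_sq_diff:
  fixes f g :: "real \<Rightarrow> complex"
  assumes [measurable]: "f \<in> borel_measurable M" "g \<in> borel_measurable M"
    and "integrable M (\<lambda>x. (cmod (f x))\<^sup>2)" "integrable M (\<lambda>x. (cmod (g x))\<^sup>2)"
  shows "integrable M (\<lambda>x. (cmod (f x - g x))\<^sup>2)"
  using integrable_sq_add[of f M "\<lambda>x. - g x"] assms by simp

lemma integrable_sq_prod:
  fixes f g :: "real \<Rightarrow> complex"
  assumes [measurable]: "f \<in> borel_measurable M" "g \<in> borel_measurable M"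
    and "integrable M (\<lambda>x. (cmod (f x))\<^sup>2)" "integrable M (\<lambda>x. (cmod (g x))\<^sup>2)"
  shows "integrable M (\<lambda>x. f x * g x)"
proof (rule Bochner_Integration.integrable_bound[of _ "\<lambda>x. (cmod (f x))\<^sup>2 + (cmod (g x))\<^sup>2"])
  have "cmod a * cmod b \<le> (cmod a)\<^sup>2 + (cmod b)\<^sup>2" for a b
    using order_trans[OF _ sum_squares_bound[of "cmod a" "cmod b"], of "cmod a * cmod b"] by simp
  then show "AE x in M. norm (f x * g x) \<le> norm ((cmod (f x))\<^sup>2 + (cmod (g x))\<^sup>2)"
    by (intro AE_I2) (auto simp: norm_mult)
qed (use assms in auto)

section \<open>Plancherel's identity\<close>

text \<open>Outer regularity replaces \<open>A\<close> by an open \<open>U\<close>, whose points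
  stay in \<open>U\<close> under small shifts. This controls only the mass that leaves
  \<open>U\<close>; the mass that enters is the same, as translation preserves measure.\<close>

lemma translation_continuous_indicator:
  fixes A :: "real set"
  assumes A: "A \<in> sets borel" "emeasure lborel A < \<infinity>" and v: "v \<longlonglongrightarrow> (0::real)"
  shows "(\<lambda>n. LINT x|lborel. \<bar>indicator A (x + v n) - indicator A x :: real\<bar>) \<longlonglongrightarrow> 0"
proof (rule LIMSEQ_I)
  fix e :: real assume "e > 0"
  note [measurable] = A(1)
  obtain U where U: "open U" "A \<subseteq> U" "emeasure lborel (U - A) < ennreal (e / 6)"
    using outer_regular_lborel[of A "e / 6"] A(1) \<open>e > 0\<close> by auto
  note [measurable] = borel_open[OF U(1)]
  have fA: "emeasure lborel (U - A) < \<infinity>" using U(3) ennreal_less_top[of "e / 6"] by (auto intro: less_trans)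
  have "emeasure lborel U \<le> emeasure lborel A + emeasure lborel (U - A)"
    using emeasure_subadditive[of A lborel "U - A"] U(2) A(1) by (simp add: Un_absorb1)
  then have fU: "emeasure lborel U < \<infinity>" using fA A(2)
    by (metis ennreal_add_eq_top infinity_ennreal_def order_le_less_trans top.not_eq_extremum)
  have int: "integrable lborel (\<lambda>x. indicator B (x + t) :: real)"
    if "B \<in> sets borel" "emeasure lborel B < \<infinity>" for B and t :: real
    using lborel_integrable_real_affine[of "indicator B :: real \<Rightarrow> real" 1 t] that
    by (simp add: add.commute)
  have intv: "(LINT x|lborel. indicator B (x + t) :: real) = measure lborel B"
    if "B \<in> sets borel" "emeasure lborel B < \<infinity>" for B and t :: real
    using lborel_integral_real_affine[of 1 "indicator B :: real \<Rightarrow> real" t] that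
    by (simp add: add.commute)
  have lim: "(\<lambda>n. LINT x|lborel. max 0 (indicator U x - indicator U (x + v n) :: real)) \<longlonglongrightarrow> (LINT x|(lborel::real measure). (0::real))"
  proof (rule integral_dominated_convergence[where w = "indicator U"])
    show "AE x in lborel. (\<lambda>n. max 0 (indicator U x - indicator U (x + v n) :: real)) \<longlonglongrightarrow> 0"
    proof (intro AE_I2)
      fix x
      show "(\<lambda>n. max 0 (indicator U x - indicator U (x + v n) :: real)) \<longlonglongrightarrow> 0"
      proof (cases "x \<in> U")
        case True
        have "(\<lambda>n. x + v n) \<longlonglongrightarrow> x" using tendsto_add[OF tendsto_const v] by simp
        from topological_tendstoD[OF this U(1) True]
        have "eventually (\<lambda>n. x + v n \<in> U) sequentially" .
        then have "eventually (\<lambda>n. max 0 (indicator U x - indicator U (x + v n) :: real) = 0) sequentially"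
          by eventually_elim (use True in auto)
        then show ?thesis by (simp add: tendsto_eventually)
      next
        case False
        then have "max 0 (indicator U x - indicator U (x + v n) :: real) = 0" for n
          by (auto simp: indicator_def)
        then show ?thesis by simp
      qed
    qed
    show "integrable lborel (indicator U :: real \<Rightarrow> real)" using fU by simp
  qed (auto intro!: AE_I2 simp: indicator_def)
  then obtain n0 where n0: "\<And>n. n \<ge> n0 \<Longrightarrow> (LINT x|lborel. max 0 (indicator U x - indicator U (x + v n) :: real)) < e / 3"
    using LIMSEQ_D[OF lim, of "e / 3"] \<open>e > 0\<close> by (auto simp: abs_less_iff)
  have "(LINT x|lborel. \<bar>indicator A (x + v n) - indicator A x :: real\<bar>) < e" if n: "n \<ge> n0" for n
  proof -
    let ?m = "\<lambda>x. max 0 (indicator U x - indicator U (x + v n) :: real)"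
    \<comment> \<open>Uses \<bar>s\<bar> = 2 * max 0 (- s) + s for s = indicator U (x + v n) -
      indicator U x, whose integral is 0.\<close>
    let ?b = "\<lambda>x. indicator (U - A) (x + v n) + indicator (U - A) x + (2 * ?m x + (indicator U (x + v n) - indicator U (x + 0))) :: real"
    have im: "integrable lborel ?m"
      by (rule Bochner_Integration.integrable_bound[of _ "indicator U :: real \<Rightarrow> real"])
        (use fU in \<open>auto intro!: AE_I2 simp: indicator_def\<close>)
    have "(LINT x|lborel. \<bar>indicator A (x + v n) - indicator A x :: real\<bar>) \<le> (LINT x|lborel. ?b x)"
    proof (rule integral_mono_AE)
      show "integrable lborel (\<lambda>x. \<bar>indicator A (x + v n) - indicator A x :: real\<bar>)"
        using int[OF A, of "v n"] int[OF A, of 0] by auto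
      show "integrable lborel ?b" using int[of "U - A" "v n"] int[of "U - A" 0] int[of U "v n"] int[of U 0] im fA fU
        by (intro Bochner_Integration.integrable_add Bochner_Integration.integrable_diff integrable_mult_right) auto
      show "AE x in lborel. \<bar>indicator A (x + v n) - indicator A x :: real\<bar> \<le> ?b x"
        using U(2) by (intro AE_I2) (auto simp: indicator_def max_def)
    qed
    also have "\<dots> = measure lborel (U - A) + measure lborel (U - A) + 2 * (LINT x|lborel. ?m x)"
      using int[of "U - A" "v n"] int[of "U - A" 0] int[of U "v n"] int[of U 0] im fA fU
        intv[of "U - A" "v n"] intv[of "U - A" 0] intv[of U "v n"] intv[of U 0]
      by simp
    also have "measure lborel (U - A) < e / 6"
      using U(3) \<open>e > 0\<close> by (metis emeasure_eq_ennreal_measure ennreal_less_iff fA infinity_ennreal_def less_irrefl measure_nonneg)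
    finally show ?thesis using n0[OF n] by simp
  qed
  then show "\<exists>no. \<forall>n\<ge>no. norm ((LINT x|lborel. \<bar>indicator A (x + v n) - indicator A x :: real\<bar>) - 0) < e"
    by (intro exI[of _ n0]) auto
qed

lemma translation_continuous_L1:
  fixes f :: "real \<Rightarrow> complex"
  assumes "integrable lborel f" and v: "v \<longlonglongrightarrow> (0::real)"
  shows "(\<lambda>n. LINT x|lborel. cmod (f (x + v n) - f x)) \<longlonglongrightarrow> 0"
  using assms(1)
proof (induction rule: integrable_induct)
  case (base A c)
  have "cmod (indicator A (x + v n) *\<^sub>R c - indicator A x *\<^sub>R c) = \<bar>indicator A (x + v n) - indicator A x\<bar> * cmod c" for x n
    by (simp add: scaleR_diff_left[symmetric])
  then show ?case
    using tendsto_mult_right[OF translation_continuous_indicator[OF _ base(2) v], of "cmod c"] base(1) by simp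
next
  case (add f g)
  have t: "integrable lborel (\<lambda>x. h (x + t))" if "integrable lborel h" for h :: "real \<Rightarrow> complex" and t
    using lborel_integrable_real_affine[OF that, of 1 t] by (simp add: add.commute)
  show ?case
  proof (rule tendsto_sandwich[OF _ _ tendsto_const tendsto_add[OF add.IH, simplified]])
    show "\<forall>\<^sub>F n in sequentially. (LINT x|lborel. cmod (f (x + v n) + g (x + v n) - (f x + g x))) \<le>
      (LINT x|lborel. cmod (f (x + v n) - f x)) + (LINT x|lborel. cmod (g (x + v n) - g x))"
    proof (intro always_eventually allI)
      fix n
      have "(LINT x|lborel. cmod (f (x + v n) + g (x + v n) - (f x + g x))) \<le>
         (LINT x|lborel. cmod (f (x + v n) - f x) + cmod (g (x + v n) - g x))"
        using add.hyps by (intro integral_mono integrable_norm Bochner_Integration.integrable_add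
          Bochner_Integration.integrable_diff t norm_diff_triangle_ineq)
      also have "\<dots> = (LINT x|lborel. cmod (f (x + v n) - f x)) + (LINT x|lborel. cmod (g (x + v n) - g x))"
        using add.hyps by (intro Bochner_Integration.integral_add integrable_norm Bochner_Integration.integrable_diff t)
      finally show "(LINT x|lborel. cmod (f (x + v n) + g (x + v n) - (f x + g x))) \<le>
      (LINT x|lborel. cmod (f (x + v n) - f x)) + (LINT x|lborel. cmod (g (x + v n) - g x))" .
    qed
  qed auto
next
  case (lim f s)
  have t: "integrable lborel (\<lambda>x. h (x + t))" if "integrable lborel h" for h :: "real \<Rightarrow> complex" and t
    using lborel_integrable_real_affine[OF that, of 1 t] by (simp add: add.commute)
  have "(\<lambda>i. LINT x|lborel. cmod (s i x - f x)) \<longlonglongrightarrow> (LINT x|(lborel::real measure). (0::real))"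
  \<comment> \<open>The approximants supplied by the induction rule satisfy cmod (s i x) \<le> 2 *
    cmod (f x).\<close>
  proof (rule integral_dominated_convergence[where w = "\<lambda>x. 3 * cmod (f x)"])
    show "AE x in lborel. (\<lambda>i. cmod (s i x - f x)) \<longlonglongrightarrow> 0"
    proof (intro AE_I2)
      fix x show "(\<lambda>i. cmod (s i x - f x)) \<longlonglongrightarrow> 0"
        using tendsto_norm[OF tendsto_diff[OF lim.hyps(2)[of x] tendsto_const[of "f x"]]] by simp
    qed
    show "AE x in lborel. norm (cmod (s i x - f x)) \<le> 3 * cmod (f x)" for i
    proof (intro AE_I2)
      fix x show "norm (cmod (s i x - f x)) \<le> 3 * cmod (f x)"
        using norm_triangle_ineq4[of "s i x" "f x"] lim.hyps(3)[of x i] by simp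
    qed
  qed (use lim.hyps(1,4) in auto)
  then have sl: "(\<lambda>i. LINT x|lborel. cmod (s i x - f x)) \<longlonglongrightarrow> 0" by simp
  show ?case
  proof (rule LIMSEQ_I)
    fix e :: real assume e: "e > 0"
    obtain i where i: "(LINT x|lborel. cmod (s i x - f x)) < e / 3"
      using LIMSEQ_D[OF sl, of "e / 3"] e by (auto simp: abs_less_iff)
    obtain n0 where n0: "\<And>n. n \<ge> n0 \<Longrightarrow> (LINT x|lborel. cmod (s i (x + v n) - s i x)) < e / 3"
      using LIMSEQ_D[OF lim.IH[of i], of "e / 3"] e by (auto simp: abs_less_iff)
    have "(LINT x|lborel. cmod (f (x + v n) - f x)) < e" if n: "n \<ge> n0" for n
    proof -
      have eq: "(LINT x|lborel. cmod (s i (x + v n) - f (x + v n))) = (LINT x|lborel. cmod (s i x - f x))"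
        using lborel_integral_real_affine[of 1 "\<lambda>x. cmod (s i x - f x)" "v n"] by (simp add: add.commute)
      have "(LINT x|lborel. cmod (f (x + v n) - f x)) \<le> (LINT x|lborel. cmod (s i (x + v n) - f (x + v n)) +
          cmod (s i (x + v n) - s i x) + cmod (s i x - f x))"
      proof (rule integral_mono)
        show "cmod (f (x + v n) - f x) \<le> cmod (s i (x + v n) - f (x + v n)) + cmod (s i (x + v n) - s i x) + cmod (s i x - f x)" for x
          by (smt (verit) norm_minus_commute norm_triangle_sub norm_diff_triangle_le)
      qed (use lim.hyps(1,4) t in \<open>auto intro!: integrable_norm Bochner_Integration.integrable_add Bochner_Integration.integrable_diff\<close>)
      also have "\<dots> = (LINT x|lborel. cmod (s i (x + v n) - f (x + v n))) +
          (LINT x|lborel. cmod (s i (x + v n) - s i x)) + (LINT x|lborel. cmod (s i x - f x))"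
        using lim.hyps(1,4) t by (simp add: integrable_norm)
      also have "\<dots> < e" using eq i n0[OF n] by simp
      finally show ?thesis .
    qed
    then show "\<exists>no. \<forall>n\<ge>no. norm ((LINT x|lborel. cmod (f (x + v n) - f x)) - 0) < e"
      by (intro exI[of _ n0]) auto
  qed
qed

lemma shift_sq:
  fixes g :: "real \<Rightarrow> complex"
  assumes "integrable lborel (\<lambda>x. (cmod (g x))\<^sup>2)"
  shows "integrable lborel (\<lambda>x. (cmod (g (x + t)))\<^sup>2)" "sqn (\<lambda>x. g (x + t)) = sqn g"
  using lborel_integrable_real_affine[OF assms, of 1 t]
    lborel_integral_real_affine[of 1 "\<lambda>x. (cmod (g x))\<^sup>2" t]
  by (simp_all add: add.commute sqn_def)

text \<open>As \<open>g\<close> may be unbounded, continuity in the mean is used only where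
  \<open>cmod (g x)\<close> is at most \<open>M\<close>. On the remaining set the product is split
  by a * b \<le> a^2 / (2 d) + d * b^2 / 2, where the first term integrates to a small tail energy
  and the second is at most 2 d times \<open>sqn g\<close>.\<close>

lemma autocorrelation_continuous:
  assumes g: "L12 g" and v: "v \<longlonglongrightarrow> (0::real)"
  shows "(\<lambda>n. LINT x|lborel. g x * cnj (g (x + v n))) \<longlonglongrightarrow> of_real (sqn g)"
proof (rule LIMSEQ_I)
  fix e :: real assume e: "e > 0"
  have i1: "integrable lborel g" and i2: "integrable lborel (\<lambda>x. (cmod (g x))\<^sup>2)" using g by (auto simp: L12_def)
  note [measurable] = L12_measurable[OF g]
  define d where "d = e / (8 * (1 + sqn g))"
  have d: "d > 0" using e by (simp add: d_def add_pos_nonneg)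
  have dd: "4 * d * sqn g < e / 2 + 1 * 0"
    using e unfolding d_def by (simp add: field_simps add_pos_nonneg)
  let ?t = "\<lambda>M x. indicator {x. cmod (g x) > real M} x * (cmod (g x))\<^sup>2"
  have "(\<lambda>M. LINT x|lborel. ?t M x) \<longlonglongrightarrow> (LINT x|(lborel::real measure). (0::real))"
  proof (rule integral_dominated_convergence[where w = "\<lambda>x. (cmod (g x))\<^sup>2" and s = "?t" and f = "\<lambda>x. 0"])
    show "AE x in lborel. (\<lambda>M. ?t M x) \<longlonglongrightarrow> 0"
    proof (intro AE_I2 tendsto_eventually)
      fix x
      obtain m :: nat where m: "cmod (g x) < real m" using reals_Archimedean2 by auto
      show "\<forall>\<^sub>F M in sequentially. ?t M x = 0"
        unfolding eventually_sequentially by (rule exI[of _ m]) (use m in \<open>auto simp: indicator_def\<close>)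
    qed
  qed (use i2 in \<open>auto intro!: AE_I2 simp: indicator_def\<close>)
  then obtain M :: nat where M: "(LINT x|lborel. ?t M x) < d * e / 2"
    using LIMSEQ_D[of "\<lambda>M. LINT x|lborel. ?t M x" 0 "d * e / 2"] e d by (auto simp: abs_less_iff)
  have M0: "0 \<le> (LINT x|lborel. ?t M x)" by simp
  obtain n0 where n0: "\<And>n. n \<ge> n0 \<Longrightarrow> (LINT x|lborel. cmod (g (x + v n) - g x)) < e / (4 * (real M + 1))"
    using LIMSEQ_D[OF translation_continuous_L1[OF i1 v], of "e / (4 * (real M + 1))"] e by (auto simp: abs_less_iff)
  have "cmod ((LINT x|lborel. g x * cnj (g (x + v n))) - of_real (sqn g)) < e" if n: "n \<ge> n0" for n
  proof -
    have it: "integrable lborel (\<lambda>x. g (x + v n))"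
      using lborel_integrable_real_affine[OF i1, of 1 "v n"] by (simp add: add.commute)
    note it2 = shift_sq[OF i2, of "v n"]
    have A1: "integrable lborel (\<lambda>x. g x * cnj (g (x + v n)))" using i2 it2
      by (intro integrable_sq_prod) auto
    have A2: "integrable lborel (\<lambda>x. g x * cnj (g x))" using i2
      by (intro integrable_sq_prod) auto
    have A3: "integrable lborel (\<lambda>x. (cmod (g (x + v n) - g x))\<^sup>2)"
      using i2 it2 by (intro integrable_sq_diff) auto
    have sq: "sqn (\<lambda>x. g (x + v n) - g x) \<le> 4 * sqn g"
    proof -
      have "sqn (\<lambda>x. g (x + v n) - g x) \<le> (LINT x|lborel. 2 * (cmod (g (x + v n)))\<^sup>2 + 2 * (cmod (g x))\<^sup>2)"
        unfolding sqn_def using A3 i2 it2 square_diff_le by (intro integral_mono) auto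
      also have "\<dots> = 4 * sqn g" using i2 it2 by (simp add: sqn_def)
      finally show ?thesis .
    qed
    have "(LINT x|lborel. g x * cnj (g (x + v n))) - of_real (sqn g)
      = (LINT x|lborel. g x * cnj (g (x + v n))) - (LINT x|lborel. g x * cnj (g x))"
      unfolding sqn_def by (subst integral_complex_of_real[symmetric]) (simp only: complex_norm_square)
    also have "\<dots> = (LINT x|lborel. g x * cnj (g (x + v n) - g x))"
      using A1 A2 by (simp add: ring_distribs)
    finally have "cmod ((LINT x|lborel. g x * cnj (g (x + v n))) - of_real (sqn g))
      \<le> (LINT x|lborel. norm (g x * cnj (g (x + v n) - g x)))" by (simp only: integral_norm_bound)
    also have "\<dots> \<le> (LINT x|lborel. (real M + 1) * cmod (g (x + v n) - g x) + (1 / (2 * d) * ?t M x + d / 2 * (cmod (g (x + v n) - g x))\<^sup>2))"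
    proof (rule integral_mono)
      show "integrable lborel (\<lambda>x. norm (g x * cnj (g (x + v n) - g x)))"
        using A1 A2 by (auto simp: ring_distribs)
      have "integrable lborel (?t M)"
        by (rule Bochner_Integration.integrable_bound[OF i2]) (auto simp: indicator_def)
      then show "integrable lborel (\<lambda>x. (real M + 1) * cmod (g (x + v n) - g x) + (1 / (2 * d) * ?t M x + d / 2 * (cmod (g (x + v n) - g x))\<^sup>2))"
        using it i1 A3 by (intro Bochner_Integration.integrable_add integrable_mult_right integrable_norm Bochner_Integration.integrable_diff)
      fix x
      let ?a = "cmod (g x)" and ?b = "cmod (g (x + v n) - g x)"
      have "norm (g x * cnj (g (x + v n) - g x)) = ?a * ?b"
        by (simp only: norm_mult complex_mod_cnj)
      also have "\<dots> \<le> (real M + 1) * ?b + (1 / (2 * d) * ?t M x + d / 2 * ?b\<^sup>2)"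
      proof (cases "?a > real M")
        case True
        have "0 \<le> (?a - d * ?b)\<^sup>2 / (2 * d)" using d by simp
        also have "\<dots> = 1 / (2 * d) * ?a\<^sup>2 + d / 2 * ?b\<^sup>2 - ?a * ?b"
          using d by (simp add: field_simps power2_eq_square)
        finally show ?thesis using True by (simp add: add_increasing)
      next
        case False
        then have "?a * ?b \<le> (real M + 1) * ?b" by (intro mult_right_mono) auto
        then show ?thesis using False d by (simp add: add_increasing2)
      qed
      finally show "norm (g x * cnj (g (x + v n) - g x)) \<le> (real M + 1) * ?b + (1 / (2 * d) * ?t M x + d / 2 * ?b\<^sup>2)" .
    qed
    also have "\<dots> = (real M + 1) * (LINT x|lborel. cmod (g (x + v n) - g x)) + (1 / (2 * d) * (LINT x|lborel. ?t M x) + d / 2 * sqn (\<lambda>x. g (x + v n) - g x))"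
    proof -
      have "integrable lborel (?t M)"
        by (rule Bochner_Integration.integrable_bound[OF i2]) (auto simp: indicator_def)
      then show ?thesis using it i1 A3 unfolding sqn_def
        by (subst Bochner_Integration.integral_add, simp, simp, subst Bochner_Integration.integral_add) auto
    qed
    also have "\<dots> < e / 4 + (e / 4 + e / 4)"
    proof -
      have a: "(real M + 1) * (LINT x|lborel. cmod (g (x + v n) - g x)) < e / 4"
        using n0[OF n] by (simp add: field_simps)
      have b: "1 / (2 * d) * (LINT x|lborel. ?t M x) < e / 4"
        using M d by (simp add: field_simps)
      have "d / 2 * sqn (\<lambda>x. g (x + v n) - g x) \<le> d / 2 * (4 * sqn g)"
        using sq d by (intro mult_left_mono) auto
      then have c: "d / 2 * sqn (\<lambda>x. g (x + v n) - g x) \<le> e / 4" using dd by simp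
      show ?thesis using a b c by linarith
    qed
    finally show ?thesis using e by simp
  qed
  then show "\<exists>no. \<forall>n\<ge>no. norm ((LINT x|lborel. g x * cnj (g (x + v n))) - of_real (sqn g)) < e"
    by (intro exI[of _ n0]) auto
qed

text \<open>The exchange of integrals used for exponential kernels: the bound on \<open>k\<close>
  reduces joint integrability to that of a product.\<close>

lemma fubini_bounded_kernel:
  fixes a b :: "real \<Rightarrow> complex" and k :: "real \<Rightarrow> real \<Rightarrow> complex"
  assumes a: "integrable lborel a" and b: "integrable lborel b"
    and [measurable]: "case_prod k \<in> borel_measurable (borel \<Otimes>\<^sub>M borel)"
    and k: "\<And>x y. cmod (k x y) \<le> 1"
  shows "(LINT x|lborel. a x * (LINT y|lborel. b y * k x y)) = (LINT y|lborel. b y * (LINT x|lborel. a x * k x y))"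
proof -
  note [measurable] = borel_measurable_integrable[OF a] borel_measurable_integrable[OF b]
  have k1: "(\<lambda>y. k x y) \<in> borel_measurable borel" "(\<lambda>x. k x y) \<in> borel_measurable borel" for x y
    using measurable_compose[OF measurable_Pair1'[of x borel borel] assms(3)]
      measurable_compose[OF measurable_Pair2'[of y borel borel] assms(3)] by simp_all
  have "integrable (lborel \<Otimes>\<^sub>M lborel) (\<lambda>(x, y). a x * (b y * k x y))"
  proof (rule lborel_pair.Fubini_integrable)
    show "AE x in lborel. integrable lborel (\<lambda>y. case (x, y) of (x, y) \<Rightarrow> a x * (b y * k x y))"
      using integrable_mult_bounded[OF b k1(1) k] by auto
    show "integrable lborel (\<lambda>x. LINT y|lborel. norm (case (x, y) of (x, y) \<Rightarrow> a x * (b y * k x y)))"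
    proof (rule Bochner_Integration.integrable_bound)
      show "integrable lborel (\<lambda>x. cmod (a x) * (LINT y|lborel. cmod (b y)))" using a by auto
      show "AE x in lborel. norm (LINT y|lborel. norm (case (x, y) of (x, y) \<Rightarrow> a x * (b y * k x y)))
        \<le> norm (cmod (a x) * (LINT y|lborel. cmod (b y)))"
      proof (intro AE_I2)
        fix x
        have "(LINT y|lborel. cmod (b y * k x y)) \<le> (LINT y|lborel. cmod (b y))"
          using b integrable_mult_bounded[OF b k1(1)[of x] k]
          by (intro integral_mono integrable_norm) (auto simp: norm_mult k intro!: mult_left_le)
        then show "norm (LINT y|lborel. norm (case (x, y) of (x, y) \<Rightarrow> a x * (b y * k x y)))
        \<le> norm (cmod (a x) * (LINT y|lborel. cmod (b y)))"
          by (simp add: norm_mult abs_mult mult_left_mono)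
      qed
    qed measurable
  qed measurable
  from lborel_pair.Fubini_integral[OF this]
  have "(LINT x|lborel. LINT y|lborel. a x * (b y * k x y)) = (LINT y|lborel. LINT x|lborel. a x * (b y * k x y))" by simp
  also have "\<dots> = (LINT y|lborel. LINT x|lborel. b y * (a x * k x y))" by (simp only: mult.left_commute)
  finally show ?thesis by simp
qed

lemma std_normal_ft: "(LINT u|lborel. of_real (std_normal_density u) * expi (x * u)) = of_real (exp (- ((2 * pi * x)\<^sup>2) / 2))"
proof -
  have "char std_normal_distribution (2 * pi * x) = (LINT u|lborel. std_normal_density u *\<^sub>R iexp ((2 * pi * x) * u))"
    unfolding char_def by (subst integral_density) (auto simp: normal_density_nonneg)
  then show ?thesis
    by (simp add: char_std_normal_distribution expi_def cis_conv_exp scaleR_conv_of_real mult.assoc)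
qed

lemma std_normal_ft_scaled:
  assumes "c > 0"
  shows "(LINT \<xi>|lborel. of_real (std_normal_density (\<xi> / c)) * expi (x * \<xi>)) = of_real (c * exp (- ((2 * pi * (c * x))\<^sup>2) / 2))"
  using lborel_integral_real_affine[of c "\<lambda>\<xi>. complex_of_real (std_normal_density (\<xi> / c)) * expi (x * \<xi>)" 0] assms
    std_normal_ft[of "c * x"]
  by (simp add: mult_ac scaleR_conv_of_real)

lemma integrable_std_normal: "integrable lborel std_normal_density"
  using integrable_normal_density[of 1 0] by simp

lemma integrable_std_normal_scaled: "c > 0 \<Longrightarrow> integrable lborel (\<lambda>\<xi>. complex_of_real (std_normal_density (\<xi> / c)))"
  using lborel_integrable_real_affine[OF integrable_std_normal, of "1 / c" 0]
  by (simp del: of_real_mult)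

text \<open>The Gaussian weight makes the exchange of integrals legitimate. Its transform is a
  Gaussian of width comparable to 1 / c, so the right side averages the autocorrelation of
  \<open>g\<close> over small shifts and tends to a multiple of \<open>sqn g\<close> as
  \<open>c\<close> grows.\<close>

lemma gaussian_mean_ft:
  assumes g: "L12 g" and c: "c > 0"
  shows "(LINT \<xi>|lborel. of_real (std_normal_density (\<xi> / c)) * (ft g \<xi> * cnj (ft g \<xi>)))
    = (1 / sqrt (2 * pi)) * (LINT u|lborel. of_real (std_normal_density u) * (LINT x|lborel. g x * cnj (g (x + u / (2 * pi * c)))))"
proof -
  have i1: "integrable lborel g" and i2: "integrable lborel (\<lambda>x. (cmod (g x))\<^sup>2)" using g by (auto simp: L12_def)
  note [measurable] = L12_measurable[OF g]
  have i1c: "integrable lborel (\<lambda>x. cnj (g x))" using i1 by simp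
  define s where "s = (\<lambda>\<xi>. complex_of_real (std_normal_density (\<xi> / c)))"
  have s1: "integrable lborel s" unfolding s_def by (rule integrable_std_normal_scaled[OF c])
  have sm[measurable]: "s \<in> borel_measurable borel" using s1 by (auto dest: borel_measurable_integrable)
  define B where "B = (LINT x|lborel. cmod (g x))"
  have B: "cmod (ft g x) \<le> B" for x unfolding B_def by (rule norm_ft_le[OF i1])
  have isf: "integrable lborel (\<lambda>\<xi>. s \<xi> * cnj (ft g \<xi>))"
    by (rule integrable_mult_bounded[OF s1, of _ B]) (use B in auto)
  have cnjft: "cnj (ft g \<xi>) = (LINT y|lborel. cnj (g y) * expi (- (y * \<xi>)))" for \<xi>
  proof -
    have "cnj (ft g \<xi>) = (LINT y|lborel. cnj (g y * expi (\<xi> * y)))"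
      unfolding ft_def by (rule Bochner_Integration.integral_cnj[symmetric])
    then show ?thesis by (simp add: mult.commute del: Bochner_Integration.integral_cnj)
  qed
  have "(LINT \<xi>|lborel. s \<xi> * (ft g \<xi> * cnj (ft g \<xi>)))
    = (LINT \<xi>|lborel. (s \<xi> * cnj (ft g \<xi>)) * (LINT x|lborel. g x * expi (\<xi> * x)))"
    by (simp add: ft_def mult_ac)
  also have "\<dots> = (LINT x|lborel. g x * (LINT \<xi>|lborel. (s \<xi> * cnj (ft g \<xi>)) * expi (\<xi> * x)))"
    by (rule fubini_bounded_kernel[OF isf i1]) auto
  also have "\<dots> = (LINT x|lborel. g x * (LINT y|lborel. cnj (g y) * of_real (c * exp (- ((2 * pi * (c * (x - y)))\<^sup>2) / 2))))"
  proof (rule Bochner_Integration.integral_cong[OF refl])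
    fix x
    have "(LINT \<xi>|lborel. (s \<xi> * cnj (ft g \<xi>)) * expi (\<xi> * x)) =
       (LINT \<xi>|lborel. (s \<xi> * expi (x * \<xi>)) * (LINT y|lborel. cnj (g y) * expi (- (y * \<xi>))))"
      by (simp add: cnjft mult_ac)
    also have "\<dots> = (LINT y|lborel. cnj (g y) * (LINT \<xi>|lborel. (s \<xi> * expi (x * \<xi>)) * expi (- (y * \<xi>))))"
      by (rule fubini_bounded_kernel[OF integrable_mult_bounded[OF s1, of _ 1] i1c]) auto
    also have "\<dots> = (LINT y|lborel. cnj (g y) * of_real (c * exp (- ((2 * pi * (c * (x - y)))\<^sup>2) / 2)))"
      using std_normal_ft_scaled[OF c]
      by (simp add: s_def mult.assoc expi_add[symmetric] left_diff_distrib[symmetric])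
    finally show "g x * (LINT \<xi>|lborel. (s \<xi> * cnj (ft g \<xi>)) * expi (\<xi> * x)) = g x * (LINT y|lborel. cnj (g y) * of_real (c * exp (- ((2 * pi * (c * (x - y)))\<^sup>2) / 2)))"
      by (simp only:)
  qed
  also have "\<dots> = (LINT x|lborel. g x * ((1 / sqrt (2 * pi)) * (LINT u|lborel. cnj (g (x + u / (2 * pi * c))) * of_real (std_normal_density u))))"
  proof (rule Bochner_Integration.integral_cong[OF refl])
    fix x
    have "(LINT y|lborel. cnj (g y) * of_real (c * exp (- ((2 * pi * (c * (x - y)))\<^sup>2) / 2))) =
      of_real (1 / (2 * pi * c)) * (LINT u|lborel. cnj (g (x + u / (2 * pi * c))) * of_real (c * exp (- (u\<^sup>2) / 2)))"
      using c by (subst lborel_integral_real_affine[of "1 / (2 * pi * c)" _ x])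
        (simp_all add: scaleR_conv_of_real power2_eq_square)
    also have "\<dots> = (1 / sqrt (2 * pi)) * (LINT u|lborel. cnj (g (x + u / (2 * pi * c))) * of_real (std_normal_density u))"
    proof -
      have "complex_of_real (c * exp (- (u\<^sup>2) / 2)) = of_real (c * sqrt (2 * pi)) * of_real (std_normal_density u)" for u
      proof -
        have "0 < sqrt (2 * pi)" using pi_gt_zero by (intro real_sqrt_gt_zero) simp
        then have "c * exp (- (u\<^sup>2) / 2) = c * sqrt (2 * pi) * std_normal_density u"
          unfolding std_normal_density_def by (simp del: real_sqrt_mult)
        then show ?thesis by (simp only: of_real_mult)
      qed
      then have "(LINT u|lborel. cnj (g (x + u / (2 * pi * c))) * of_real (c * exp (- (u\<^sup>2) / 2)))
        = of_real (c * sqrt (2 * pi)) * (LINT u|lborel. cnj (g (x + u / (2 * pi * c))) * of_real (std_normal_density u))"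
        by (simp add: mult.left_commute mult.assoc del: of_real_mult)
      moreover have "1 / (2 * pi * c) * (c * sqrt (2 * pi)) = 1 / sqrt (2 * pi)"
        using c by (simp add: field_simps)
      ultimately show ?thesis by (simp only: mult.assoc[symmetric] of_real_mult[symmetric])
    qed
    finally show "g x * (LINT y|lborel. cnj (g y) * of_real (c * exp (- ((2 * pi * (c * (x - y)))\<^sup>2) / 2))) = g x * ((1 / sqrt (2 * pi)) * (LINT u|lborel. cnj (g (x + u / (2 * pi * c))) * of_real (std_normal_density u)))"
      by (simp only:)
  qed
  also have "\<dots> = (1 / sqrt (2 * pi)) * (LINT x|lborel. (LINT u|lborel. g x * cnj (g (x + u / (2 * pi * c))) * of_real (std_normal_density u)))"
    by (simp add: mult_ac)
  also have "(LINT x|lborel. (LINT u|lborel. g x * cnj (g (x + u / (2 * pi * c))) * of_real (std_normal_density u)))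
    = (LINT u|lborel. (LINT x|lborel. g x * cnj (g (x + u / (2 * pi * c))) * of_real (std_normal_density u)))"
  proof (rule lborel_pair.Fubini_integral)
    have nb: "(LINT x|lborel. cmod (g x * cnj (g (x + t)))) \<le> sqn g" for t
    proof -
      have "(LINT x|lborel. cmod (g x * cnj (g (x + t)))) \<le> (LINT x|lborel. ((cmod (g x))\<^sup>2 + (cmod (g (x + t)))\<^sup>2) / 2)"
      proof (rule integral_mono)
        show "integrable lborel (\<lambda>x. cmod (g x * cnj (g (x + t))))"
          using i2 shift_sq[OF i2] by (intro integrable_norm integrable_sq_prod) auto
        show "cmod (g x * cnj (g (x + t))) \<le> ((cmod (g x))\<^sup>2 + (cmod (g (x + t)))\<^sup>2) / 2" for x
          using sum_squares_bound[of "cmod (g x)" "cmod (g (x + t))"] by (simp add: norm_mult)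
      qed (use i2 shift_sq[OF i2] in auto)
      also have "\<dots> = sqn g" using i2 shift_sq[OF i2, of t] by (simp add: sqn_def)
      finally show ?thesis .
    qed
    show "integrable (lborel \<Otimes>\<^sub>M lborel) (\<lambda>(u, x). g x * cnj (g (x + u / (2 * pi * c))) * of_real (std_normal_density u))"
    proof (rule lborel_pair.Fubini_integrable)
      show "AE u in lborel. integrable lborel (\<lambda>x. case (u, x) of (u, x) \<Rightarrow> g x * cnj (g (x + u / (2 * pi * c))) * of_real (std_normal_density u))"
      proof (intro AE_I2)
        fix u
        have "integrable lborel (\<lambda>x. g x * cnj (g (x + u / (2 * pi * c))))"
          using i2 shift_sq[OF i2] by (intro integrable_sq_prod) auto
        then show "integrable lborel (\<lambda>x. case (u, x) of (u, x) \<Rightarrow> g x * cnj (g (x + u / (2 * pi * c))) * of_real (std_normal_density u))"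
          by simp
      qed
      show "integrable lborel (\<lambda>u. LINT x|lborel. norm (case (u, x) of (u, x) \<Rightarrow> g x * cnj (g (x + u / (2 * pi * c))) * of_real (std_normal_density u)))"
      proof (rule Bochner_Integration.integrable_bound)
        show "integrable lborel (\<lambda>u. sqn g * std_normal_density u)" using integrable_std_normal by auto
        show "AE u in lborel. norm (LINT x|lborel. norm (case (u, x) of (u, x) \<Rightarrow> g x * cnj (g (x + u / (2 * pi * c))) * of_real (std_normal_density u)))
          \<le> norm (sqn g * std_normal_density u)"
          using nb by (auto intro!: AE_I2 mult_right_mono simp: norm_mult abs_mult)
      qed measurable
    qed measurable
  qed
  also have "\<dots> = (LINT u|lborel. of_real (std_normal_density u) * (LINT x|lborel. g x * cnj (g (x + u / (2 * pi * c)))))"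
    by (rule Bochner_Integration.integral_cong[OF refl]) (simp add: mult.commute)
  finally show ?thesis by (simp only: s_def)
qed

text \<open>Let the Gaussian weight widen. Its values increase to 1 / sqrt (2 pi), so monotone
  convergence yields integrability of the squared modulus together with the value of the integral;
  before that \<open>ft g\<close> is only known to be bounded.\<close>

lemma plancherel:
  assumes g: "L12 g"
  shows "integrable lborel (\<lambda>x. (cmod (ft g x))\<^sup>2)" "sqn (ft g) = sqn g"
proof -
  have i1: "integrable lborel g" and i2: "integrable lborel (\<lambda>x. (cmod (g x))\<^sup>2)" using g by (auto simp: L12_def)
  note [measurable] = L12_measurable[OF g]
  define c where "c n = real (Suc n)" for n
  define A where "A t = (LINT x|lborel. g x * cnj (g (x + t)))" for t
  define J where "J n = (LINT \<xi>|lborel. std_normal_density (\<xi> / c n) * (cmod (ft g \<xi>))\<^sup>2)" for n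
  have cp: "c n > 0" for n by (simp add: c_def)
  have Am[measurable]: "A \<in> borel_measurable borel" unfolding A_def
    by (rule lborel.borel_measurable_lebesgue_integral) measurable
  have Ab: "cmod (A t) \<le> sqn g" for t
  proof -
    have "cmod (A t) \<le> (LINT x|lborel. norm (g x * cnj (g (x + t))))" unfolding A_def by (rule integral_norm_bound)
    also have "\<dots> \<le> (LINT x|lborel. ((cmod (g x))\<^sup>2 + (cmod (g (x + t)))\<^sup>2) / 2)"
    proof (rule integral_mono)
      show "integrable lborel (\<lambda>x. cmod (g x * cnj (g (x + t))))"
        using i2 shift_sq[OF i2] by (intro integrable_norm integrable_sq_prod) auto
      show "cmod (g x * cnj (g (x + t))) \<le> ((cmod (g x))\<^sup>2 + (cmod (g (x + t)))\<^sup>2) / 2" for x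
        using sum_squares_bound[of "cmod (g x)" "cmod (g (x + t))"] by (simp add: norm_mult)
    qed (use i2 shift_sq[OF i2] in auto)
    also have "\<dots> = sqn g" using i2 shift_sq[OF i2, of t] by (simp add: sqn_def)
    finally show ?thesis .
  qed
  have JA: "of_real (J n) = (1 / sqrt (2 * pi)) * (LINT u|lborel. of_real (std_normal_density u) * A (u / (2 * pi * c n)))" for n
  proof -
    have "complex_of_real (J n) = (LINT \<xi>|lborel. of_real (std_normal_density (\<xi> / c n)) * (ft g \<xi> * cnj (ft g \<xi>)))"
      unfolding J_def by (subst integral_complex_of_real[symmetric]) (simp add: complex_norm_square[symmetric])
    then show ?thesis unfolding A_def using gaussian_mean_ft[OF g cp] by simp
  qed
  have "(\<lambda>n. LINT u|lborel. complex_of_real (std_normal_density u) * A (u / (2 * pi * c n))) \<longlonglongrightarrow> (LINT u|lborel. of_real (std_normal_density u) * of_real (sqn g))"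
  proof (rule integral_dominated_convergence[where w = "\<lambda>u. std_normal_density u * sqn g"])
    show "AE u in lborel. (\<lambda>n. complex_of_real (std_normal_density u) * A (u / (2 * pi * c n))) \<longlonglongrightarrow> of_real (std_normal_density u) * of_real (sqn g)"
    proof (intro AE_I2 tendsto_mult tendsto_const)
      fix u
      have "(\<lambda>n. (u / (2 * pi)) * inverse (real (Suc n))) \<longlonglongrightarrow> (u / (2 * pi)) * 0"
        by (intro tendsto_mult tendsto_const LIMSEQ_inverse_real_of_nat)
      then have "(\<lambda>n. u / (2 * pi * c n)) \<longlonglongrightarrow> 0" by (simp add: c_def field_simps)
      from autocorrelation_continuous[OF g this] show "(\<lambda>n. A (u / (2 * pi * c n))) \<longlonglongrightarrow> of_real (sqn g)"
        by (simp add: A_def)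
    qed
    show "AE u in lborel. norm (complex_of_real (std_normal_density u) * A (u / (2 * pi * c n))) \<le> std_normal_density u * sqn g" for n
      by (auto intro!: AE_I2 mult_left_mono Ab simp: norm_mult)
  qed (use integrable_std_normal in auto)
  also have "(LINT u|lborel. complex_of_real (std_normal_density u) * of_real (sqn g)) = of_real (sqn g)"
  proof -
    have "(LINT u|lborel. std_normal_density u) = 1" using integral_normal_density[of 1 0] by simp
    then show ?thesis using integral_complex_of_real[of lborel std_normal_density] by simp
  qed
  finally have "(\<lambda>n. complex_of_real (J n)) \<longlonglongrightarrow> complex_of_real (1 / sqrt (2 * pi)) * of_real (sqn g)"
    unfolding JA by (intro tendsto_mult tendsto_const)
  then have Jlim: "J \<longlonglongrightarrow> (1 / sqrt (2 * pi)) * sqn g"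
    using tendsto_of_real_iff[of J "(1 / sqrt (2 * pi)) * sqn g" sequentially, where ?'a = complex]
    by (simp only: of_real_mult)
  let ?f = "\<lambda>n \<xi>. std_normal_density (\<xi> / c n) * (cmod (ft g \<xi>))\<^sup>2"
  define B where "B = (LINT x|lborel. cmod (g x))"
  have B: "cmod (ft g x) \<le> B" for x unfolding B_def by (rule norm_ft_le[OF i1])
  have fi: "integrable lborel (?f n)" for n
  proof (rule Bochner_Integration.integrable_bound)
    show "integrable lborel (\<lambda>\<xi>. std_normal_density (\<xi> / c n) * B\<^sup>2)"
      using lborel_integrable_real_affine[OF integrable_std_normal, of "1 / c n" 0] cp[of n] by auto
    show "AE \<xi> in lborel. norm (?f n \<xi>) \<le> norm (std_normal_density (\<xi> / c n) * B\<^sup>2)"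
      using B by (auto intro!: AE_I2 mult_left_mono power_mono simp: abs_mult)
  qed measurable
  have mono: "?f n \<xi> \<le> ?f m \<xi>" if "n \<le> m" for n m \<xi>
  proof -
    have "(\<xi> / c m)\<^sup>2 \<le> (\<xi> / c n)\<^sup>2"
      using that by (auto simp: c_def power_divide intro!: divide_left_mono power_mono)
    then have "std_normal_density (\<xi> / c n) \<le> std_normal_density (\<xi> / c m)"
      by (auto simp: std_normal_density_def intro!: divide_right_mono)
    then show ?thesis by (intro mult_right_mono) auto
  qed
  have lim: "(\<lambda>n. ?f n \<xi>) \<longlonglongrightarrow> (1 / sqrt (2 * pi)) * (cmod (ft g \<xi>))\<^sup>2" for \<xi>
  proof (intro tendsto_mult tendsto_const)
    have "(\<lambda>n. \<xi> * inverse (real (Suc n))) \<longlonglongrightarrow> \<xi> * 0"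
      by (intro tendsto_mult tendsto_const LIMSEQ_inverse_real_of_nat)
    then have l: "(\<lambda>n. \<xi> / c n) \<longlonglongrightarrow> 0" by (simp add: c_def field_simps)
    have "(\<lambda>n. (1 / sqrt (2 * pi)) * exp (- (\<xi> / c n)\<^sup>2 / 2)) \<longlonglongrightarrow> (1 / sqrt (2 * pi)) * exp (- (0::real)\<^sup>2 / 2)"
      by (intro tendsto_intros l) simp_all
    then show "(\<lambda>n. std_normal_density (\<xi> / c n)) \<longlonglongrightarrow> 1 / sqrt (2 * pi)"
      by (simp add: std_normal_density_def)
  qed
  have hb: "has_bochner_integral lborel (\<lambda>\<xi>. (1 / sqrt (2 * pi)) * (cmod (ft g \<xi>))\<^sup>2) ((1 / sqrt (2 * pi)) * sqn g)"
    by (rule has_bochner_integral_monotone_convergence[where f = ?f])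
      (use fi mono lim Jlim in \<open>auto simp: mono_def J_def[abs_def]\<close>)
  have "has_bochner_integral lborel (\<lambda>\<xi>. (cmod (ft g \<xi>))\<^sup>2) (sqn g)"
  proof -
    have q: "sqrt (2 * pi) * (1 / sqrt (2 * pi) * t) = t" for t
    proof -
      have "0 < sqrt (2 * pi)" using pi_gt_zero by (intro real_sqrt_gt_zero) simp
      moreover have "s * (1 / s * t) = t" if "s > 0" for s t :: real using that by simp
      ultimately show ?thesis by blast
    qed
    have "has_bochner_integral lborel (\<lambda>\<xi>. sqrt (2 * pi) * ((1 / sqrt (2 * pi)) * (cmod (ft g \<xi>))\<^sup>2))
      (sqrt (2 * pi) * ((1 / sqrt (2 * pi)) * sqn g))"
      by (intro has_bochner_integral_mult_right hb)
    then show ?thesis by (simp only: q)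
  qed
  then show "integrable lborel (\<lambda>x. (cmod (ft g x))\<^sup>2)" "sqn (ft g) = sqn g"
    by (auto simp: has_bochner_integral_iff sqn_def)
qed

section \<open>Exponential sums on subsets of the unit interval\<close>

lemma Cauchy_Schwarz_sum_cmod:
  fixes a b :: "'a \<Rightarrow> complex"
  shows "cmod (\<Sum>i\<in>I. a i * b i) \<le> sqrt (\<Sum>i\<in>I. (cmod (a i))\<^sup>2) * sqrt (\<Sum>i\<in>I. (cmod (b i))\<^sup>2)"
proof -
  have "cmod (\<Sum>i\<in>I. a i * b i) \<le> (\<Sum>i\<in>I. cmod (a i) * cmod (b i))"
    using norm_sum[of "\<lambda>i. a i * b i" I] by (simp add: norm_mult)
  also have "\<dots> = sqrt ((\<Sum>i\<in>I. cmod (a i) * cmod (b i))\<^sup>2)"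
    by (simp add: sum_nonneg)
  also have "\<dots> \<le> sqrt ((\<Sum>i\<in>I. (cmod (a i))\<^sup>2) * (\<Sum>i\<in>I. (cmod (b i))\<^sup>2))"
    by (intro real_sqrt_le_mono Cauchy_Schwarz_ineq_sum)
  finally show ?thesis by (simp add: real_sqrt_mult)
qed

lemma abs_eq_cmod: "complex_of_real x = z \<Longrightarrow> \<bar>x\<bar> = cmod z"
  by auto

lemma set_integrable_continuous_unit:
  fixes f :: "real \<Rightarrow> 'a::{banach, second_countable_topology}"
  assumes "continuous_on UNIV f" "Y \<in> sets borel" "Y \<subseteq> {0..1}"
  shows "set_integrable lborel Y f"
  by (rule set_integrable_subset[OF borel_integrable_atLeastAtMost'[OF continuous_on_subset[OF assms(1)]], of 0 1])
    (use assms(2,3) in auto)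

lemma set_lebesgue_integral_sum:
  fixes f :: "'i \<Rightarrow> 'a \<Rightarrow> 'b::{banach, second_countable_topology}"
  assumes "\<And>i. i \<in> I \<Longrightarrow> set_integrable M Y (f i)"
  shows "(LINT x:Y|M. \<Sum>i\<in>I. f i x) = (\<Sum>i\<in>I. LINT x:Y|M. f i x)"
  using assms unfolding set_lebesgue_integral_def set_integrable_def scaleR_sum_right
  by (rule Bochner_Integration.integral_sum)

lemma measure_shift:
  fixes V :: "real set"
  assumes [measurable]: "V \<in> sets borel"
  shows "measure lborel {x. x + a \<in> V} = measure lborel V"
proof -
  have "emeasure lborel V = emeasure (distr lborel borel ((+) a)) V" by (simp add: lborel_distr_plus)
  also have "\<dots> = emeasure lborel {x. x + a \<in> V}"
    by (subst emeasure_distr) (auto simp: vimage_def add.commute)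
  finally show ?thesis by (simp add: measure_def)
qed

lemma measure_lborel_mono:
  fixes A B :: "real set"
  assumes "A \<subseteq> B" "A \<in> sets borel" "B \<in> sets borel" "bounded B"
  shows "measure lborel A \<le> measure lborel B"
proof (rule measure_mono_fmeasurable)
  have "emeasure lborel B < \<infinity>" using emeasure_bounded_finite[OF assms(4)] by simp
  then show "B \<in> fmeasurable lborel" using assms by (simp add: fmeasurable_def)
qed (use assms in auto)

lemma integral_expi_unit:
  assumes "b \<noteq> 0"
  shows "cmod (LINT s:{0..1}|lborel. expi (b * s)) \<le> 1 / \<bar>b\<bar>"
proof -
  let ?F = "\<lambda>s. expi (b * s) / (2 * of_real pi * \<i> * of_real b)"
  have d: "(?F has_vector_derivative expi (b * s)) (at s within {0..1})" for s
  proof -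
    have "((\<lambda>z. exp (\<i> * (2 * of_real pi * (of_real b * z)))) has_field_derivative
        (2 * of_real pi * \<i> * of_real b) * exp (\<i> * (2 * of_real pi * (of_real b * of_real s)))) (at (of_real s))"
      by (auto intro!: derivative_eq_intros)
    from has_vector_derivative_real_field[OF this] have "((\<lambda>s. expi (b * s)) has_vector_derivative (2 * of_real pi * \<i> * of_real b) * expi (b * s)) (at s within {0..1})"
      by (simp add: expi_def cis_conv_exp)
    from has_vector_derivative_divide[OF this, of "2 * of_real pi * \<i> * of_real b"] assms
    show ?thesis by simp
  qed
  have "(LINT s:{0..1}|lborel. expi (b * s)) = ?F 1 - ?F 0"
    unfolding set_lebesgue_integral_def
    by (rule integral_FTC_Icc) (auto intro!: d continuous_intros)
  also have "cmod \<dots> = cmod (expi b - 1) / (2 * pi * \<bar>b\<bar>)"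
    by (simp add: diff_divide_distrib[symmetric] norm_divide norm_mult)
  also have "\<dots> \<le> 2 / (2 * pi * \<bar>b\<bar>)"
    using norm_triangle_ineq4[of "expi b" 1] by (intro divide_right_mono) auto
  also have "\<dots> \<le> 1 / \<bar>b\<bar>"
    using assms pi_gt3 by (simp add: field_simps)
  finally show ?thesis .
qed

text \<open>Assumption \<open>HS\<close> bounds the Hilbert-Schmidt norm of the off-diagonal part of the operator \<open>P 1\<^sub>Y P\<close>, \<open>P\<close> being
  the projection onto the span of the exponentials.\<close>

locale trig_sums =
  fixes K :: "nat set" and l :: "nat \<Rightarrow> real" and H :: real
  assumes finK: "finite K" and Hpos: "0 < H"
    and HS: "\<And>Y. Y \<in> sets borel \<Longrightarrow> Y \<subseteq> {0..1} \<Longrightarrow>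
      (\<Sum>(k, j)\<in>Sigma K (\<lambda>k. K - {k}). (cmod (LINT x:Y|lborel. expi ((l k - l j) * x)))\<^sup>2) \<le> H * measure lborel Y"
begin

definition tp :: "(nat \<Rightarrow> complex) \<Rightarrow> real \<Rightarrow> complex" where
  "tp c x = (\<Sum>k\<in>K. c k * expi (l k * x))"

definition ip :: "(nat \<Rightarrow> complex) \<Rightarrow> (nat \<Rightarrow> complex) \<Rightarrow> complex" where
  "ip c d = (\<Sum>k\<in>K. c k * cnj (d k))"

definition nsq :: "(nat \<Rightarrow> complex) \<Rightarrow> real" where
  "nsq c = (\<Sum>k\<in>K. (cmod (c k))\<^sup>2)"

definition tr :: "real \<Rightarrow> (nat \<Rightarrow> complex) \<Rightarrow> nat \<Rightarrow> complex" where
  "tr s c k = c k * expi (l k * s)"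

definition hat :: "real set \<Rightarrow> nat \<Rightarrow> nat \<Rightarrow> complex" where
  "hat Y k j = (LINT x:Y|lborel. expi ((l k - l j) * x))"

text \<open>The quadratic form of the matrix \<open>hat Y\<close> without its diagonal, which alone
  would give the measure of \<open>Y\<close> times \<open>nsq v\<close>.\<close>

definition off_diagonal :: "real set \<Rightarrow> (nat \<Rightarrow> complex) \<Rightarrow> complex" where
  "off_diagonal Y v = (\<Sum>(k, j)\<in>Sigma K (\<lambda>k. K - {k}). v k * cnj (v j) * hat Y k j)"

lemma tp_tr: "tp (tr s c) x = tp c (x + s)"
  by (simp add: tp_def tr_def ring_distribs expi_add mult_ac)

lemma nsq_tr [simp]: "nsq (tr s c) = nsq c"
  by (simp add: nsq_def tr_def norm_mult)

lemma nsq_nonneg [simp]: "0 \<le> nsq c"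
  by (simp add: nsq_def sum_nonneg)

lemma ip_self: "ip c c = of_real (nsq c)"
  by (simp add: ip_def nsq_def complex_norm_square[symmetric] del: of_real_power) 

lemma ip_le: "cmod (ip c d) \<le> sqrt (nsq c) * sqrt (nsq d)"
  unfolding ip_def nsq_def using Cauchy_Schwarz_sum_cmod[of c "\<lambda>k. cnj (d k)" K] by simp

lemma continuous_on_tp: "continuous_on A (tp c)"
  unfolding tp_def[abs_def] by (intro continuous_intros)

lemma measurable_tp [measurable]: "tp c \<in> borel_measurable borel"
  by (intro borel_measurable_continuous_onI continuous_on_tp)

lemma integral_tp_sq:
  assumes Y: "Y \<in> sets borel" "Y \<subseteq> {0..1}"
  shows "of_real (LINT x:Y|lborel. (cmod (tp v x))\<^sup>2) = of_real (measure lborel Y * nsq v) + off_diagonal Y v"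
proof -
  have si: "set_integrable lborel Y (\<lambda>x. v k * cnj (v j) * expi ((l k - l j) * x))" for k j
    by (intro set_integrable_continuous_unit Y continuous_intros)
  have "of_real (LINT x:Y|lborel. (cmod (tp v x))\<^sup>2) = (LINT x:Y|lborel. complex_of_real ((cmod (tp v x))\<^sup>2))"
    unfolding set_lebesgue_integral_def by (subst integral_complex_of_real[symmetric]) (simp add: scaleR_conv_of_real)
  also have "\<dots> = (LINT x:Y|lborel. \<Sum>k\<in>K. \<Sum>j\<in>K. v k * cnj (v j) * expi ((l k - l j) * x))"
    by (rule set_lebesgue_integral_cong)
      (use Y in \<open>auto simp: complex_norm_square tp_def sum_product expi_diff_mult mult_ac simp del: of_real_power cnj_expi\<close>)
  also have "\<dots> = (\<Sum>k\<in>K. \<Sum>j\<in>K. (LINT x:Y|lborel. v k * cnj (v j) * expi ((l k - l j) * x)))"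
    by (subst set_lebesgue_integral_sum, intro set_integrable_continuous_unit Y continuous_intros)
      (simp add: set_lebesgue_integral_sum[OF si])
  also have "\<dots> = (\<Sum>k\<in>K. \<Sum>j\<in>K. v k * cnj (v j) * hat Y k j)"
    by (simp add: hat_def)
  also have "\<dots> = (\<Sum>k\<in>K. v k * cnj (v k) * hat Y k k) + (\<Sum>k\<in>K. \<Sum>j\<in>K - {k}. v k * cnj (v j) * hat Y k j)"
    unfolding sum.distrib[symmetric] by (intro sum.cong refl sum.remove finK) 
  also have "(\<Sum>k\<in>K. v k * cnj (v k) * hat Y k k) = of_real (measure lborel Y * nsq v)"
  proof -
    have "hat Y k k = of_real (measure lborel Y)" for k
    proof -
      have "emeasure lborel Y < \<infinity>"
        using emeasure_bounded_finite[of Y] bounded_subset[OF bounded_closed_interval Y(2)] by simp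
      then show ?thesis using Y(1) unfolding hat_def set_lebesgue_integral_def
        by (simp add: scaleR_conv_of_real)
    qed
    then show ?thesis
      by (simp add: nsq_def sum_distrib_left sum_distrib_right complex_norm_square[symmetric] mult_ac del: of_real_power)
  qed
  also have "(\<Sum>k\<in>K. \<Sum>j\<in>K - {k}. v k * cnj (v j) * hat Y k j) = off_diagonal Y v"
    unfolding off_diagonal_def using finK by (intro sum.Sigma) auto
  finally show ?thesis .
qed

text \<open>With T the sum of the rank one operators attached to the \<open>v i\<close>, both sides
  are the squared Hilbert-Schmidt norm of T, computed from its entries and from the Gram matrix of
  the \<open>v i\<close>.\<close>

lemma sum_gram:
  "(\<Sum>k\<in>K. \<Sum>j\<in>K. (cmod (\<Sum>i\<in>I. v i k * cnj (v i j)))\<^sup>2) = (\<Sum>i\<in>I. \<Sum>i'\<in>I. (cmod (ip (v i) (v i')))\<^sup>2)"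
proof -
  have "complex_of_real (\<Sum>k\<in>K. \<Sum>j\<in>K. (cmod (\<Sum>i\<in>I. v i k * cnj (v i j)))\<^sup>2)
    = (\<Sum>k\<in>K. \<Sum>j\<in>K. \<Sum>i\<in>I. \<Sum>i'\<in>I. (v i k * cnj (v i' k)) * (cnj (v i j) * v i' j))"
    by (simp add: complex_norm_square sum_product mult_ac del: of_real_power)
  also have "\<dots> = (\<Sum>i\<in>I. \<Sum>i'\<in>I. \<Sum>k\<in>K. \<Sum>j\<in>K. (v i k * cnj (v i' k)) * (cnj (v i j) * v i' j))"
    (is "(\<Sum>k\<in>K. \<Sum>j\<in>K. \<Sum>i\<in>I. \<Sum>i'\<in>I. ?F k j i i') = _")
  proof -
    have "(\<Sum>k\<in>K. \<Sum>j\<in>K. \<Sum>i\<in>I. \<Sum>i'\<in>I. ?F k j i i') = (\<Sum>k\<in>K. \<Sum>i\<in>I. \<Sum>j\<in>K. \<Sum>i'\<in>I. ?F k j i i')"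
      by (rule sum.cong[OF refl], rule sum.swap)
    also have "\<dots> = (\<Sum>i\<in>I. \<Sum>k\<in>K. \<Sum>j\<in>K. \<Sum>i'\<in>I. ?F k j i i')"
      by (rule sum.swap)
    also have "\<dots> = (\<Sum>i\<in>I. \<Sum>k\<in>K. \<Sum>i'\<in>I. \<Sum>j\<in>K. ?F k j i i')"
      by (rule sum.cong[OF refl], rule sum.cong[OF refl], rule sum.swap)
    also have "\<dots> = (\<Sum>i\<in>I. \<Sum>i'\<in>I. \<Sum>k\<in>K. \<Sum>j\<in>K. ?F k j i i')"
      by (rule sum.cong[OF refl], rule sum.swap)
    finally show ?thesis .
  qed
  also have "\<dots> = (\<Sum>i\<in>I. \<Sum>i'\<in>I. ip (v i) (v i') * cnj (ip (v i) (v i')))"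
    by (simp add: ip_def sum_product)
  also have "\<dots> = of_real (\<Sum>i\<in>I. \<Sum>i'\<in>I. (cmod (ip (v i) (v i')))\<^sup>2)"
    by (simp add: complex_norm_square del: of_real_power)
  finally show ?thesis by (simp only: of_real_eq_iff)
qed

text \<open>The sum of the forms pairs the matrix in \<open>sum_gram\<close> with the off-diagonal
  part of \<open>hat Y\<close>, so Cauchy-Schwarz is applied once to the whole family. Bounding each
  form separately would lose a factor sqrt m for m orthonormal vectors.\<close>

lemma off_diagonal_sum_le:
  assumes Y: "Y \<in> sets borel" "Y \<subseteq> {0..1}"
  shows "cmod (\<Sum>i\<in>I. off_diagonal Y (v i)) \<le> sqrt (\<Sum>i\<in>I. \<Sum>i'\<in>I. (cmod (ip (v i) (v i')))\<^sup>2) * sqrt (H * measure lborel Y)"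
proof -
  let ?P = "Sigma K (\<lambda>k. K - {k})"
  have "(\<Sum>i\<in>I. off_diagonal Y (v i)) = (\<Sum>p\<in>?P. (\<Sum>i\<in>I. v i (fst p) * cnj (v i (snd p))) * hat Y (fst p) (snd p))"
    unfolding off_diagonal_def by (subst sum.swap) (simp add: sum_distrib_right case_prod_beta)
  also have "cmod \<dots> \<le> sqrt (\<Sum>p\<in>?P. (cmod (\<Sum>i\<in>I. v i (fst p) * cnj (v i (snd p))))\<^sup>2) * sqrt (\<Sum>p\<in>?P. (cmod (hat Y (fst p) (snd p)))\<^sup>2)"
    by (rule Cauchy_Schwarz_sum_cmod)
  also have "\<dots> \<le> sqrt (\<Sum>i\<in>I. \<Sum>i'\<in>I. (cmod (ip (v i) (v i')))\<^sup>2) * sqrt (H * measure lborel Y)"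
  proof (intro mult_mono real_sqrt_le_mono)
    have "(\<Sum>p\<in>?P. (cmod (\<Sum>i\<in>I. v i (fst p) * cnj (v i (snd p))))\<^sup>2) \<le> (\<Sum>p\<in>K \<times> K. (cmod (\<Sum>i\<in>I. v i (fst p) * cnj (v i (snd p))))\<^sup>2)"
      using finK by (intro sum_mono2) auto
    also have "\<dots> = (\<Sum>i\<in>I. \<Sum>i'\<in>I. (cmod (ip (v i) (v i')))\<^sup>2)"
      unfolding sum_gram[symmetric] sum.cartesian_product by (simp add: case_prod_beta)
    finally show "(\<Sum>p\<in>?P. (cmod (\<Sum>i\<in>I. v i (fst p) * cnj (v i (snd p))))\<^sup>2) \<le> \<dots>" .
    show "(\<Sum>p\<in>?P. (cmod (hat Y (fst p) (snd p)))\<^sup>2) \<le> H * measure lborel Y"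
      using HS[OF Y] by (simp add: hat_def case_prod_beta)
  qed (auto intro!: sum_nonneg)
  finally show ?thesis .
qed

lemma integral_tp_sq_le:
  assumes Y: "Y \<in> sets borel" "Y \<subseteq> {0..1}"
  shows "\<bar>(LINT x:Y|lborel. (cmod (tp v x))\<^sup>2) - measure lborel Y * nsq v\<bar> \<le> sqrt (H * measure lborel Y) * nsq v"
proof -
  have "complex_of_real ((LINT x:Y|lborel. (cmod (tp v x))\<^sup>2) - measure lborel Y * nsq v) = off_diagonal Y v"
    using integral_tp_sq[OF Y, of v] by simp
  then have "\<bar>(LINT x:Y|lborel. (cmod (tp v x))\<^sup>2) - measure lborel Y * nsq v\<bar> = cmod (off_diagonal Y v)"
    by (rule abs_eq_cmod)
  also have "\<dots> \<le> nsq v * sqrt (H * measure lborel Y)"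
    using off_diagonal_sum_le[OF Y, of "\<lambda>_. v" "{0::nat}"] by (simp add: ip_self del: of_real_power)
  finally show ?thesis by (simp add: mult.commute)
qed

text \<open>The Gram sum of an orthonormal family is \<open>m\<close>, so the error grows like sqrt
  m and is outgrown by the main term.\<close>

lemma orthonormal_integral_lower:
  assumes Y: "Y \<in> sets borel" "Y \<subseteq> {0..1}"
    and orth: "\<And>i j. i < m \<Longrightarrow> j < m \<Longrightarrow> ip (v i) (v j) = (if i = j then 1 else 0)"
  shows "(\<Sum>i<m. LINT x:Y|lborel. (cmod (tp (v i) x))\<^sup>2) \<ge> real m * measure lborel Y - sqrt (real m * H)"
proof -
  have n1: "nsq (v i) = 1" if "i < m" for i
    using orth[OF that that] by (simp add: ip_self)
  have "complex_of_real ((\<Sum>i<m. LINT x:Y|lborel. (cmod (tp (v i) x))\<^sup>2) - real m * measure lborel Y) = (\<Sum>i<m. off_diagonal Y (v i))"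
    using n1 by (simp add: integral_tp_sq[OF Y] sum.distrib)
  then have "\<bar>(\<Sum>i<m. LINT x:Y|lborel. (cmod (tp (v i) x))\<^sup>2) - real m * measure lborel Y\<bar> = cmod (\<Sum>i<m. off_diagonal Y (v i))"
    by (rule abs_eq_cmod)
  also have "\<dots> \<le> sqrt (\<Sum>i<m. \<Sum>i'<m. (cmod (ip (v i) (v i')))\<^sup>2) * sqrt (H * measure lborel Y)"
    by (rule off_diagonal_sum_le[OF Y])
  also have "(\<Sum>i<m. \<Sum>i'<m. (cmod (ip (v i) (v i')))\<^sup>2) = real m"
  proof -
    have "(\<Sum>i<m. \<Sum>i'<m. (cmod (ip (v i) (v i')))\<^sup>2) = (\<Sum>i<m. \<Sum>i'<m. if i = i' then 1 else 0)"
      by (intro sum.cong refl) (auto simp: orth)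
    then show ?thesis by simp
  qed
  also have "sqrt (real m) * sqrt (H * measure lborel Y) \<le> sqrt (real m) * sqrt (H * 1)"
    using measure_lborel_mono[OF Y(2,1)] Hpos by (intro mult_left_mono real_sqrt_le_mono) auto
  finally show ?thesis by (simp add: real_sqrt_mult abs_le_iff)
qed

text \<open>Averaging over the shifts multiplies each off-diagonal term by the integral of a
  character of frequency at least \<open>B\<close> in modulus, hence by at most 1 / B. The average
  therefore differs from the measure of \<open>X\<close> by at most sqrt H / B; the factor 2 makes
  the contradiction strict.\<close>

lemma integral_shift_average:
  assumes X: "X \<in> sets borel" "X \<subseteq> {0..1}" and B: "B > 0"
    and gap: "\<And>k j. k \<in> K \<Longrightarrow> j \<in> K \<Longrightarrow> k \<noteq> j \<Longrightarrow> \<bar>l k - l j\<bar> \<ge> B"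
    and c: "nsq c = 1"
  shows "\<exists>s\<in>{0..1}. (LINT x:X|lborel. (cmod (tp c (x + s)))\<^sup>2) \<ge> measure lborel X - 2 * sqrt H / B"
proof (rule ccontr)
  let ?f = "\<lambda>s. (LINT x:X|lborel. (cmod (tp c (x + s)))\<^sup>2)" and ?q = "measure lborel X - 2 * sqrt H / B"
  let ?P = "Sigma K (\<lambda>k. K - {k})"
  assume "\<not> (\<exists>s\<in>{0..1}. ?f s \<ge> ?q)"
  then have less: "?f s \<le> ?q" if "s \<in> {0..1}" for s using that by force
  have feq: "of_real (?f s) = of_real (measure lborel X) + (\<Sum>p\<in>?P. c (fst p) * cnj (c (snd p)) * hat X (fst p) (snd p) * expi ((l (fst p) - l (snd p)) * s))" for s
    using integral_tp_sq[OF X, of "tr s c"] c unfolding tp_tr nsq_tr off_diagonal_def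
    by (simp add: case_prod_beta tr_def expi_diff_mult mult_ac del: cnj_expi)
  have si: "set_integrable lborel {0..1::real} (\<lambda>s. a * expi (b * s))" for a b
    by (intro set_integrable_continuous_unit continuous_intros) auto
  let ?I = "LINT s:{0..1}|lborel. complex_of_real (?f s)"
  have si2: "set_integrable lborel {0..1::real} (\<lambda>s. complex_of_real (?f s))"
    unfolding feq by (intro set_integrable_continuous_unit continuous_intros) auto
  have I: "?I = of_real (measure lborel X) + (\<Sum>p\<in>?P. c (fst p) * cnj (c (snd p)) * (hat X (fst p) (snd p) * (LINT s:{0..1}|lborel. expi ((l (fst p) - l (snd p)) * s))))"
  proof -
    have "?I = (LINT s:{0..1::real}|lborel. of_real (measure lborel X)) + (LINT s:{0..1}|lborel. \<Sum>p\<in>?P. c (fst p) * cnj (c (snd p)) * hat X (fst p) (snd p) * expi ((l (fst p) - l (snd p)) * s))"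
      unfolding feq by (intro set_integral_add(2) set_integrable_continuous_unit continuous_intros) auto
    also have "(LINT s:{0..1}|lborel. \<Sum>p\<in>?P. c (fst p) * cnj (c (snd p)) * hat X (fst p) (snd p) * expi ((l (fst p) - l (snd p)) * s))
      = (\<Sum>p\<in>?P. LINT s:{0..1}|lborel. c (fst p) * cnj (c (snd p)) * hat X (fst p) (snd p) * expi ((l (fst p) - l (snd p)) * s))"
      by (rule set_lebesgue_integral_sum[OF si])
    also have "(LINT s:{0..1::real}|lborel. complex_of_real (measure lborel X)) = of_real (measure lborel X)"
      unfolding set_lebesgue_integral_def by (simp add: scaleR_conv_of_real)
    finally show ?thesis by (simp add: mult.assoc)
  qed
  have "cmod (?I - of_real (measure lborel X)) \<le>
     sqrt (\<Sum>p\<in>?P. (cmod (c (fst p) * cnj (c (snd p))))\<^sup>2) * sqrt (\<Sum>p\<in>?P. (cmod (hat X (fst p) (snd p) * (LINT s:{0..1}|lborel. expi ((l (fst p) - l (snd p)) * s))))\<^sup>2)"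
    unfolding I using Cauchy_Schwarz_sum_cmod by simp
  also have "\<dots> \<le> sqrt 1 * sqrt (H * (1 / B)\<^sup>2)"
  proof (intro mult_mono real_sqrt_le_mono)
    have "(\<Sum>p\<in>?P. (cmod (c (fst p) * cnj (c (snd p))))\<^sup>2) \<le> (\<Sum>p\<in>K \<times> K. (cmod (c (fst p)))\<^sup>2 * (cmod (c (snd p)))\<^sup>2)"
      unfolding norm_mult complex_mod_cnj power_mult_distrib using finK by (intro sum_mono2) auto
    also have "\<dots> = nsq c * nsq c"
      unfolding nsq_def sum_product sum.cartesian_product by (simp add: case_prod_beta)
    finally show "(\<Sum>p\<in>?P. (cmod (c (fst p) * cnj (c (snd p))))\<^sup>2) \<le> 1" using c by simp
    have "(\<Sum>p\<in>?P. (cmod (hat X (fst p) (snd p) * (LINT s:{0..1}|lborel. expi ((l (fst p) - l (snd p)) * s))))\<^sup>2)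
      \<le> (\<Sum>p\<in>?P. (cmod (hat X (fst p) (snd p)))\<^sup>2 * (1 / B)\<^sup>2)"
    proof (intro sum_mono)
      fix p assume "p \<in> ?P"
      then have p: "fst p \<in> K" "snd p \<in> K" "fst p \<noteq> snd p" by auto
      have "cmod (LINT s:{0..1}|lborel. expi ((l (fst p) - l (snd p)) * s)) \<le> 1 / \<bar>l (fst p) - l (snd p)\<bar>"
        using gap[OF p] B by (intro integral_expi_unit) auto
      also have "\<dots> \<le> 1 / B" using gap[OF p] B by (intro divide_left_mono) auto
      finally show "(cmod (hat X (fst p) (snd p) * (LINT s:{0..1}|lborel. expi ((l (fst p) - l (snd p)) * s))))\<^sup>2
        \<le> (cmod (hat X (fst p) (snd p)))\<^sup>2 * (1 / B)\<^sup>2"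
        unfolding norm_mult power_mult_distrib by (intro mult_left_mono power_mono) auto
    qed
    also have "\<dots> \<le> (H * measure lborel X) * (1 / B)\<^sup>2"
      unfolding sum_distrib_right[symmetric] using HS[OF X] B
      by (intro mult_right_mono) (auto simp: hat_def case_prod_beta)
    also have "\<dots> \<le> (H * 1) * (1 / B)\<^sup>2"
      using measure_lborel_mono[OF X(2,1)] Hpos by (intro mult_right_mono mult_left_mono) auto
    finally show "(\<Sum>p\<in>?P. (cmod (hat X (fst p) (snd p) * (LINT s:{0..1}|lborel. expi ((l (fst p) - l (snd p)) * s))))\<^sup>2) \<le> H * (1 / B)\<^sup>2" by simp
  qed (auto intro!: sum_nonneg)
  also have "\<dots> = sqrt H / B" using B Hpos by (simp add: real_sqrt_mult real_sqrt_divide)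
  finally have "Re ?I \<ge> measure lborel X - sqrt H / B"
    using abs_Re_le_cmod[of "?I - of_real (measure lborel X)"] by simp
  moreover have "Re ?I \<le> ?q"
  proof -
    have fm: "set_integrable lborel {0..1::real} ?f"
      using si2 unfolding set_integrable_def
      by (auto dest!: integrable_Re simp: scaleR_conv_of_real)
    have "?I = of_real (LINT s:{0..1}|lborel. ?f s)"
      unfolding set_lebesgue_integral_def by (subst integral_complex_of_real[symmetric]) (simp add: scaleR_conv_of_real)
    then have "Re ?I = (LINT s:{0..1}|lborel. ?f s)" by simp
    also have "\<dots> \<le> (LINT s:{0..1::real}|lborel. ?q)"
      using less fm by (intro set_integral_mono) (auto intro!: set_integrable_continuous_unit)
    also have "\<dots> = ?q" unfolding set_lebesgue_integral_def by simp
    finally show ?thesis .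
  qed
  moreover have "0 < sqrt H / B" using B Hpos by simp
  moreover have "2 * sqrt H / B = 2 * (sqrt H / B)" by simp
  ultimately show False by linarith
qed

end

text \<open>The constants in the pointwise domination below after \<open>k\<close> Gram-Schmidt steps, each of which divides by at
  least \<open>\<eta>\<close>.\<close>

primrec Dseq :: "real \<Rightarrow> nat \<Rightarrow> real" where
  "Dseq \<eta> 0 = 0"
| "Dseq \<eta> (Suc k) = (1 + real k * Dseq \<eta> k) / \<eta>"

lemma Dseq_nonneg: "0 < \<eta> \<Longrightarrow> 0 \<le> Dseq \<eta> k"
  by (induction k) auto

lemma Dseq_Suc_ge:
  assumes "0 < \<eta>" "\<eta> \<le> 1"
  shows "Dseq \<eta> k \<le> Dseq \<eta> (Suc k)"
proof (cases k)
  case (Suc n)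
  have "Dseq \<eta> k \<le> real k * Dseq \<eta> k"
    using Suc mult_right_mono[OF _ Dseq_nonneg[OF assms(1), of k], of 1 "real k"] by simp
  also have "\<dots> \<le> (1 + real k * Dseq \<eta> k) / 1" by simp
  also have "\<dots> \<le> (1 + real k * Dseq \<eta> k) / \<eta>"
    using assms Dseq_nonneg[OF assms(1), of k] by (intro divide_left_mono) auto
  finally show ?thesis by simp
qed (use assms in simp)

lemma Dseq_mono:
  assumes "0 < \<eta>" "\<eta> \<le> 1" "k \<le> m"
  shows "Dseq \<eta> k \<le> Dseq \<eta> m"
  using lift_Suc_mono_le[of "Dseq \<eta>", OF Dseq_Suc_ge[OF assms(1,2)] assms(3)] .

lemma decreasing_nat_repeats:
  fixes r :: "nat \<Rightarrow> nat"
  assumes "\<And>j. r (Suc j) \<le> r j" "r 0 < m"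
  shows "\<exists>j<m. r (Suc j) = r j"
proof (rule ccontr)
  assume "\<not> ?thesis"
  then have lt: "r (Suc j) < r j" if "j < m" for j using assms(1)[of j] that by fastforce
  have "r j + j \<le> r 0" if "j \<le> m" for j
    using that
  proof (induction j)
    case (Suc j)
    then show ?case using lt[of j] by simp
  qed simp
  from this[of m] assms(2) show False by simp
qed

context trig_sums
begin

text \<open>The domination by translates of \<open>c\<close> keeps the orthonormal system small wherever all these translates are small.\<close>

definition frames :: "(nat \<Rightarrow> complex) \<Rightarrow> real set \<Rightarrow> nat \<Rightarrow> real \<Rightarrow> real set \<Rightarrow> (nat \<Rightarrow> nat \<Rightarrow> complex) \<Rightarrow> bool" where
  "frames c A k D T v \<longleftrightarrow> finite T \<and> T \<subseteq> A \<and> card T \<le> k \<and>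
     (\<forall>i<k. \<forall>j<k. ip (v i) (v j) = (if i = j then 1 else 0)) \<and>
     (\<forall>i<k. \<forall>x. cmod (tp (v i) x) \<le> D * (\<Sum>t\<in>T. cmod (tp c (x + t))))"

definition residual :: "(nat \<Rightarrow> complex) \<Rightarrow> nat \<Rightarrow> (nat \<Rightarrow> nat \<Rightarrow> complex) \<Rightarrow> nat \<Rightarrow> complex" where
  "residual u k v n = u n - (\<Sum>i<k. ip u (v i) * v i n)"

lemma tp_residual: "tp u x = (\<Sum>i<k. ip u (v i) * tp (v i) x) + tp (residual u k v) x"
proof -
  have "(\<Sum>i<k. ip u (v i) * tp (v i) x) = (\<Sum>n\<in>K. (\<Sum>i<k. ip u (v i) * v i n) * expi (l n * x))"
    unfolding tp_def sum_distrib_left sum_distrib_right by (subst sum.swap) (simp add: mult.assoc)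
  then show ?thesis
    by (simp add: tp_def residual_def left_diff_distrib sum_subtractf)
qed

lemma ip_diff_left: "ip (\<lambda>n. a n - b n) d = ip a d - ip b d"
  by (simp add: ip_def left_diff_distrib sum_subtractf)

lemma ip_sum_left: "ip (\<lambda>n. \<Sum>i\<in>I. a i * f i n) d = (\<Sum>i\<in>I. a i * ip (f i) d)"
  unfolding ip_def sum_distrib_left sum_distrib_right by (subst sum.swap) (simp add: mult.assoc)

lemma ip_cmult_left: "ip (\<lambda>n. a * f n) d = a * ip f d"
  by (simp add: ip_def sum_distrib_left mult.assoc)

lemma ip_commute: "ip f g = cnj (ip g f)"
  by (simp add: ip_def mult.commute)

lemma ip_residual:
  assumes "\<And>i j. i < k \<Longrightarrow> j < k \<Longrightarrow> ip (v i) (v j) = (if i = j then 1 else 0)" "j < k"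
  shows "ip (residual u k v) (v j) = 0"
proof -
  have "ip (residual u k v) (v j) = ip u (v j) - (\<Sum>i<k. ip u (v i) * ip (v i) (v j))"
    unfolding residual_def[abs_def] by (simp add: ip_diff_left ip_sum_left)
  also have "(\<Sum>i<k. ip u (v i) * ip (v i) (v j)) = (\<Sum>i<k. if i = j then ip u (v j) else 0)"
    by (intro sum.cong refl) (auto simp: assms)
  finally show ?thesis using assms(2) by simp
qed

text \<open>One Gram-Schmidt step. Translates of \<open>c\<close> have norm 1, so the
  \<open>k\<close> projection coefficients are at most 1 in modulus, and the residual is divided by
  its norm, which is at least \<open>\<eta>\<close>; this is the origin of the recursion for
  \<open>Dseq\<close>.\<close>

lemma frames_extend:
  assumes fr: "frames c A k D T v" and c: "nsq c = 1" and s: "s \<in> A" and \<eta>: "0 < \<eta>" "\<eta> \<le> 1"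
    and D: "D = Dseq \<eta> k" and big: "nsq (residual (tr s c) k v) \<ge> \<eta>\<^sup>2"
  shows "\<exists>T v. frames c A (Suc k) (Dseq \<eta> (Suc k)) T v"
proof -
  let ?u = "tr s c"
  define w where "w = residual ?u k v"
  define a where "a = sqrt (nsq w)"
  define T' where "T' = insert s T"
  define v' where "v' i = (if i < k then v i else (\<lambda>n. of_real (1 / a) * w n))" for i
  have a: "a \<ge> \<eta>" using big \<eta> unfolding a_def w_def by (intro real_le_rsqrt) auto
  have aa: "a * a = nsq w" unfolding a_def by simp
  have orth: "\<And>i j. i < k \<Longrightarrow> j < k \<Longrightarrow> ip (v i) (v j) = (if i = j then 1 else 0)"
    and dom: "\<And>i x. i < k \<Longrightarrow> cmod (tp (v i) x) \<le> D * (\<Sum>t\<in>T. cmod (tp c (x + t)))"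
    and T: "finite T" "T \<subseteq> A" "card T \<le> k"
    using fr by (auto simp: frames_def)
  have D0: "0 \<le> D" using Dseq_nonneg \<eta> D by simp
  have n1: "nsq (v i) = 1" if "i < k" for i using orth[OF that that] by (simp add: ip_self)
  have TT: "(\<Sum>t\<in>T. cmod (tp c (x + t))) \<le> (\<Sum>t\<in>T'. cmod (tp c (x + t)))" for x
    unfolding T'_def using T by (intro sum_mono2) auto
  have sT: "cmod (tp c (x + s)) \<le> (\<Sum>t\<in>T'. cmod (tp c (x + t)))" for x
    unfolding T'_def using T by (intro member_le_sum[where f = "\<lambda>t. cmod (tp c (x + t))"]) auto
  have "frames c A (Suc k) (Dseq \<eta> (Suc k)) T' v'"
    unfolding frames_def
  proof (intro conjI allI impI)
    show "finite T'" "T' \<subseteq> A" "card T' \<le> Suc k"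
      using T s card_insert_le_m1[of "Suc k" T s] by (auto simp: T'_def)
    fix i assume i: "i < Suc k"
    show "ip (v' i) (v' j) = (if i = j then 1 else 0)" if j: "j < Suc k" for j
    proof -
      have w0: "ip w (v j) = 0" if "j < k" for j unfolding w_def using orth that by (rule ip_residual)
      have w0': "ip (v j) w = 0" if "j < k" for j using w0[OF that] ip_commute[of "v j" w] by simp
      consider "i < k" "j < k" | "i < k" "j = k" | "i = k" "j < k" | "i = k" "j = k" using i j by linarith
      then show ?thesis
      proof cases
        case 1 then show ?thesis using orth by (simp add: v'_def)
      next
        case 2
        then show ?thesis using w0'[of i] ip_commute[of "v i" "\<lambda>n. of_real (1 / a) * w n"]
          by (simp add: v'_def ip_cmult_left w0 del: of_real_divide)
      next
        case 3 then show ?thesis by (simp add: v'_def ip_cmult_left w0 del: of_real_divide)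
      next
        case 4
        have "ip (\<lambda>n. of_real (1 / a) * w n) (\<lambda>n. of_real (1 / a) * w n) = of_real (1 / a) * of_real (1 / a) * ip w w"
          using ip_commute[of w "\<lambda>n. of_real (1 / a) * w n"] by (simp add: ip_cmult_left ip_self del: of_real_divide)
        also have "\<dots> = of_real (1 / a * (1 / a) * (a * a))" unfolding ip_self aa by simp
        also have "\<dots> = 1" using a \<eta> by simp
        finally show ?thesis using 4 by (simp add: v'_def)
      qed
    qed
    fix x
    let ?S = "\<Sum>t\<in>T'. cmod (tp c (x + t))"
    have S0: "0 \<le> ?S" by (intro sum_nonneg) auto
    show "cmod (tp (v' i) x) \<le> Dseq \<eta> (Suc k) * ?S"
    proof (cases "i < k")
      case True
      have "cmod (tp (v i) x) \<le> D * (\<Sum>t\<in>T. cmod (tp c (x + t)))" by (rule dom[OF True])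
      also have "\<dots> \<le> Dseq \<eta> (Suc k) * ?S"
        unfolding D using TT D0[unfolded D] by (intro mult_mono Dseq_Suc_ge \<eta> order_trans[OF D0[unfolded D] Dseq_Suc_ge]) (auto intro: sum_nonneg)
      finally show ?thesis using True by (simp add: v'_def)
    next
      case False
      have "tp w x = tp ?u x - (\<Sum>i<k. ip ?u (v i) * tp (v i) x)"
        unfolding w_def using tp_residual[of ?u x v k] by simp
      then have "cmod (tp w x) \<le> cmod (tp c (x + s)) + (\<Sum>i<k. cmod (ip ?u (v i) * tp (v i) x))"
        by (simp only: tp_tr) (rule order_trans[OF norm_triangle_ineq4 add_left_mono[OF norm_sum]])
      also have "\<dots> \<le> ?S + (\<Sum>i<k. 1 * (D * ?S))"
      proof (intro add_mono sT sum_mono)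
        fix i assume "i \<in> {..<k}"
        then have i: "i < k" by simp
        show "cmod (ip ?u (v i) * tp (v i) x) \<le> 1 * (D * ?S)"
          unfolding norm_mult
        proof (intro mult_mono)
          show "cmod (ip ?u (v i)) \<le> 1" using ip_le[of ?u "v i"] c n1[OF i] by simp
          show "cmod (tp (v i) x) \<le> D * ?S" using dom[OF i, of x] TT[of x] D0
            by (meson mult_left_mono order_trans)
        qed auto
      qed
      also have "\<dots> = (1 + real k * D) * ?S" by (simp add: algebra_simps)
      finally have w: "cmod (tp w x) \<le> (1 + real k * D) * ?S" .
      have "tp (\<lambda>n. of_real (1 / a) * w n) x = of_real (1 / a) * tp w x"
        by (simp add: tp_def sum_distrib_left mult.assoc)
      then have "cmod (tp (v' i) x) = cmod (tp w x) / a"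
        using False a \<eta> by (simp add: v'_def norm_mult norm_divide)
      also have "\<dots> \<le> ((1 + real k * D) * ?S) / \<eta>"
        using w a \<eta> D0 S0 by (intro frac_le) auto
      finally show ?thesis by (simp add: D)
    qed
  qed
  then show ?thesis by blast
qed

text \<open>Not intersected with the unit interval, because the shifted points \<open>x + s\<close>
  range over {0..2}.\<close>

definition sublevel :: "(nat \<Rightarrow> complex) \<Rightarrow> real \<Rightarrow> real set" where
  "sublevel c e = {x. cmod (tp c x) \<le> e}"

definition loss_set :: "(nat \<Rightarrow> complex) \<Rightarrow> real \<Rightarrow> real \<Rightarrow> real set" where
  "loss_set c e s = {x\<in>{0..1}. x \<in> sublevel c e \<and> x + s \<notin> sublevel c e}"

lemma sublevel_borel [measurable]: "sublevel c e \<in> sets borel"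
  unfolding sublevel_def by measurable

lemma loss_set_borel [measurable]: "loss_set c e s \<in> sets borel"
  unfolding loss_set_def sublevel_def by measurable

lemma set_integrable_tp_sq:
  assumes "Y \<in> sets borel" "Y \<subseteq> {0..1}"
  shows "set_integrable lborel Y (\<lambda>x. (cmod (tp v (x + a)))\<^sup>2)"
proof (intro set_integrable_continuous_unit assms)
  show "continuous_on UNIV (\<lambda>x. (cmod (tp v (x + a)))\<^sup>2)"
    by (intro continuous_intros continuous_on_compose2[OF continuous_on_tp[of UNIV]]) auto
qed

lemma set_integrable_const_unit:
  "Y \<in> sets borel \<Longrightarrow> Y \<subseteq> {0..1} \<Longrightarrow> set_integrable lborel Y (\<lambda>x::real. r::real)"
  by (intro set_integrable_continuous_unit) auto

lemma measure_unit: "Y \<in> sets borel \<Longrightarrow> Y \<subseteq> {0..1::real} \<Longrightarrow> measure lborel Y \<le> 1"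
  using measure_lborel_mono[of Y "{0..1}"] by simp

text \<open>An orthonormal system of \<open>m\<close> sums cannot be small on a set of measure \<open>g / 2\<close>, since the Hilbert-Schmidt bound
  makes the integrals of its squares add up to about \<open>m * g / 2\<close>.\<close>

lemma frame_rank_bound:
  assumes fr: "frames c A m D T v"
    and X: "X = {0..1} \<inter> sublevel c e" "measure lborel X \<ge> g"
    and loss: "\<And>t. t \<in> A \<Longrightarrow> measure lborel (loss_set c e t) \<le> \<kappa>"
    and par: "real m * \<kappa> \<le> g / 2" "0 \<le> \<kappa>" "real m * (g / 2) - sqrt (real m * H) \<ge> 1" "0 \<le> D" "0 \<le> e"
      "real m * (D * real m * e)\<^sup>2 < 1"
  shows False
proof -
  have orth: "\<And>i j. i < m \<Longrightarrow> j < m \<Longrightarrow> ip (v i) (v j) = (if i = j then 1 else 0)"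
    and dom: "\<And>i x. i < m \<Longrightarrow> cmod (tp (v i) x) \<le> D * (\<Sum>t\<in>T. cmod (tp c (x + t)))"
    and T: "finite T" "T \<subseteq> A" "card T \<le> m"
    using fr by (auto simp: frames_def)
  \<comment> \<open>On \<open>Y\<close> every translate of \<open>c\<close> by a shift in
    \<open>T\<close> is at most \<open>e\<close>, and the at most \<open>m\<close> removed sets cost
    at most g / 2 of the measure.\<close>
  define Y where "Y = X - (\<Union>t\<in>T. loss_set c e t)"
  have Xb: "X \<in> sets borel" "X \<subseteq> {0..1}" unfolding X by auto
  have Lb: "(\<Union>t\<in>T. loss_set c e t) \<in> sets borel" "(\<Union>t\<in>T. loss_set c e t) \<subseteq> {0..1}"
    using T by (auto simp: loss_set_def intro!: sets.finite_UN loss_set_borel[unfolded loss_set_def])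
  have Yb: "Y \<in> sets borel" "Y \<subseteq> {0..1}" unfolding Y_def using Xb Lb by auto
  have fm: "Z \<in> fmeasurable lborel" if "Z \<in> sets borel" "Z \<subseteq> {0..1}" for Z :: "real set"
    using that emeasure_bounded_finite[OF bounded_subset[OF bounded_closed_interval that(2)]] by (auto simp: fmeasurable_def)
  have "measure lborel X \<le> measure lborel (Y \<union> (\<Union>t\<in>T. loss_set c e t))"
    using Yb Lb Xb by (intro measure_mono_fmeasurable fm) (auto simp: Y_def)
  also have "\<dots> \<le> measure lborel Y + measure lborel (\<Union>t\<in>T. loss_set c e t)"
    using Yb Lb by (intro measure_Un_le) auto
  also have "measure lborel (\<Union>t\<in>T. loss_set c e t) \<le> (\<Sum>t\<in>T. measure lborel (loss_set c e t))"
    using T by (intro measure_UNION_le) auto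
  also have "\<dots> \<le> (\<Sum>t\<in>T. \<kappa>)" using T loss by (intro sum_mono) auto
  also have "\<dots> \<le> real m * \<kappa>" using T par by (auto intro!: mult_right_mono)
  finally have Y: "measure lborel Y \<ge> g / 2" using X(2) par by simp
  have pt: "(cmod (tp (v i) x))\<^sup>2 \<le> (D * real m * e)\<^sup>2" if "i < m" "x \<in> Y" for i x
  proof -
    have "cmod (tp c (x + t)) \<le> e" if "t \<in> T" for t
      using \<open>x \<in> Y\<close> that unfolding Y_def X by (auto simp: loss_set_def sublevel_def)
    then have "(\<Sum>t\<in>T. cmod (tp c (x + t))) \<le> (\<Sum>t\<in>T. e)" by (intro sum_mono) auto
    also have "\<dots> \<le> real m * e" using T par by (auto intro!: mult_right_mono)
    finally have "cmod (tp (v i) x) \<le> D * (real m * e)"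
      using dom[OF that(1), of x] par by (meson mult_left_mono order_trans)
    then show ?thesis by (intro power_mono) (auto simp: mult.assoc)
  qed
  have "real m * (g / 2) - sqrt (real m * H) \<le> real m * measure lborel Y - sqrt (real m * H)"
    using Y by (intro diff_right_mono mult_left_mono) auto
  also have "\<dots> \<le> (\<Sum>i<m. LINT x:Y|lborel. (cmod (tp (v i) x))\<^sup>2)"
    by (rule orthonormal_integral_lower[OF Yb orth])
  also have "\<dots> \<le> (\<Sum>i<m. LINT x:Y|lborel. (D * real m * e)\<^sup>2)"
    using set_integrable_tp_sq[OF Yb, of _ 0] pt
    by (intro sum_mono set_integral_mono) (auto intro: set_integrable_const_unit[OF Yb])
  also have "\<dots> = real m * (measure lborel Y * (D * real m * e)\<^sup>2)"
    using fm[OF Yb] by (simp add: set_lebesgue_integral_def fmeasurable_def)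
  also have "\<dots> \<le> real m * (1 * (D * real m * e)\<^sup>2)"
    using measure_unit[OF Yb] by (intro mult_left_mono mult_right_mono) auto
  finally show False using par by simp
qed

text \<open>Chebyshev's inequality combined with the mean square bound
  \<open>integral_tp_sq_le\<close>.\<close>

lemma large_values_small:
  assumes "nsq w < \<eta>\<^sup>2" "0 < d"
  shows "measure lborel {x\<in>{0..1}. cmod (tp w x) > d} \<le> (1 + sqrt H) * \<eta>\<^sup>2 / d\<^sup>2"
proof -
  let ?Z = "{x\<in>{0..1}. cmod (tp w x) > d}"
  have Z: "?Z \<in> sets borel" "?Z \<subseteq> {0..1}" by auto
  have "emeasure lborel ?Z < \<infinity>"
    using emeasure_bounded_finite[OF bounded_subset[OF bounded_closed_interval Z(2)]] by simp
  then have "d\<^sup>2 * measure lborel ?Z = (LINT x:?Z|lborel. d\<^sup>2)"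
    by (simp add: set_lebesgue_integral_def)
  also have "\<dots> \<le> (LINT x:?Z|lborel. (cmod (tp w x))\<^sup>2)"
    using set_integrable_tp_sq[OF Z, of w 0] assms(2)
    by (intro set_integral_mono set_integrable_const_unit Z) (auto intro!: power_mono)
  also have "\<dots> \<le> (measure lborel ?Z + sqrt (H * measure lborel ?Z)) * nsq w"
    using integral_tp_sq_le[OF Z, of w] by (simp add: abs_le_iff ring_distribs)
  also have "\<dots> \<le> (1 + sqrt (H * 1)) * \<eta>\<^sup>2"
    using assms(1) measure_unit[OF Z] Hpos by (intro mult_mono add_mono real_sqrt_le_mono mult_left_mono) (auto intro!: add_nonneg_nonneg)
  finally show ?thesis using assms(2) by (simp add: field_simps)
qed

text \<open>If every shift lost at most \<open>\<kappa>\<close>, the squared sum shifted by any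
  \<open>s\<close> would have integral at most g / 4 over \<open>X\<close>: at most e^2 where it is
  still tiny, and at most \<open>\<kappa> + sqrt (H * \<kappa>)\<close> on the lost set. But some
  shift gives at least 3 g / 4 by averaging.\<close>

lemma some_shift_loses:
  assumes c: "nsq c = 1" and B: "B > 0"
    and gap: "\<And>k j. k \<in> K \<Longrightarrow> j \<in> K \<Longrightarrow> k \<noteq> j \<Longrightarrow> \<bar>l k - l j\<bar> \<ge> B"
    and X: "X = {0..1} \<inter> sublevel c e" "measure lborel X \<ge> g" "g > 0"
    and par: "\<kappa> + sqrt (H * \<kappa>) + e\<^sup>2 \<le> g / 4" "2 * sqrt H / B \<le> g / 4" "0 \<le> \<kappa>" "0 \<le> e"
  shows "\<exists>s\<in>{0..1}. measure lborel (loss_set c e s) > \<kappa>"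
proof (rule ccontr)
  assume "\<not> ?thesis"
  then have loss: "measure lborel (loss_set c e s) \<le> \<kappa>" if "s \<in> {0..1}" for s using that by force
  have Xb: "X \<in> sets borel" "X \<subseteq> {0..1}" unfolding X by auto
  obtain s where s: "s \<in> {0..1}" "(LINT x:X|lborel. (cmod (tp c (x + s)))\<^sup>2) \<ge> measure lborel X - 2 * sqrt H / B"
    using integral_shift_average[OF Xb B gap c] by blast
  let ?L = "loss_set c e s"
  have Lb: "?L \<in> sets borel" "?L \<subseteq> {0..1}" by (auto simp: loss_set_def[of c e s])
  have XL: "X - ?L \<in> sets borel" "X - ?L \<subseteq> {0..1}" using Xb Lb by auto
  have LX: "?L \<subseteq> X" unfolding X loss_set_def by auto
  have "(LINT x:X|lborel. (cmod (tp c (x + s)))\<^sup>2) = (LINT x:(X - ?L) \<union> ?L|lborel. (cmod (tp c (x + s)))\<^sup>2)"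
    using LX by (simp add: Un_absorb2)
  also have "\<dots> = (LINT x:X - ?L|lborel. (cmod (tp c (x + s)))\<^sup>2) + (LINT x:?L|lborel. (cmod (tp c (x + s)))\<^sup>2)"
    using XL Lb by (intro set_integral_Un set_integrable_tp_sq) auto
  also have "(LINT x:X - ?L|lborel. (cmod (tp c (x + s)))\<^sup>2) \<le> (LINT x:X - ?L|lborel. e\<^sup>2)"
    using set_integrable_tp_sq[OF XL, of c s]
    by (intro set_integral_mono set_integrable_const_unit XL) (auto simp: X loss_set_def sublevel_def intro!: power_mono)
  also have "(LINT x:X - ?L|lborel. e\<^sup>2) = measure lborel (X - ?L) * e\<^sup>2"
    using emeasure_bounded_finite[OF bounded_subset[OF bounded_closed_interval XL(2)]] by (simp add: set_lebesgue_integral_def)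
  also have "measure lborel (X - ?L) * e\<^sup>2 \<le> 1 * e\<^sup>2" using measure_unit[OF XL] by (intro mult_right_mono) auto
  also have "(LINT x:?L|lborel. (cmod (tp c (x + s)))\<^sup>2) \<le> measure lborel ?L + sqrt (H * measure lborel ?L)"
    using integral_tp_sq_le[OF Lb, of "tr s c"] c by (simp add: tp_tr abs_le_iff)
  also have "\<dots> \<le> \<kappa> + sqrt (H * \<kappa>)"
    using loss[OF s(1)] Hpos by (intro add_mono real_sqrt_le_mono mult_left_mono) auto
  finally show False using s(2) X par by simp
qed

text \<open>Otherwise let \<open>A j\<close> be the shifts up to which the loss stays below \<open>kap j\<close>, and choose \<open>j\<close> with equal maximal
  rank of a frame from \<open>A j\<close> and from \<open>A (Suc j)\<close>. Then each translate by \<open>s \<in> A j\<close> is nearly a combination of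
  translates from \<open>A (Suc j)\<close>, so it stays below \<open>\<delta>\<close>, hence off a small set below \<open>e\<close>, on a slightly longer range of
  shifts; thus \<open>A j = {0..1}\<close>, against \<open>some_shift_loses\<close>.\<close>

lemma level_gap:
  assumes c: "nsq c = 1" and B: "B > 0"
    and gap: "\<And>k j. k \<in> K \<Longrightarrow> j \<in> K \<Longrightarrow> k \<noteq> j \<Longrightarrow> \<bar>l k - l j\<bar> \<ge> B"
    and X: "X = {0..1} \<inter> sublevel c e" "measure lborel X \<ge> g" "g > 0"
    and m: "m \<ge> 1" "real m * (g / 2) - sqrt (real m * H) \<ge> 1"
    and \<kappa>: "0 < \<kappa>" "real m * \<kappa> \<le> g / 2" "\<kappa> + sqrt (H * \<kappa>) + e\<^sup>2 \<le> g / 4" "2 * sqrt H / B \<le> g / 4"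
    and \<mu>: "\<mu> = \<kappa> / (4 * real m) ^ m"
    and \<eta>: "0 < \<eta>" "\<eta> \<le> 1" "(1 + sqrt H) * \<eta>\<^sup>2 / (\<delta> / 4)\<^sup>2 \<le> \<mu> / 4"
    and e: "0 < e" "e \<le> \<delta>" "real m * real m * Dseq \<eta> m * e \<le> \<delta> / 4" "real m * (Dseq \<eta> m * real m * e)\<^sup>2 < 1"
  shows "measure lborel {y\<in>{0..2}. e < cmod (tp c y) \<and> cmod (tp c y) \<le> \<delta>} > \<mu> / 4"
proof (rule ccontr)
  let ?V = "{y\<in>{0..2}. e < cmod (tp c y) \<and> cmod (tp c y) \<le> \<delta>}"
  assume "\<not> ?thesis"
  then have V: "measure lborel ?V \<le> \<mu> / 4" by simp
  have Vb[measurable]: "?V \<in> sets borel" by auto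
  \<comment> \<open>The factor 4 m between consecutive tolerances lets up to m translates from
    \<open>A (Suc j)\<close> lose at most \<open>kap j / 4\<close> together.\<close>
  define kap where "kap j = \<kappa> / (4 * real m) ^ j" for j
  \<comment> \<open>Quantifying over all smaller shifts makes \<open>A j\<close> an interval with
    left end 0, the shape needed for the induction in \<open>climb\<close>.\<close>
  define A where "A j = {s\<in>{0..1}. \<forall>s'\<in>{0..s}. measure lborel (loss_set c e s') \<le> kap j}" for j
  define fam where "fam j = {k. k \<le> m \<and> (\<exists>T v. frames c (A j) k (Dseq \<eta> k) T v)}" for j
  define r where "r j = Max (fam j)" for j
  have m4: "1 \<le> 4 * real m" using m by simp
  have kap_pos: "0 < kap j" for j using \<kappa> m by (simp add: kap_def)
  have kap_Suc: "kap (Suc j) = kap j / (4 * real m)" for j by (simp add: kap_def field_simps)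
  have kap_dec: "kap (Suc j) \<le> kap j" for j
    unfolding kap_Suc using kap_pos[of j] m4 by (simp add: field_simps mult_le_cancel_left1)
  have kap_anti: "kap j \<le> kap i" if "i \<le> j" for i j
    using lift_Suc_antimono_le[of kap, OF kap_dec that] .
  have kap0: "kap j \<le> \<kappa>" for j using kap_anti[of 0 j] by (simp add: kap_def)
  have kapm: "\<mu> \<le> kap j" if "j \<le> m" for j using kap_anti[OF that] by (simp add: \<mu> kap_def)
  have A_sub: "A (Suc j) \<subseteq> A j" for j unfolding A_def using kap_dec[of j] by fastforce
  have \<delta>: "\<delta> > 0" using e by simp
  have Am: "measure lborel (loss_set c e s) \<le> kap j" if "s \<in> A j" for s j
    using that unfolding A_def by auto
  have fin: "finite (fam j)" for j by (rule finite_subset[of _ "{..m}"]) (auto simp: fam_def)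
  have "0 \<in> fam j" for j
    unfolding fam_def frames_def by (auto intro!: exI[of _ "{}"])
  then have ne: "fam j \<noteq> {}" for j by blast
  have r_in: "r j \<in> fam j" for j unfolding r_def by (rule Max_in[OF fin ne])
  have "fam (Suc j) \<subseteq> fam j" for j
  proof
    fix k assume "k \<in> fam (Suc j)"
    then obtain T v where "k \<le> m" "frames c (A (Suc j)) k (Dseq \<eta> k) T v" by (auto simp: fam_def)
    moreover from this have "frames c (A j) k (Dseq \<eta> k) T v" using A_sub[of j] unfolding frames_def by auto
    ultimately show "k \<in> fam j" by (auto simp: fam_def)
  qed
  then have r_dec: "r (Suc j) \<le> r j" for j unfolding r_def using ne fin by (intro Max_mono) auto
  have r_lt: "r j < m" for j
  proof (rule ccontr)
    assume "\<not> r j < m"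
    then have "r j = m" using r_in[of j] by (auto simp: fam_def)
    then obtain T v where fr: "frames c (A j) m (Dseq \<eta> m) T v" using r_in[of j] by (auto simp: fam_def)
    show False
    proof (rule frame_rank_bound[OF fr X(1,2), of \<kappa>])
      show "measure lborel (loss_set c e t) \<le> \<kappa>" if "t \<in> A j" for t using Am[OF that] kap0[of j] by simp
    qed (use \<kappa> m e Dseq_nonneg[OF \<eta>(1)] in auto)
  qed
  obtain j where j: "j < m" "r (Suc j) = r j" using decreasing_nat_repeats[of r, OF r_dec r_lt] by blast
  define k where "k = r j"
  have km: "k < m" unfolding k_def by (rule r_lt)
  \<comment> \<open>Equal ranks let the frame come from the smaller set \<open>A (Suc j)\<close>,
    with its finer tolerance, while every translate from the larger set \<open>A j\<close> lies
    within \<open>\<eta>\<close> of its span.\<close>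
  obtain T v where fr: "frames c (A (Suc j)) k (Dseq \<eta> k) T v"
    using r_in[of "Suc j"] j by (auto simp: fam_def k_def)
  have frj: "frames c (A j) k (Dseq \<eta> k) T v" using fr A_sub[of j] unfolding frames_def by auto
  have small: "nsq (residual (tr s c) k v) < \<eta>\<^sup>2" if s: "s \<in> A j" for s
  proof (rule ccontr)
    assume "\<not> ?thesis"
    then have "\<exists>T v. frames c (A j) (Suc k) (Dseq \<eta> (Suc k)) T v"
      using frames_extend[OF frj c s \<eta>(1,2) refl] by simp
    then have "Suc k \<in> fam j" using km by (auto simp: fam_def)
    then have "Suc k \<le> r j" unfolding r_def by (rule Max_ge[OF fin])
    then show False by (simp add: k_def)
  qed
  have orth: "\<And>i j. i < k \<Longrightarrow> j < k \<Longrightarrow> ip (v i) (v j) = (if i = j then 1 else 0)"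
    and dom: "\<And>i x. i < k \<Longrightarrow> cmod (tp (v i) x) \<le> Dseq \<eta> k * (\<Sum>t\<in>T. cmod (tp c (x + t)))"
    and T: "finite T" "T \<subseteq> A (Suc j)" "card T \<le> k"
    using fr by (auto simp: frames_def)
  have n1: "nsq (v i) = 1" if "i < k" for i using orth[OF that that] by (simp add: ip_self)
  \<comment> \<open>The modulus of continuity depends on \<open>c\<close>, but it only fixes the
    step length \<open>t0\<close> of a finite climb and enters no bound.\<close>
  have "uniformly_continuous_on {0..2} (tp c)"
    by (intro compact_uniformly_continuous continuous_on_tp) auto
  then obtain t1 where t1: "t1 > 0" "\<And>y y'. y \<in> {0..2} \<Longrightarrow> y' \<in> {0..2} \<Longrightarrow> dist y' y < t1 \<Longrightarrow> dist (tp c y') (tp c y) < \<delta> / 2"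
    unfolding uniformly_continuous_on_def using \<delta> by (metis half_gt_zero)
  define t0 where "t0 = t1 / 2"
  have t0: "t0 > 0" using t1 by (simp add: t0_def)
  have step: "measure lborel (loss_set c e (s + t)) \<le> kap j" if s: "s \<in> A j" and t: "t \<in> {0..t0}" "s + t \<le> 1" for s t
  proof -
    let ?w = "residual (tr s c) k v"
    let ?Z = "{x\<in>{0..1}. cmod (tp ?w x) > \<delta> / 4}"
    let ?W = "{x. x + (s + t) \<in> ?V}"
    have s01: "s \<in> {0..1}" using s by (auto simp: A_def)
    have Wb: "?W \<in> sets borel" by measurable
    \<comment> \<open>A lost point is lost already for a shift in \<open>T\<close>, or has a large
      residual, or its value lands in the intermediate band between \<open>e\<close> and
      \<open>\<delta>\<close>. Each of the three sets is allowed a quarter of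
      \<open>kap j\<close>.\<close>
    have incl: "loss_set c e (s + t) \<subseteq> (\<Union>t\<in>T. loss_set c e t) \<union> (?Z \<union> ({0..1} \<inter> ?W))"
    proof
      fix x assume x: "x \<in> loss_set c e (s + t)"
      then have x01: "x \<in> {0..1}" and xs: "cmod (tp c x) \<le> e" and xl: "cmod (tp c (x + (s + t))) > e"
        by (auto simp: loss_set_def sublevel_def)
      show "x \<in> (\<Union>t\<in>T. loss_set c e t) \<union> (?Z \<union> ({0..1} \<inter> ?W))"
      proof (cases "x \<in> (\<Union>t\<in>T. loss_set c e t) \<union> ?Z")
        case False
        then have tT: "cmod (tp c (x + t)) \<le> e" if "t \<in> T" for t
          using that x01 xs by (auto simp: loss_set_def sublevel_def)
        have z: "cmod (tp ?w x) \<le> \<delta> / 4" using False x01 by auto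
        have "(\<Sum>t\<in>T. cmod (tp c (x + t))) \<le> (\<Sum>t\<in>T. e)" using tT by (intro sum_mono) auto
        also have "\<dots> \<le> real m * e" using T km e by (auto intro!: mult_right_mono)
        finally have sT: "(\<Sum>t\<in>T. cmod (tp c (x + t))) \<le> real m * e" .
        have vb: "cmod (tp (v i) x) \<le> Dseq \<eta> m * (real m * e)" if "i < k" for i
        proof -
          have "Dseq \<eta> k * (\<Sum>t\<in>T. cmod (tp c (x + t))) \<le> Dseq \<eta> m * (real m * e)"
            using sT km \<eta> e by (intro mult_mono Dseq_mono Dseq_nonneg) (auto intro: sum_nonneg)
          then show ?thesis using dom[OF that, of x] by simp
        qed
        have "cmod (tp c (x + s)) = cmod ((\<Sum>i<k. ip (tr s c) (v i) * tp (v i) x) + tp ?w x)"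
          using tp_residual[of "tr s c" x v k] by (simp add: tp_tr)
        also have "\<dots> \<le> (\<Sum>i<k. cmod (ip (tr s c) (v i) * tp (v i) x)) + cmod (tp ?w x)"
          by (intro order_trans[OF norm_triangle_ineq] add_right_mono norm_sum)
        also have "(\<Sum>i<k. cmod (ip (tr s c) (v i) * tp (v i) x)) \<le> (\<Sum>i<k. 1 * (Dseq \<eta> m * (real m * e)))"
        proof (intro sum_mono)
          fix i assume "i \<in> {..<k}"
          then have i: "i < k" by simp
          show "cmod (ip (tr s c) (v i) * tp (v i) x) \<le> 1 * (Dseq \<eta> m * (real m * e))"
            unfolding norm_mult
            using ip_le[of "tr s c" "v i"] c n1[OF i] vb[OF i] by (intro mult_mono) auto
        qed
        also have "\<dots> \<le> real m * (Dseq \<eta> m * (real m * e))"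
          using km Dseq_nonneg[OF \<eta>(1), of m] e by (auto intro!: mult_right_mono)
        also have "\<dots> \<le> \<delta> / 4" using e(3) by (simp add: mult_ac)
        finally have P: "cmod (tp c (x + s)) \<le> \<delta> / 2" using z by simp
        have "dist (tp c (x + (s + t))) (tp c (x + s)) < \<delta> / 2"
          using x01 s01 t t0 t1(1) by (intro t1(2)) (auto simp: dist_norm t0_def)
        then have "cmod (tp c (x + (s + t))) \<le> \<delta>"
          using P norm_triangle_ineq2[of "tp c (x + (s + t))" "tp c (x + s)"] by (simp add: dist_norm)
        then have "x + (s + t) \<in> ?V" using x01 s01 t xl by auto
        then show ?thesis using x01 by auto
      qed auto
    qed
    have Zb: "?Z \<in> sets borel" by auto
    have Lb: "(\<Union>t\<in>T. loss_set c e t) \<in> sets borel" using T by auto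
    have Lbd: "(\<Union>t\<in>T. loss_set c e t) \<subseteq> {0..1}" by (auto simp: loss_set_def)
    have "measure lborel (loss_set c e (s + t)) \<le> measure lborel ((\<Union>t\<in>T. loss_set c e t) \<union> (?Z \<union> ({0..1} \<inter> ?W)))"
    proof (rule measure_lborel_mono[OF incl])
      show "bounded ((\<Union>t\<in>T. loss_set c e t) \<union> (?Z \<union> ({0..1} \<inter> ?W)))"
        by (rule bounded_subset[OF bounded_closed_interval[of 0 1]]) (use Lbd in blast)
    qed (use Lb Zb Wb in auto)
    also have "\<dots> \<le> measure lborel (\<Union>t\<in>T. loss_set c e t) + (measure lborel ?Z + measure lborel ({0..1} \<inter> ?W))"
      using Lb Zb Wb by (intro order_trans[OF measure_Un_le] add_left_mono measure_Un_le) auto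
    also have "measure lborel (\<Union>t\<in>T. loss_set c e t) \<le> kap j / 4"
    proof -
      have "measure lborel (\<Union>t\<in>T. loss_set c e t) \<le> (\<Sum>t\<in>T. measure lborel (loss_set c e t))"
        using T by (intro measure_UNION_le) auto
      also have "\<dots> \<le> (\<Sum>t\<in>T. kap (Suc j))" using T Am by (intro sum_mono) auto
      also have "\<dots> \<le> real m * kap (Suc j)" using T km kap_pos[of "Suc j"] by (auto intro!: mult_right_mono)
      also have "\<dots> = kap j / 4" using m by (simp add: kap_Suc)
      finally show ?thesis .
    qed
    also have "measure lborel ?Z \<le> kap j / 4"
      by (rule order_trans[OF large_values_small[OF small[OF s]] order_trans[OF \<eta>(3)]])
        (use \<delta> kapm[of j] j in auto)
    also have "measure lborel ({0..1} \<inter> ?W) \<le> kap j / 4"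
    proof -
      have bW: "bounded ?W"
      proof (rule bounded_subset[OF bounded_closed_interval[of "-1" 2]])
        show "?W \<subseteq> {-1..2}" using s01 t by auto
      qed
      have "measure lborel ({0..1} \<inter> ?W) \<le> measure lborel ?W"
        using Wb bW by (intro measure_lborel_mono) auto
      also have "\<dots> = measure lborel ?V" by (rule measure_shift[OF Vb])
      also have "\<dots> \<le> kap j / 4" using V kapm[of j] j by simp
      finally show ?thesis .
    qed
    finally show ?thesis using kap_pos[of j] by simp
  qed
  have zero: "0 \<in> A j"
  proof -
    have "loss_set c e 0 = {}" by (auto simp: loss_set_def)
    then show ?thesis using kap_pos[of j] by (auto simp: A_def)
  qed
  have climb: "min 1 (real i * t0) \<in> A j" for i
  proof (induction i)
    case (Suc i)
    let ?s = "min 1 (real i * t0)" and ?s' = "min 1 (real (Suc i) * t0)"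
    have *: "measure lborel (loss_set c e u) \<le> kap j" if u: "u \<in> {0..?s'}" for u
    proof (cases "u \<le> ?s")
      case True then show ?thesis using Suc.IH u by (auto simp: A_def)
    next
      case False
      have "measure lborel (loss_set c e (?s + (u - ?s))) \<le> kap j"
        using Suc.IH u False t0 by (intro step) (auto simp: ring_distribs min_def split: if_splits)
      then show ?thesis by simp
    qed
    show ?case unfolding A_def using * t0 by auto
  qed (use zero in simp)
  obtain n :: nat where "1 / t0 < real n" using reals_Archimedean2 by blast
  then have "min 1 (real n * t0) = 1" using t0 by (simp add: field_simps)
  then have one: "1 \<in> A j" using climb[of n] by simp
  have "measure lborel (loss_set c e s) \<le> \<kappa>" if "s \<in> {0..1}" for s
    using one that kap0[of j] unfolding A_def by fastforce
  moreover have "\<exists>s\<in>{0..1}. measure lborel (loss_set c e s) > \<kappa>"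
    by (rule some_shift_loses[OF c B gap X]) (use \<kappa> e in auto)
  ultimately show False by force
qed

end

section \<open>A large sieve inequality for frequencies of bounded multiplicity, and its
  dual\<close>

lemma sum_exp_neg_abs_le:
  fixes J :: "int set"
  assumes "finite J"
  shows "(\<Sum>j\<in>J. exp (- \<bar>real_of_int j\<bar>)) \<le> 4"
proof -
  have e1: "exp (-1 :: real) \<le> 1 / 2"
  proof -
    have "2 \<le> exp (1::real)" using exp_ge_add_one_self[of 1] by simp
    then show ?thesis by (simp add: exp_minus field_simps)
  qed
  have pw: "exp (- real n) \<le> (1 / 2) ^ n" for n
    using power_mono[OF e1, of n] by (simp add: exp_of_nat_mult[symmetric])
  have g: "(\<Sum>n\<in>I. (1 / 2 :: real) ^ n) \<le> 2" if "finite I" for I :: "nat set"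
    using sum_le_suminf[OF summable_geometric that, of "1 / 2 :: real"] suminf_geometric[of "1/2 :: real"] by simp
  have half: "(\<Sum>j\<in>I. exp (- \<bar>real_of_int j\<bar>)) \<le> 2" if "finite I" "inj_on (\<lambda>j. nat \<bar>j\<bar>) I" for I
  proof -
    have "(\<Sum>j\<in>I. exp (- \<bar>real_of_int j\<bar>)) \<le> (\<Sum>j\<in>I. (1 / 2) ^ nat \<bar>j\<bar>)"
    proof (rule sum_mono)
      fix j show "exp (- \<bar>real_of_int j\<bar>) \<le> (1 / 2) ^ nat \<bar>j\<bar>"
        using pw[of "nat \<bar>j\<bar>"] by simp
    qed
    also have "\<dots> = (\<Sum>n\<in>(\<lambda>j. nat \<bar>j\<bar>) ` I. (1 / 2) ^ n)"
      using that(2) by (simp add: sum.reindex)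
    also have "\<dots> \<le> 2" using that by (intro g) auto
    finally show ?thesis .
  qed
  have "J = {j\<in>J. 0 \<le> j} \<union> {j\<in>J. j < 0}" by auto
  then have "(\<Sum>j\<in>J. exp (- \<bar>real_of_int j\<bar>)) = (\<Sum>j\<in>{j\<in>J. 0 \<le> j}. exp (- \<bar>real_of_int j\<bar>)) + (\<Sum>j\<in>{j\<in>J. j < 0}. exp (- \<bar>real_of_int j\<bar>))"
    using assms by (metis (no_types, lifting) sum.union_disjoint[of "{j\<in>J. 0 \<le> j}" "{j\<in>J. j < 0}"] finite_Collect_conjI Int_emptyI linorder_not_less mem_Collect_eq finite_subset Un_upper1 Un_upper2)
  also have "\<dots> \<le> 2 + 2"
    using assms by (intro add_mono half) (auto simp: inj_on_def)
  finally show ?thesis by simp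
qed

text \<open>Frequencies are grouped by the integer part of \<open>\<xi> q - x\<close>. Two in one
  group differ by at most 1, so a group has at most \<open>N\<close> members, and on the group of j
  the Gaussian is at most exp (2 - \<bar>j\<bar>).\<close>

lemma gaussian_sum_le:
  fixes \<xi> :: "'p \<Rightarrow> real"
  assumes P: "finite P" and N: "\<And>p. p \<in> P \<Longrightarrow> card {q\<in>P. \<bar>\<xi> p - \<xi> q\<bar> \<le> 1} \<le> N"
  shows "(\<Sum>q\<in>P. exp (- ((2 * pi * (x - \<xi> q))\<^sup>2) / 2)) \<le> 4 * exp 2 * real N"
proof -
  let ?f = "\<lambda>q. \<lfloor>\<xi> q - x\<rfloor>"
  have pt: "exp (- ((2 * pi * (x - \<xi> q))\<^sup>2) / 2) \<le> exp 2 * exp (- \<bar>real_of_int (?f q)\<bar>)" for q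
  proof -
    define d where "d = \<xi> q - x"
    have fl: "real_of_int (?f q) \<le> d" "d < real_of_int (?f q) + 1" unfolding d_def by linarith+
    then have a: "\<bar>real_of_int (?f q)\<bar> \<le> \<bar>d\<bar> + 1" by linarith
    have "\<bar>d\<bar> - 1 \<le> d\<^sup>2"
    proof (cases "\<bar>d\<bar> \<le> 1")
      case False
      then have "\<bar>d\<bar> * 1 \<le> \<bar>d\<bar> * \<bar>d\<bar>" by (intro mult_left_mono) auto
      then show ?thesis by (simp add: power2_eq_square)
    qed (use zero_le_power2[of d] in linarith)
    also have "d\<^sup>2 * 1 \<le> d\<^sup>2 * (2 * pi * pi)"
    proof (rule mult_left_mono)
      have "1 \<le> 2 * pi" using pi_gt3 by simp
      also have "2 * pi * 1 \<le> 2 * pi * pi" using pi_gt3 by (intro mult_left_mono) auto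
      finally show "1 \<le> 2 * pi * pi" by simp
    qed auto
    finally have "\<bar>d\<bar> - 1 \<le> (2 * pi * (x - \<xi> q))\<^sup>2 / 2"
      by (simp add: d_def power2_eq_square algebra_simps)
    then have "- ((2 * pi * (x - \<xi> q))\<^sup>2) / 2 \<le> 2 + (- \<bar>real_of_int (?f q)\<bar>)" using a by linarith
    then show ?thesis by (simp add: exp_add[symmetric])
  qed
  have "(\<Sum>q\<in>P. exp (- ((2 * pi * (x - \<xi> q))\<^sup>2) / 2)) \<le> (\<Sum>q\<in>P. exp 2 * exp (- \<bar>real_of_int (?f q)\<bar>))"
    by (intro sum_mono pt)
  also have "\<dots> = (\<Sum>j\<in>?f ` P. \<Sum>q\<in>{q\<in>P. ?f q = j}. exp 2 * exp (- \<bar>real_of_int (?f q)\<bar>))"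
    by (rule sum.image_gen[OF P])
  also have "\<dots> \<le> (\<Sum>j\<in>?f ` P. real N * (exp 2 * exp (- \<bar>real_of_int j\<bar>)))"
  proof (rule sum_mono)
    fix j assume "j \<in> ?f ` P"
    then obtain p where p: "p \<in> P" "?f p = j" by auto
    have "card {q\<in>P. ?f q = j} \<le> card {q\<in>P. \<bar>\<xi> p - \<xi> q\<bar> \<le> 1}"
    proof (rule card_mono)
      show "{q\<in>P. ?f q = j} \<subseteq> {q\<in>P. \<bar>\<xi> p - \<xi> q\<bar> \<le> 1}"
      proof (rule subsetI)
        fix q assume "q \<in> {q\<in>P. ?f q = j}"
        then have "q \<in> P" "?f q = ?f p" using p(2) by auto
        moreover from this(2) have "\<bar>\<xi> p - \<xi> q\<bar> \<le> 1" by linarith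
        ultimately show "q \<in> {q\<in>P. \<bar>\<xi> p - \<xi> q\<bar> \<le> 1}" by simp
      qed
    qed (use P in auto)
    then have "real (card {q\<in>P. ?f q = j}) \<le> real N" using N[OF p(1)] by simp
    then show "(\<Sum>q\<in>{q\<in>P. ?f q = j}. exp 2 * exp (- \<bar>real_of_int (?f q)\<bar>)) \<le> real N * (exp 2 * exp (- \<bar>real_of_int j\<bar>))"
      by (simp add: mult_right_mono)
  qed
  also have "\<dots> = exp 2 * real N * (\<Sum>j\<in>?f ` P. exp (- \<bar>real_of_int j\<bar>))"
    by (simp add: sum_distrib_left mult_ac)
  also have "\<dots> \<le> exp 2 * real N * 4"
    using P by (intro mult_left_mono sum_exp_neg_abs_le) auto
  finally show ?thesis by (simp add: mult_ac)
qed

text \<open>The numerator is the constant of \<open>gaussian_sum_le\<close>; dividing by the density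
  at 1, its minimum on the unit interval, pays for dominating an indicator by a Gaussian.\<close>

definition sieve_const :: real where
  "sieve_const = 4 * exp 2 / std_normal_density 1"

lemma std_normal_pos: "0 < std_normal_density x"
  by (simp add: std_normal_density_def)

lemma sieve_const_pos: "0 < sieve_const"
  by (simp add: sieve_const_def std_normal_pos)

text \<open>The indicator of \<open>Y\<close> is dominated by a multiple of the Gaussian density,
  whose transform is positive and decays fast. The resulting double sum is treated by Schur's test,
  with row sums bounded by \<open>gaussian_sum_le\<close>.\<close>

lemma large_sieve:
  fixes \<xi> :: "'p \<Rightarrow> real" and b :: "'p \<Rightarrow> complex"
  assumes P: "finite P" and N: "\<And>p. p \<in> P \<Longrightarrow> card {q\<in>P. \<bar>\<xi> p - \<xi> q\<bar> \<le> 1} \<le> N"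
    and Y: "Y \<in> sets borel" "Y \<subseteq> {0..1}"
  shows "(LINT x:Y|lborel. (cmod (\<Sum>p\<in>P. b p * expi (\<xi> p * x)))\<^sup>2) \<le> sieve_const * real N * (\<Sum>p\<in>P. (cmod (b p))\<^sup>2)"
proof -
  let ?F = "\<lambda>x. \<Sum>p\<in>P. b p * expi (\<xi> p * x)" and ?s = "std_normal_density"
  let ?g = "\<lambda>p q. exp (- ((2 * pi * (\<xi> p - \<xi> q))\<^sup>2) / 2)"
  have Fm[measurable]: "?F \<in> borel_measurable borel" by measurable
  have Fb: "cmod (?F x) \<le> (\<Sum>p\<in>P. cmod (b p))" for x
    using norm_sum[of "\<lambda>p. b p * expi (\<xi> p * x)" P] by (simp add: norm_mult)
  have intg: "integrable lborel (\<lambda>x. ?s x * (cmod (?F x))\<^sup>2)"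
  proof (rule Bochner_Integration.integrable_bound)
    show "integrable lborel (\<lambda>x. ?s x * (\<Sum>p\<in>P. cmod (b p))\<^sup>2)" using integrable_std_normal by simp
    show "AE x in lborel. norm (?s x * (cmod (?F x))\<^sup>2) \<le> norm (?s x * (\<Sum>p\<in>P. cmod (b p))\<^sup>2)"
      using Fb by (intro AE_I2) (auto simp: abs_mult intro!: mult_left_mono power_mono)
  qed measurable
  have ie: "integrable lborel (\<lambda>x. complex_of_real (?s x) * expi (y * x))" for y
    by (rule integrable_mult_bounded[where C = 1]) (use integrable_std_normal in auto)
  have "complex_of_real (LINT x|lborel. ?s x * (cmod (?F x))\<^sup>2)
     = (LINT x|lborel. complex_of_real (?s x * (cmod (?F x))\<^sup>2))"
    by (rule integral_complex_of_real[symmetric])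
  also have "\<dots> = (LINT x|lborel. (\<Sum>p\<in>P. \<Sum>q\<in>P. b p * cnj (b q) * (of_real (?s x) * expi ((\<xi> p - \<xi> q) * x))))"
  proof (intro Bochner_Integration.integral_cong refl)
    fix x
    have "complex_of_real (?s x * (cmod (?F x))\<^sup>2) = of_real (?s x) * (\<Sum>p\<in>P. \<Sum>q\<in>P. (b p * expi (\<xi> p * x)) * cnj (b q * expi (\<xi> q * x)))"
      by (simp only: of_real_mult complex_norm_square cnj_sum sum_product)
    then show "complex_of_real (?s x * (cmod (?F x))\<^sup>2) = (\<Sum>p\<in>P. \<Sum>q\<in>P. b p * cnj (b q) * (of_real (?s x) * expi ((\<xi> p - \<xi> q) * x)))"
      by (simp add: sum_distrib_left expi_diff_mult mult_ac del: cnj_expi)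
  qed
  also have "\<dots> = (\<Sum>p\<in>P. \<Sum>q\<in>P. b p * cnj (b q) * (LINT x|lborel. of_real (?s x) * expi ((\<xi> p - \<xi> q) * x)))"
    using ie by (simp add: Bochner_Integration.integral_sum)
  also have "\<dots> = (\<Sum>p\<in>P. \<Sum>q\<in>P. b p * cnj (b q) * of_real (?g p q))"
    by (simp only: std_normal_ft)
  finally have eq: "complex_of_real (LINT x|lborel. ?s x * (cmod (?F x))\<^sup>2) = (\<Sum>p\<in>P. \<Sum>q\<in>P. b p * cnj (b q) * of_real (?g p q))" .
  have "(LINT x|lborel. ?s x * (cmod (?F x))\<^sup>2) \<le> cmod (\<Sum>p\<in>P. \<Sum>q\<in>P. b p * cnj (b q) * of_real (?g p q))"
    unfolding eq[symmetric] by simp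
  also have "\<dots> \<le> (\<Sum>p\<in>P. \<Sum>q\<in>P. cmod (b p) * cmod (b q) * ?g p q)"
    by (intro order_trans[OF norm_sum sum_mono]) (auto simp: norm_mult)
  also have "\<dots> \<le> (\<Sum>p\<in>P. \<Sum>q\<in>P. ((cmod (b p))\<^sup>2 * ?g p q + (cmod (b q))\<^sup>2 * ?g q p) / 2)"
  proof (intro sum_mono)
    fix p q
    have gs: "?g q p = ?g p q" by (simp add: power2_commute algebra_simps power2_eq_square)
    have "cmod (b p) * cmod (b q) \<le> ((cmod (b p))\<^sup>2 + (cmod (b q))\<^sup>2) / 2"
      using sum_squares_bound[of "cmod (b p)" "cmod (b q)"] by simp
    then have "cmod (b p) * cmod (b q) * ?g p q \<le> ((cmod (b p))\<^sup>2 + (cmod (b q))\<^sup>2) / 2 * ?g p q"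
      by (intro mult_right_mono) auto
    then show "cmod (b p) * cmod (b q) * ?g p q \<le> ((cmod (b p))\<^sup>2 * ?g p q + (cmod (b q))\<^sup>2 * ?g q p) / 2"
      unfolding gs by (simp add: field_simps)
  qed
  also have "\<dots> = (\<Sum>p\<in>P. \<Sum>q\<in>P. (cmod (b p))\<^sup>2 * ?g p q)"
  proof -
    have "(\<Sum>p\<in>P. \<Sum>q\<in>P. (cmod (b q))\<^sup>2 * ?g q p) = (\<Sum>p\<in>P. \<Sum>q\<in>P. (cmod (b p))\<^sup>2 * ?g p q)"
      by (rule sum.swap)
    then show ?thesis by (simp add: sum_divide_distrib[symmetric] sum.distrib)
  qed
  also have "\<dots> \<le> (\<Sum>p\<in>P. (cmod (b p))\<^sup>2 * (4 * exp 2 * real N))"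
    unfolding sum_distrib_left[symmetric] by (intro sum_mono mult_left_mono gaussian_sum_le[OF P N]) auto
  finally have up: "(LINT x|lborel. ?s x * (cmod (?F x))\<^sup>2) \<le> (\<Sum>p\<in>P. (cmod (b p))\<^sup>2) * (4 * exp 2 * real N)"
    by (simp add: sum_distrib_right)
  have "?s 1 * (LINT x:Y|lborel. (cmod (?F x))\<^sup>2) = (LINT x|lborel. ?s 1 * (indicator Y x * (cmod (?F x))\<^sup>2))"
    unfolding set_lebesgue_integral_def by simp
  also have "\<dots> \<le> (LINT x|lborel. ?s x * (cmod (?F x))\<^sup>2)"
  proof (rule integral_mono[OF _ intg])
    have "set_integrable lborel Y (\<lambda>x. (cmod (?F x))\<^sup>2)"
      by (intro set_integrable_continuous_unit Y continuous_intros)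
    then show "integrable lborel (\<lambda>x. ?s 1 * (indicator Y x * (cmod (?F x))\<^sup>2))"
      by (simp add: set_integrable_def)
    show "?s 1 * (indicator Y x * (cmod (?F x))\<^sup>2) \<le> ?s x * (cmod (?F x))\<^sup>2" for x
    proof (cases "x \<in> Y")
      case True
      then have "x\<^sup>2 \<le> 1" using Y(2) by (auto simp: power_le_one)
      then have "?s 1 \<le> ?s x" by (simp add: std_normal_density_def divide_right_mono)
      then show ?thesis using True by (simp add: mult_right_mono)
    qed simp
  qed
  also note up
  finally show ?thesis using std_normal_pos[of 1] by (simp add: sieve_const_def field_simps)
qed

text \<open>Duality: \<open>large_sieve\<close> is applied with the conjugates of the integrals as
  coefficients. The sum \<open>T\<close> of their squares is then the integral of that exponential
  sum over \<open>Y\<close>, and half of \<open>T\<close> is absorbed after splitting its modulus as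
  t / 2 plus a square.\<close>

lemma sieve_dual:
  fixes \<xi> :: "'p \<Rightarrow> real"
  assumes P: "finite P" and N: "\<And>p. p \<in> P \<Longrightarrow> card {q\<in>P. \<bar>\<xi> p - \<xi> q\<bar> \<le> 1} \<le> N"
    and Y: "Y \<in> sets borel" "Y \<subseteq> {0..1}"
  shows "(\<Sum>p\<in>P. (cmod (LINT x:Y|lborel. expi (\<xi> p * x)))\<^sup>2) \<le> (sieve_const * real N + 1) * measure lborel Y"
proof -
  define W where "W p = (LINT x:Y|lborel. expi (\<xi> p * x))" for p
  define T where "T = (\<Sum>p\<in>P. (cmod (W p))\<^sup>2)"
  \<comment> \<open>The summand 1 keeps \<open>t\<close> positive when \<open>N\<close> is
    0.\<close>
  define t where "t = sieve_const * real N + 1"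
  let ?F = "\<lambda>x. \<Sum>p\<in>P. cnj (W p) * expi (\<xi> p * x)"
  have t: "t > 0" using sieve_const_pos by (simp add: t_def add_nonneg_pos)
  have T0: "0 \<le> T" by (simp add: T_def sum_nonneg)
  have si: "set_integrable lborel Y (\<lambda>x. cnj (W p) * expi (\<xi> p * x))" for p
    by (intro set_integrable_continuous_unit Y continuous_intros)
  have siF: "set_integrable lborel Y (\<lambda>x. cmod (?F x))" "set_integrable lborel Y (\<lambda>x. t / 2 + (cmod (?F x))\<^sup>2 / (2 * t))"
    "set_integrable lborel Y (\<lambda>x. (cmod (?F x))\<^sup>2 / (2 * t))"
    by (intro set_integrable_continuous_unit Y continuous_intros; use t in simp)+
  have "complex_of_real T = (\<Sum>p\<in>P. cnj (W p) * W p)"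
    by (simp add: T_def complex_norm_square mult.commute del: of_real_power)
  also have "\<dots> = (LINT x:Y|lborel. ?F x)"
    unfolding set_lebesgue_integral_sum[OF si] by (simp add: W_def)
  finally have "T = cmod (LINT x:Y|lborel. ?F x)" using T0 by (metis abs_of_nonneg norm_of_real)
  also have "\<dots> \<le> (LINT x:Y|lborel. cmod (?F x))"
    unfolding set_lebesgue_integral_def by (rule order_trans[OF integral_norm_bound]) simp
  also have "\<dots> \<le> (LINT x:Y|lborel. t / 2 + (cmod (?F x))\<^sup>2 / (2 * t))"
  proof (intro set_integral_mono siF)
    fix x
    have "0 \<le> (cmod (?F x) - t)\<^sup>2 / (2 * t)" using t by simp
    also have "\<dots> = t / 2 + (cmod (?F x))\<^sup>2 / (2 * t) - cmod (?F x)"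
      using t by (simp add: field_simps power2_eq_square)
    finally show "cmod (?F x) \<le> t / 2 + (cmod (?F x))\<^sup>2 / (2 * t)" by simp
  qed
  also have "\<dots> = (LINT x:Y|lborel. t / 2) + (LINT x:Y|lborel. (cmod (?F x))\<^sup>2 / (2 * t))"
    by (intro set_integral_add(2) siF set_integrable_continuous_unit Y) auto
  also have "(LINT x:Y|lborel. t / 2) = measure lborel Y * (t / 2)"
    using emeasure_bounded_finite[OF bounded_subset[OF bounded_closed_interval Y(2)]] by (simp add: set_lebesgue_integral_def)
  also have "(LINT x:Y|lborel. (cmod (?F x))\<^sup>2 / (2 * t)) = (LINT x:Y|lborel. (cmod (?F x))\<^sup>2) / (2 * t)"
    by simp
  also have "\<dots> \<le> (t * T) / (2 * t)"
  proof (rule divide_right_mono)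
    have "(LINT x:Y|lborel. (cmod (?F x))\<^sup>2) \<le> sieve_const * real N * (\<Sum>p\<in>P. (cmod (cnj (W p)))\<^sup>2)"
      by (rule large_sieve[OF P N Y])
    also have "\<dots> \<le> t * T" using T0 by (simp add: T_def t_def algebra_simps)
    finally show "(LINT x:Y|lborel. (cmod (?F x))\<^sup>2) \<le> t * T" .
  qed (use t in simp)
  finally have "T \<le> t * measure lborel Y" using t by (simp add: field_simps)
  then show ?thesis by (simp add: T_def W_def t_def)
qed

text \<open>Each upper bound holds strictly in the limit, so small positive \<open>e\<close> satisfy
  all of them.\<close>

lemma exists_small_level:
  assumes "0 < (\<delta>::real)" "0 < a" "(b::real) < a"
  shows "\<exists>e. 0 < e \<and> e \<le> \<delta> \<and> r * e \<le> \<delta> / 4 \<and> real m * (q * e)\<^sup>2 < 1 \<and> b + e\<^sup>2 \<le> a"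
proof -
  have "((\<lambda>e. r * e) \<longlongrightarrow> r * 0) (at_right (0::real))" "((\<lambda>e. real m * (q * e)\<^sup>2) \<longlongrightarrow> real m * (q * 0)\<^sup>2) (at_right (0::real))"
    "((\<lambda>e. b + e\<^sup>2) \<longlongrightarrow> b + 0\<^sup>2) (at_right (0::real))" "((\<lambda>e. e) \<longlongrightarrow> (0::real)) (at_right (0::real))"
    by (intro tendsto_intros)+
  from order_tendstoD(2)[OF this(1), of "\<delta> / 4"] order_tendstoD(2)[OF this(2), of 1]
    order_tendstoD(2)[OF this(3), of a] order_tendstoD(2)[OF this(4), of \<delta>]
  have "\<forall>\<^sub>F e in at_right (0::real). r * e < \<delta> / 4" "\<forall>\<^sub>F e in at_right (0::real). real m * (q * e)\<^sup>2 < 1"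
    "\<forall>\<^sub>F e in at_right (0::real). b + e\<^sup>2 < a" "\<forall>\<^sub>F e in at_right (0::real). e < \<delta>"
    using assms by simp_all
  moreover have "\<forall>\<^sub>F e in at_right (0::real). 0 < e" by (simp add: eventually_at_right_less)
  ultimately have "\<forall>\<^sub>F e in at_right (0::real). 0 < e \<and> e \<le> \<delta> \<and> r * e \<le> \<delta> / 4 \<and> real m * (q * e)\<^sup>2 < 1 \<and> b + e\<^sup>2 \<le> a"
    by eventually_elim auto
  then show ?thesis using eventually_happens' trivial_limit_at_right_real by blast
qed

text \<open>Pigeonhole over a chain of levels: the sets where the sum lies between consecutive levels are disjoint, so they
  cannot all have measure above \<open>\<mu> / 4\<close>.\<close>

lemma trig_sums_lower_bound:
  assumes \<gamma>: "0 < \<gamma>" and H: "0 < H"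
  shows "\<exists>C>0. \<exists>B>0. \<forall>K l. trig_sums K l H \<longrightarrow> (\<forall>k\<in>K. \<forall>j\<in>K. k \<noteq> j \<longrightarrow> \<bar>l k - l j\<bar> \<ge> B) \<longrightarrow>
    (\<forall>X a. X \<in> sets borel \<longrightarrow> X \<subseteq> {0..1} \<longrightarrow> \<gamma> \<le> measure lborel X \<longrightarrow>
       C * (\<Sum>k\<in>K. (cmod (a k))\<^sup>2) \<le> (LINT x:X|lborel. (cmod (\<Sum>k\<in>K. a k * expi (l k * x)))\<^sup>2))"
proof -
  define g where "g = \<gamma> / 2"
  have g: "g > 0" using \<gamma> by (simp add: g_def)
  \<comment> \<open>The bound 16 H / g^2 makes sqrt (m H) at most m g / 4, and the bound 4 / g makes
    m g / 4 at least 1; together they give \<open>mm\<close>.\<close>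
  obtain m :: nat where m: "real m > max 1 (max (16 * H / g\<^sup>2) (4 / g))" using reals_Archimedean2 by blast
  have m1: "m \<ge> 1" using m by linarith
  have mm: "real m * (g / 2) - sqrt (real m * H) \<ge> 1"
  proof -
    have "16 * H \<le> real m * g\<^sup>2" using m g by (simp add: field_simps)
    then have "real m * H \<le> (real m * (g / 4))\<^sup>2"
      using mult_left_mono[of "16 * H" "real m * g\<^sup>2" "real m"] by (simp add: power2_eq_square field_simps)
    then have "sqrt (real m * H) \<le> real m * (g / 4)" using g by (intro real_le_lsqrt) auto
    moreover have "real m * (g / 4) \<ge> 1" using m g by (simp add: field_simps)
    ultimately show ?thesis by simp
  qed
  \<comment> \<open>The first bound serves the rank argument; the other two make
    \<open>\<kappa>\<close> and sqrt (H \<kappa>) at most g / 16 each, which leaves room below g / 4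
    for the square of the next level.\<close>
  define \<kappa> where "\<kappa> = min (g / (2 * real m)) (min (g / 16) (g\<^sup>2 / (256 * H)))"
  have \<kappa>: "\<kappa> > 0" using g m1 H by (simp add: \<kappa>_def)
  have \<kappa>1: "real m * \<kappa> \<le> g / 2"
  proof -
    have "real m * \<kappa> \<le> real m * (g / (2 * real m))" by (intro mult_left_mono) (auto simp: \<kappa>_def)
    then show ?thesis using m1 by simp
  qed
  have \<kappa>2: "\<kappa> + sqrt (H * \<kappa>) < g / 4"
  proof -
    have "H * \<kappa> \<le> H * (g\<^sup>2 / (256 * H))" using H by (intro mult_left_mono) (auto simp: \<kappa>_def)
    also have "\<dots> = (g / 16)\<^sup>2" using H by (simp add: power2_eq_square)
    finally have "sqrt (H * \<kappa>) \<le> g / 16" using g by (intro real_le_lsqrt) auto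
    moreover have "\<kappa> \<le> g / 16" by (simp add: \<kappa>_def)
    ultimately show ?thesis using g by simp
  qed
  define B where "B = 8 * sqrt H / g"
  have B: "B > 0" "2 * sqrt H / B \<le> g / 4" using H g by (auto simp: B_def)
  define \<mu> where "\<mu> = \<kappa> / (4 * real m) ^ m"
  have \<mu>: "\<mu> > 0" using \<kappa> m1 by (simp add: \<mu>_def)
  \<comment> \<open>At the level \<open>\<delta>\<close> the residual tolerance is
    \<open>h * \<delta>\<close>, so the level cancels in the Chebyshev bound and a single
    \<open>\<mu>\<close> serves all levels.\<close>
  define h where "h = min 1 (sqrt (\<mu> / (64 * (1 + sqrt H))))"
  have sH: "0 < 1 + sqrt H" using H by (simp add: add_pos_nonneg)
  have h: "0 < h" "h \<le> 1" using \<mu> sH by (auto simp: h_def)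
  have h2: "(1 + sqrt H) * h\<^sup>2 * 16 \<le> \<mu> / 4"
  proof -
    have "h\<^sup>2 \<le> (sqrt (\<mu> / (64 * (1 + sqrt H))))\<^sup>2" using h by (intro power_mono) (auto simp: h_def)
    also have "\<dots> = \<mu> / (64 * (1 + sqrt H))" using \<mu> sH by simp
    finally show ?thesis using sH by (simp add: field_simps)
  qed
  \<comment> \<open>The map \<open>E\<close> from a level to the next depends on
    \<open>\<gamma>\<close> and \<open>H\<close> alone; iterated from 1 it gives levels common to
    all sums.\<close>
  have "\<forall>\<delta>. \<exists>e. 0 < \<delta> \<longrightarrow> (0 < e \<and> e \<le> \<delta> \<and> (real m * real m * Dseq (h * \<delta>) m) * e \<le> \<delta> / 4 \<and>
     real m * ((Dseq (h * \<delta>) m * real m) * e)\<^sup>2 < 1 \<and> (\<kappa> + sqrt (H * \<kappa>)) + e\<^sup>2 \<le> g / 4)"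
    using exists_small_level[of _ "g / 4" "\<kappa> + sqrt (H * \<kappa>)"] g \<kappa>2 by (metis divide_pos_pos zero_less_numeral)
  then obtain E where E: "\<And>\<delta>. 0 < \<delta> \<Longrightarrow> (0 < E \<delta> \<and> E \<delta> \<le> \<delta> \<and> (real m * real m * Dseq (h * \<delta>) m) * E \<delta> \<le> \<delta> / 4 \<and>
     real m * ((Dseq (h * \<delta>) m * real m) * E \<delta>)\<^sup>2 < 1 \<and> (\<kappa> + sqrt (H * \<kappa>)) + (E \<delta>)\<^sup>2 \<le> g / 4)"
    by metis
  define d where "d q = (E ^^ q) 1" for q
  have d0: "0 < d q \<and> d q \<le> 1" for q
  proof (induction q)
    case (Suc q)
    then show ?case using E[of "d q"] by (auto simp: d_def)
  qed (simp add: d_def)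
  have dS: "d (Suc q) = E (d q)" for q by (simp add: d_def)
  have d_dec: "d (Suc q) \<le> d q" for q unfolding dS using E[of "d q"] d0[of q] by simp
  have d_anti: "d q' \<le> d q" if "q \<le> q'" for q q'
    using lift_Suc_antimono_le[of d, OF d_dec that] .
  \<comment> \<open>2 is the length of the interval {0..2} that contains all the disjoint level
    sets.\<close>
  obtain Q :: nat where Q: "real Q * (\<mu> / 4) > 2"
    using reals_Archimedean3[of "\<mu> / 4"] \<mu> by (metis divide_pos_pos zero_less_numeral)
  \<comment> \<open>Off a set of measure less than \<gamma> / 2 the normalised sum exceeds the last
    level \<open>d Q\<close>, which leaves measure at least \<gamma> / 2 in
    \<open>X\<close>.\<close>
  define C where "C = (d Q)\<^sup>2 * (\<gamma> / 2)"
  have C: "C > 0" using d0[of Q] \<gamma> by (simp add: C_def)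
  have main: "C \<le> (LINT x:X|lborel. (cmod (\<Sum>k\<in>K. c k * expi (l k * x)))\<^sup>2)"
    if tsum: "trig_sums K l H" and gap: "\<forall>k\<in>K. \<forall>j\<in>K. k \<noteq> j \<longrightarrow> \<bar>l k - l j\<bar> \<ge> B"
      and X: "X \<in> sets borel" "X \<subseteq> {0..1}" "\<gamma> \<le> measure lborel X"
      and c1: "(\<Sum>k\<in>K. (cmod (c k))\<^sup>2) = 1" for K l X c
  proof -
    interpret trig_sums K l H by (rule tsum)
    have c: "nsq c = 1" using c1 by (simp add: nsq_def)
    have small: "measure lborel ({0..1} \<inter> sublevel c (d Q)) < g"
    proof (rule ccontr)
      assume "\<not> ?thesis"
      then have big: "measure lborel ({0..1} \<inter> sublevel c (d Q)) \<ge> g" by simp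
      have bigq: "measure lborel ({0..1} \<inter> sublevel c (d (Suc q))) \<ge> g" if "q < Q" for q
      proof -
        have "measure lborel ({0..1} \<inter> sublevel c (d Q)) \<le> measure lborel ({0..1} \<inter> sublevel c (d (Suc q)))"
          using d_anti[of "Suc q" Q] that by (intro measure_lborel_mono) (auto simp: sublevel_def intro: bounded_Int)
        then show ?thesis using big by simp
      qed
      let ?V = "\<lambda>a b. {y\<in>{0..2}. a < cmod (tp c y) \<and> cmod (tp c y) \<le> b}"
      have lev: "measure lborel (?V (d (Suc q)) (d q)) > \<mu> / 4" if q: "q < Q" for q
      proof (rule level_gap[OF c B(1) _ refl bigq[OF q] g m1 mm \<kappa> \<kappa>1 _ B(2) \<mu>_def, of "h * d q"])
        show "\<And>k j. k \<in> K \<Longrightarrow> j \<in> K \<Longrightarrow> k \<noteq> j \<Longrightarrow> B \<le> \<bar>l k - l j\<bar>" using gap by blast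
        show "\<kappa> + sqrt (H * \<kappa>) + (d (Suc q))\<^sup>2 \<le> g / 4" "0 < d (Suc q)" "d (Suc q) \<le> d q"
          "real m * real m * Dseq (h * d q) m * d (Suc q) \<le> d q / 4"
          "real m * (Dseq (h * d q) m * real m * d (Suc q))\<^sup>2 < 1"
          using E[of "d q"] d0[of q] by (auto simp: dS)
        show "0 < h * d q" using h d0[of q] by simp
        show "h * d q \<le> 1" using h d0[of q] by (simp add: mult_le_one)
        have "(1 + sqrt H) * (h * d q)\<^sup>2 / (d q / 4)\<^sup>2 = (1 + sqrt H) * h\<^sup>2 * 16"
          using d0[of q] by (simp add: power_mult_distrib power_divide)
        then show "(1 + sqrt H) * (h * d q)\<^sup>2 / (d q / 4)\<^sup>2 \<le> \<mu> / 4" using h2 by simp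
      qed
      have Vb: "?V a b \<in> sets borel" for a b by measurable
      have bd: "bounded (?V a b)" for a b by (rule bounded_subset[of "{0..2}"]) auto
      have fin: "emeasure lborel (?V a b) \<noteq> \<infinity>" for a b
        using emeasure_bounded_finite[OF bd, of a b] by simp
      have acc: "real q * (\<mu> / 4) \<le> measure lborel (?V (d q) 1)" if "q \<le> Q" for q
        using that
      proof (induction q)
        case (Suc q)
        have sp: "?V (d (Suc q)) 1 = ?V (d (Suc q)) (d q) \<union> ?V (d q) 1"
          using d_dec[of q] d0[of q] by auto
        have "measure lborel (?V (d (Suc q)) 1) = measure lborel (?V (d (Suc q)) (d q)) + measure lborel (?V (d q) 1)"
          unfolding sp using fin Vb by (intro measure_Union) auto
        then show ?case using Suc lev[of q] by (simp add: algebra_simps)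
      qed simp
      have "measure lborel (?V (d Q) 1) \<le> measure lborel {0..2::real}"
        using Vb by (intro measure_lborel_mono) auto
      then show False using acc[of Q] Q by simp
    qed
    let ?Z = "X - sublevel c (d Q)"
    have Z: "?Z \<in> sets borel" "?Z \<subseteq> {0..1}" using X by auto
    have "measure lborel X \<le> measure lborel (?Z \<union> ({0..1} \<inter> sublevel c (d Q)))"
      using X by (intro measure_lborel_mono) (auto intro: bounded_subset[of "{0..1}"])
    also have "\<dots> \<le> measure lborel ?Z + measure lborel ({0..1} \<inter> sublevel c (d Q))"
      using Z by (intro measure_Un_le) auto
    finally have mZ: "\<gamma> / 2 \<le> measure lborel ?Z" using X(3) small by (simp add: g_def)
    have "C \<le> (d Q)\<^sup>2 * measure lborel ?Z" unfolding C_def using mZ by (intro mult_left_mono) auto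
    also have "\<dots> = (LINT x:?Z|lborel. (d Q)\<^sup>2)"
      using emeasure_bounded_finite[OF bounded_subset[OF bounded_closed_interval Z(2)]] by (simp add: set_lebesgue_integral_def)
    also have "\<dots> \<le> (LINT x:?Z|lborel. (cmod (tp c x))\<^sup>2)"
      using set_integrable_tp_sq[OF Z, of c 0] d0[of Q]
      by (intro set_integral_mono set_integrable_const_unit Z) (auto simp: sublevel_def intro!: power_mono)
    also have "\<dots> \<le> (LINT x:X|lborel. (cmod (tp c x))\<^sup>2)"
      using set_integrable_tp_sq[OF Z, of c 0] set_integrable_tp_sq[OF X(1,2), of c 0]
      unfolding set_lebesgue_integral_def set_integrable_def by (intro integral_mono) (auto simp: indicator_def)
    finally show ?thesis by (simp add: tp_def)
  qed
  have "C * (\<Sum>k\<in>K. (cmod (a k))\<^sup>2) \<le> (LINT x:X|lborel. (cmod (\<Sum>k\<in>K. a k * expi (l k * x)))\<^sup>2)"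
    if tsum: "trig_sums K l H" and gap: "\<forall>k\<in>K. \<forall>j\<in>K. k \<noteq> j \<longrightarrow> \<bar>l k - l j\<bar> \<ge> B"
      and X: "X \<in> sets borel" "X \<subseteq> {0..1}" "\<gamma> \<le> measure lborel X" for K l X a
  proof -
    define S where "S = (\<Sum>k\<in>K. (cmod (a k))\<^sup>2)"
    have S0: "0 \<le> S" by (simp add: S_def sum_nonneg)
    show ?thesis
    proof (cases "S = 0")
      case True
      then show ?thesis unfolding S_def[symmetric] set_lebesgue_integral_def by simp
    next
      case False
      then have S: "S > 0" using S0 by simp
      define c where "c k = a k / of_real (sqrt S)" for k
      have "(\<Sum>k\<in>K. (cmod (c k))\<^sup>2) = 1"
        using S by (simp add: c_def norm_divide power_divide sum_divide_distrib[symmetric] S_def[symmetric])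
      from main[OF tsum gap X this]
      have "C \<le> (LINT x:X|lborel. (cmod (\<Sum>k\<in>K. c k * expi (l k * x)))\<^sup>2)" .
      also have "\<dots> = (LINT x:X|lborel. (cmod (\<Sum>k\<in>K. a k * expi (l k * x)))\<^sup>2 / S)"
        using S by (simp add: c_def sum_divide_distrib[symmetric] norm_divide power_divide)
      also have "\<dots> = (LINT x:X|lborel. (cmod (\<Sum>k\<in>K. a k * expi (l k * x)))\<^sup>2) / S" by simp
      finally show ?thesis using S by (simp add: S_def[symmetric] field_simps)
    qed
  qed
  then show ?thesis using C B(1) by blast
qed

text \<open>The differences \<open>l k - l j\<close> over ordered pairs of distinct indices are
  taken as the frequencies of the sieve. The counting assumption is its multiplicity bound, and
  \<open>sieve_dual\<close> delivers the Hilbert-Schmidt hypothesis of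
  \<open>trig_sums\<close>.\<close>

lemma exponential_sum_lower_bound:
  assumes \<gamma>: "0 < \<gamma>"
  shows "\<exists>C>0. \<exists>B>0. \<forall>(K::nat set) l. finite K \<longrightarrow> (\<forall>k\<in>K. \<forall>j\<in>K. k \<noteq> j \<longrightarrow> \<bar>l k - l j\<bar> \<ge> B) \<longrightarrow>
    (\<forall>k\<in>K. \<forall>j\<in>K. k \<noteq> j \<longrightarrow> card {(k', j')\<in>Sigma K (\<lambda>k. K - {k}). \<bar>(l k - l j) - (l k' - l j')\<bar> \<le> 1} \<le> N) \<longrightarrow>
    (\<forall>X a. X \<in> sets borel \<longrightarrow> X \<subseteq> {0..1} \<longrightarrow> \<gamma> \<le> measure lborel X \<longrightarrow>
       C * (\<Sum>k\<in>K. (cmod (a k))\<^sup>2) \<le> (LINT x:X|lborel. (cmod (\<Sum>k\<in>K. a k * expi (l k * x)))\<^sup>2))"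
proof -
  define H where "H = sieve_const * real N + 1"
  have H: "0 < H" using sieve_const_pos by (simp add: H_def add_nonneg_pos)
  have "trig_sums K l H" if "finite K"
    and cnt: "\<forall>k\<in>K. \<forall>j\<in>K. k \<noteq> j \<longrightarrow> card {(k', j')\<in>Sigma K (\<lambda>k. K - {k}). \<bar>(l k - l j) - (l k' - l j')\<bar> \<le> 1} \<le> N" for K l
  proof
    fix Y :: "real set" assume Y: "Y \<in> sets borel" "Y \<subseteq> {0..1}"
    let ?P = "Sigma K (\<lambda>k. K - {k})"
    have "(\<Sum>p\<in>?P. (cmod (LINT x:Y|lborel. expi ((\<lambda>(k, j). l k - l j) p * x)))\<^sup>2) \<le> (sieve_const * real N + 1) * measure lborel Y"
    proof (rule sieve_dual[OF _ _ Y])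
      fix p assume p: "p \<in> ?P"
      have "{q\<in>?P. \<bar>(case p of (k, j) \<Rightarrow> l k - l j) - (case q of (k, j) \<Rightarrow> l k - l j)\<bar> \<le> 1} =
         {(k', j')\<in>?P. \<bar>(l (fst p) - l (snd p)) - (l k' - l j')\<bar> \<le> 1}"
        by (auto simp: case_prod_beta)
      then show "card {q\<in>?P. \<bar>(case p of (k, j) \<Rightarrow> l k - l j) - (case q of (k, j) \<Rightarrow> l k - l j)\<bar> \<le> 1} \<le> N"
        using cnt p by auto
    qed (use that in auto)
    then show "(\<Sum>(k, j)\<in>?P. (cmod (LINT x:Y|lborel. expi ((l k - l j) * x)))\<^sup>2) \<le> H * measure lborel Y"
      by (simp add: H_def case_prod_beta)
  qed (use that H in auto)
  then show ?thesis using trig_sums_lower_bound[OF \<gamma> H] by meson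
qed

section \<open>Functions with spectrum in a half-line\<close>

abbreviation I01 :: "real measure" where "I01 \<equiv> restrict_space lborel {0..1}"

lemma emeasure_I01: "emeasure I01 {0..1} = 1"
  by (subst emeasure_restrict_space) auto

lemma finite_measure_unit_interval: "finite_measure I01"
  by (rule finite_measureI) (simp add: emeasure_I01 space_restrict_space)

interpretation I01: finite_measure I01 by (rule finite_measure_unit_interval)

lemma borel_measurable_I01: "f \<in> borel_measurable borel \<Longrightarrow> f \<in> borel_measurable I01"
  by (rule measurable_restrict_space1) simp

lemma integrable_I01_bounded:
  fixes f :: "real \<Rightarrow> 'a::{banach, second_countable_topology}"
  assumes "f \<in> borel_measurable borel" "\<And>x. norm (f x) \<le> B"
  shows "integrable I01 f"
  by (rule I01.integrable_const_bound[where B = B]) (use assms borel_measurable_I01 in auto)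

lemma radii_tendsto_1: "(\<lambda>m. 1 - 1 / real (m + 2)) \<longlonglongrightarrow> 1"
  using tendsto_diff[OF tendsto_const[of 1] LIMSEQ_Suc[OF LIMSEQ_inverse_real_of_nat]]
  by (simp add: inverse_eq_divide)

lemma mean_value_unit_disc:
  assumes holo: "W holomorphic_on ball 0 1" and r: "0 < r" "r < 1"
  shows "cmod (W 0) \<le> (LINT t|I01. cmod (W (of_real r * expi t)))"
proof -
  have hc: "W holomorphic_on cball 0 r" using r by (intro holomorphic_on_subset[OF holo]) auto
  have "((\<lambda>u. W u / (u - 0)) has_contour_integral (2 * of_real pi * \<i> * W 0)) (circlepath 0 r)"
    by (rule Cauchy_integral_circlepath_simple[OF hc]) (use r in auto)
  then have "((\<lambda>t. W (circlepath 0 r t) / (circlepath 0 r t) * vector_derivative (circlepath 0 r) (at t within {0..1})) has_integral (2 * of_real pi * \<i> * W 0)) {0..1}"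
    by (simp add: has_contour_integral_def)
  moreover have "W (circlepath 0 r t) / (circlepath 0 r t) * vector_derivative (circlepath 0 r) (at t within {0..1})
      = (2 * of_real pi * \<i>) * W (of_real r * expi t)" if "t \<in> {0..1}" for t
  proof -
    have "exp (2 * of_real pi * \<i> * of_real t) = expi t" by (simp add: expi_def cis_conv_exp mult_ac)
    moreover have "expi t \<noteq> 0" by (simp add: expi_def)
    moreover from calculation have "vector_derivative (circlepath 0 r) (at t within {0..1}) = 2 * of_real pi * \<i> * of_real r * expi t"
      using vector_derivative_circlepath01[of t 0 r] that by simp
    moreover have "circlepath 0 r t = of_real r * expi t" using calculation by (simp add: circlepath)
    ultimately show ?thesis using r by simp
  qed
  ultimately have "((\<lambda>t. (2 * of_real pi * \<i>) * W (of_real r * expi t)) has_integral (2 * of_real pi * \<i> * W 0)) {0..1}"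
    by (subst (asm) has_integral_cong[where g = "\<lambda>t. (2 * of_real pi * \<i>) * W (of_real r * expi t)"]) auto
  from has_integral_mult_right[OF this, of "1 / (2 * of_real pi * \<i>)"]
  have hi: "((\<lambda>t. W (of_real r * expi t)) has_integral W 0) {0..1}" by simp
  have cont: "continuous_on {0..1} (\<lambda>t. W (of_real r * expi t))"
    by (intro continuous_on_compose2[OF holomorphic_on_imp_continuous_on[OF hc]] continuous_intros)
      (use r in \<open>auto simp: norm_mult\<close>)
  have si: "set_integrable lborel {0..1} (\<lambda>t. W (of_real r * expi t))"
    by (rule borel_integrable_atLeastAtMost'[OF cont])
  have "W 0 = (LINT t:{0..1}|lborel. W (of_real r * expi t))"
    using set_borel_integral_eq_integral(2)[OF si] hi by (simp add: integral_unique)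
  also have "\<dots> = (LINT t|I01. W (of_real r * expi t))"
    by (simp add: set_lebesgue_integral_def integral_restrict_space)
  finally show ?thesis by (metis integral_norm_bound)
qed

text \<open>The product of the \<open>1 - b i * z\<close> has no zeros in the unit disc, so its power with exponent \<open>q\<close> is the modulus of a
  holomorphic function.\<close>

lemma powr_mean_linear_factors:
  fixes b :: "nat \<Rightarrow> complex"
  assumes b: "\<And>i. i < n \<Longrightarrow> cmod (b i) \<le> 1" and q: "0 < q"
  shows "1 \<le> (LINT t|I01. (\<Prod>i<n. cmod (1 - b i * expi t) powr q))"
proof -
  define W where "W z = (\<Prod>i<n. exp (of_real q * Ln (1 - b i * z)))" for z
  define V where "V z = (\<Prod>i<n. cmod (1 - b i * z) powr q)" for z
  have re: "0 < Re (1 - b i * z)" if "i < n" "cmod z < 1" for i z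
  proof -
    have "Re (b i * z) \<le> cmod (b i * z)" by (rule complex_Re_le_cmod)
    also have "\<dots> \<le> 1 * cmod z" unfolding norm_mult using b[OF that(1)] by (intro mult_right_mono) auto
    finally show ?thesis using that by simp
  qed
  have nn: "1 - b i * z \<notin> \<real>\<^sub>\<le>\<^sub>0" if "i < n" "cmod z < 1" for i z
    using re[OF that] by (auto simp: complex_nonpos_Reals_iff simp del: minus_complex.sel)
  have holo: "W holomorphic_on ball 0 1"
    unfolding W_def by (intro holomorphic_intros) (use nn in auto)
  have WV: "cmod (W z) = V z" if "cmod z < 1" for z
    unfolding W_def V_def prod_norm[symmetric]
  proof (intro prod.cong refl)
    fix i assume "i \<in> {..<n}"
    then have "1 - b i * z \<noteq> 0" using nn[of i z] that by auto
    then show "cmod (exp (of_real q * Ln (1 - b i * z))) = cmod (1 - b i * z) powr q"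
      by (simp add: norm_exp_eq_Re powr_def)
  qed
  \<comment> \<open>A factor with \<open>cmod (b i) = 1\<close> vanishes somewhere on the unit
    circle, where its logarithm breaks down; the mean is therefore taken over smaller circles
    first.\<close>
  define r where "r m = 1 - 1 / real (m + 2)" for m
  have r: "0 < r m" "r m < 1" for m by (auto simp: r_def field_simps)
  have W0: "W 0 = 1" by (simp add: W_def)
  have Vb: "cmod (V' :: complex) \<le> 1 \<Longrightarrow> V V' \<le> (\<Prod>i<n. 2 powr q)" for V'
    unfolding V_def
  proof (intro prod_mono conjI powr_mono2)
    fix i assume V': "cmod V' \<le> 1" and i: "i \<in> {..<n}"
    have "cmod (1 - b i * V') \<le> 1 + cmod (b i * V')" using norm_triangle_ineq4[of 1 "b i * V'"] by simp
    also have "cmod (b i * V') \<le> 1 * 1" unfolding norm_mult using b i V' by (intro mult_mono) auto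
    finally show "cmod (1 - b i * V') \<le> 2" by simp
  qed (use q in auto)
  have contV: "continuous_on UNIV V"
    unfolding V_def by (intro continuous_intros continuous_on_powr') (use q in auto)
  have Vm: "(\<lambda>t. V (of_real s * expi t)) \<in> borel_measurable I01" for s
    by (intro borel_measurable_I01 borel_measurable_continuous_onI continuous_on_compose2[OF contV] continuous_intros) auto
  have V0: "0 \<le> V z" for z unfolding V_def by (intro prod_nonneg) auto
  have "(\<lambda>m. LINT t|I01. V (of_real (r m) * expi t)) \<longlonglongrightarrow> (LINT t|I01. V (of_real 1 * expi t))"
  proof (rule integral_dominated_convergence[where w = "\<lambda>_. \<Prod>i<n. 2 powr q"])
    show "AE t in I01. (\<lambda>m. V (of_real (r m) * expi t)) \<longlonglongrightarrow> V (of_real 1 * expi t)"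
    proof (intro AE_I2)
      fix t
      have "r \<longlonglongrightarrow> 1" unfolding r_def[abs_def] by (rule radii_tendsto_1)
      then have "(\<lambda>m. complex_of_real (r m) * expi t) \<longlonglongrightarrow> of_real 1 * expi t"
        by (intro tendsto_intros)
      then show "(\<lambda>m. V (of_real (r m) * expi t)) \<longlonglongrightarrow> V (of_real 1 * expi t)"
        using contV by (intro isCont_tendsto_compose[of _ V]) (simp_all add: continuous_on_eq_continuous_at)
    qed
    show "AE t in I01. norm (V (of_real (r m) * expi t)) \<le> (\<Prod>i<n. 2 powr q)" for m
    proof (intro AE_I2)
      fix t
      have "cmod (of_real (r m) * expi t) \<le> 1" using r[of m] by (simp add: norm_mult)
      from Vb[OF this] V0 show "norm (V (of_real (r m) * expi t)) \<le> (\<Prod>i<n. 2 powr q)" by simp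
    qed
  qed (use Vm Vm[of 1] in auto)
  moreover have "1 \<le> (LINT t|I01. V (of_real (r m) * expi t))" for m
    using mean_value_unit_disc[OF holo r, of m] W0 WV[of "of_real (r m) * expi _"] r[of m] by (simp add: norm_mult)
  ultimately have "1 \<le> (LINT t|I01. V (of_real 1 * expi t))"
    by (intro LIMSEQ_le_const) auto
  then show ?thesis by (simp add: V_def)
qed

text \<open>Replacing a factor \<open>z - a\<close> with \<open>\<bar>a\<bar> < 1\<close> by \<open>1 - cnj a * z\<close> leaves the modulus on the unit circle
  unchanged and does not decrease it at \<open>0\<close>.\<close>

lemma powr_mean_poly:
  fixes P :: "complex poly"
  assumes q: "0 < q"
  shows "cmod (poly P 0) powr q \<le> (LINT t|I01. cmod (poly P (expi t)) powr q)"
proof -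
  obtain root where root: "smult (lead_coeff P) (\<Prod>i<degree P. [:-root i, 1:]) = P"
    by (rule complex_poly_decompose')
  let ?n = "degree P"
  have ev: "poly P z = lead_coeff P * (\<Prod>i<?n. z - root i)" for z
    by (subst root[symmetric]) (simp add: poly_prod)
  define k where "k i = (if cmod (root i) < 1 then 1 else - root i)" for i
  define b where "b i = (if cmod (root i) < 1 then cnj (root i) else 1 / root i)" for i
  have b: "cmod (b i) \<le> 1" for i by (auto simp: b_def norm_divide divide_le_eq_1 not_less)
  have rk: "cmod (root i) \<le> cmod (k i)" for i by (auto simp: k_def)
  have fac: "cmod (expi t - root i) = cmod (k i) * cmod (1 - b i * expi t)" for t i
  proof (cases "cmod (root i) < 1")
    case True
    have "expi t * cnj (expi t - root i) = 1 - cnj (root i) * expi t"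
      by (simp add: algebra_simps expi_add[symmetric])
    then have "cmod (1 - cnj (root i) * expi t) = cmod (expi t) * cmod (cnj (expi t - root i))"
      by (metis norm_mult)
    then show ?thesis using True by (simp add: k_def b_def del: complex_cnj_diff)
  next
    case False
    then have "root i \<noteq> 0" by auto
    then have "expi t - root i = k i * (1 - b i * expi t)" using False by (simp add: k_def b_def field_simps)
    then show ?thesis by (simp add: norm_mult)
  qed
  define c where "c = cmod (lead_coeff P) * (\<Prod>i<?n. cmod (k i))"
  have c0: "0 \<le> c" by (auto simp: c_def intro!: mult_nonneg_nonneg prod_nonneg)
  have val: "cmod (poly P (expi t)) powr q = c powr q * (\<Prod>i<?n. cmod (1 - b i * expi t) powr q)" for t
  proof -
    have pp: "(\<Prod>i<m. f i) powr q = (\<Prod>i<m. f i powr q)" if "\<And>i. 0 \<le> f i" for f :: "nat \<Rightarrow> real" and m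
      using that by (induction m) (auto simp: powr_mult prod_nonneg)
    have "cmod (poly P (expi t)) = c * (\<Prod>i<?n. cmod (1 - b i * expi t))"
      unfolding ev norm_mult prod_norm[symmetric] fac prod.distrib by (simp add: c_def)
    then show ?thesis using c0 by (simp add: powr_mult prod_nonneg pp)
  qed
  have "cmod (poly P 0) \<le> c"
    unfolding ev norm_mult prod_norm[symmetric] c_def using rk by (intro mult_left_mono prod_mono) auto
  then have "cmod (poly P 0) powr q \<le> c powr q * 1" using q by (simp add: powr_mono2)
  also have "\<dots> \<le> c powr q * (LINT t|I01. (\<Prod>i<?n. cmod (1 - b i * expi t) powr q))"
    using powr_mean_linear_factors[where n = ?n and b = b, OF b q] by (intro mult_left_mono) auto
  also have "\<dots> = (LINT t|I01. cmod (poly P (expi t)) powr q)" by (simp add: val)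
  finally show ?thesis .
qed

text \<open>Since \<open>R\<close> exceeds 1, the Taylor coefficients are absolutely summable, so
  the Taylor polynomials converge boundedly on the unit circle and the polynomial case passes to the
  limit.\<close>

lemma powr_mean_holomorphic:
  assumes holo: "F holomorphic_on ball 0 R" and R: "1 < R" and q: "0 < q"
  shows "cmod (F 0) powr q \<le> (LINT t|I01. cmod (F (expi t)) powr q)"
proof -
  define a where "a n = (deriv ^^ n) F 0 / fact n" for n
  have ps: "(\<lambda>n. a n * w ^ n) sums F w" if "w \<in> ball 0 R" for w
    using holomorphic_power_series[OF holo that] by (simp add: a_def)
  define \<rho> where "\<rho> = (1 + R) / 2"
  have \<rho>: "1 < \<rho>" "\<rho> < R" using R by (auto simp: \<rho>_def field_simps)
  have "summable (\<lambda>n. a n * (of_real \<rho>) ^ n)"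
    using ps[of "of_real \<rho>"] \<rho> by (auto simp: sums_iff)
  from powser_insidea[OF this, of 1] have sa: "summable (\<lambda>n. cmod (a n))" using \<rho> by simp
  define P where "P N = (\<Sum>n<N. monom (a n) n)" for N
  have ev: "poly (P N) z = (\<Sum>n<N. a n * z ^ n)" for N z by (simp add: P_def poly_sum poly_monom)
  define A where "A = (\<Sum>n. cmod (a n))"
  have bd: "cmod (poly (P N) (expi t)) \<le> A" for N t
  proof -
    have "cmod (poly (P N) (expi t)) \<le> (\<Sum>n<N. cmod (a n))"
      unfolding ev by (rule order_trans[OF norm_sum]) (simp add: norm_mult norm_power)
    also have "\<dots> \<le> A" unfolding A_def by (rule sum_le_suminf[OF sa]) auto
    finally show ?thesis .
  qed
  have lim: "(\<lambda>N. cmod (poly (P N) z) powr q) \<longlonglongrightarrow> cmod (F z) powr q" if "z \<in> ball 0 R" for z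
  proof (intro tendsto_powr' tendsto_norm tendsto_const)
    show "(\<lambda>N. poly (P N) z) \<longlonglongrightarrow> F z" unfolding ev using ps[OF that] by (simp add: sums_def)
  qed (use q in auto)
  have cF: "continuous_on UNIV (\<lambda>t. F (expi t))"
    by (intro continuous_on_compose2[OF holomorphic_on_imp_continuous_on[OF holo]] continuous_intros) (use R in auto)
  have "(\<lambda>N. LINT t|I01. cmod (poly (P N) (expi t)) powr q) \<longlonglongrightarrow> (LINT t|I01. cmod (F (expi t)) powr q)"
  proof (rule integral_dominated_convergence[where w = "\<lambda>_. A powr q"])
    show "AE t in I01. (\<lambda>N. cmod (poly (P N) (expi t)) powr q) \<longlonglongrightarrow> cmod (F (expi t)) powr q"
      using R by (intro AE_I2 lim) auto
    show "AE t in I01. norm (cmod (poly (P N) (expi t)) powr q) \<le> A powr q" for N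
      using bd q by (intro AE_I2) (auto intro!: powr_mono2)
    show "(\<lambda>t. cmod (F (expi t)) powr q) \<in> borel_measurable I01"
      using borel_measurable_continuous_onI[OF cF] by (intro borel_measurable_I01) measurable
    show "(\<lambda>t. cmod (poly (P N) (expi t)) powr q) \<in> borel_measurable I01" for N
      unfolding ev by (intro borel_measurable_I01) measurable
  qed auto
  moreover have "(\<lambda>N. cmod (poly (P N) 0) powr q) \<longlonglongrightarrow> cmod (F 0) powr q" using R by (intro lim) auto
  ultimately show ?thesis using powr_mean_poly[OF q] by (intro LIMSEQ_le) auto
qed

section \<open>The Fourier-Laplace transform in the upper half-plane and its boundary values\<close>

definition lft :: "(real \<Rightarrow> complex) \<Rightarrow> complex \<Rightarrow> complex" where
  "lft g z = (LINT \<xi>|lborel. g \<xi> * exp (2 * of_real pi * \<i> * of_real \<xi> * z))"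

text \<open>The boundary values of the Cayley transform \<open>z \<mapsto> \<i> (1 + z) / (1 - z)\<close> at \<open>z = expi t\<close>; the uniform
  distribution of \<open>t\<close> turns into the harmonic measure of the half-plane at \<open>\<i>\<close>.\<close>

definition cayley_line :: "real \<Rightarrow> real" where
  "cayley_line t = tan (pi * (t - 1 / 2))"

lemma lft_of_real: "lft g (of_real x) = ft g x"
  unfolding lft_def ft_def expi_def cis_conv_exp by (simp add: mult_ac)

text \<open>Bounded support permits integrating the exponential series term by term: the n-th term
  is at most the integral of \<open>cmod (g \<xi>)\<close> times ?M^n / n!.\<close>

lemma lft_holomorphic:
  assumes g: "integrable lborel g" and supp: "\<And>\<xi>. \<xi> < 0 \<or> \<xi> > T \<Longrightarrow> g \<xi> = 0"
  shows "lft g holomorphic_on UNIV"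
proof -
  have T: "\<bar>\<xi>\<bar> \<le> \<bar>T\<bar>" if "g \<xi> \<noteq> 0" for \<xi> using supp[of \<xi>] that by force
  note [measurable] = borel_measurable_integrable[OF g]
  define c where "c n = (LINT \<xi>|lborel. g \<xi> * ((2 * of_real pi * \<i> * of_real \<xi>) ^ n / fact n))" for n
  have "(\<lambda>n. c n * z ^ n) sums lft g z" for z
  proof -
    let ?f = "\<lambda>n \<xi>. g \<xi> * ((2 * of_real pi * \<i> * of_real \<xi> * z) ^ n / fact n)"
    let ?M = "2 * pi * \<bar>T\<bar> * cmod z"
    have bd: "cmod (?f n \<xi>) \<le> cmod (g \<xi>) * (?M ^ n / fact n)" for n \<xi>
    proof (cases "g \<xi> = 0")
      case False
      have "cmod (2 * of_real pi * \<i> * of_real \<xi> * z) \<le> ?M"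
        using T[OF False] by (auto simp: norm_mult intro!: mult_right_mono mult_left_mono)
      then show ?thesis unfolding norm_mult norm_divide norm_power
        by (intro mult_left_mono) (auto intro!: divide_right_mono power_mono)
    qed simp
    have int: "integrable lborel (?f n)" for n
    proof (rule Bochner_Integration.integrable_bound)
      show "integrable lborel (\<lambda>\<xi>. cmod (g \<xi>) * (?M ^ n / fact n))" using g by auto
      show "AE \<xi> in lborel. norm (?f n \<xi>) \<le> norm (cmod (g \<xi>) * (?M ^ n / fact n))"
        unfolding real_norm_def by (intro AE_I2 order_trans[OF bd abs_ge_self])
    qed measurable
    have "(\<lambda>n. integral\<^sup>L lborel (?f n)) sums (LINT \<xi>|lborel. (\<Sum>n. ?f n \<xi>))"
    proof (rule sums_integral[OF int])
      show "AE \<xi> in lborel. summable (\<lambda>n. norm (?f n \<xi>))"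
      proof (rule AE_I2)
        fix \<xi>
        have "summable (\<lambda>n. cmod (g \<xi>) * (?M ^ n / fact n))"
          using summable_exp[of ?M] by (intro summable_mult) (simp add: divide_inverse mult.commute)
        moreover have "norm (norm (?f n \<xi>)) \<le> cmod (g \<xi>) * (?M ^ n / fact n)" for n
          unfolding real_norm_def abs_norm_cancel by (rule bd)
        ultimately show "summable (\<lambda>n. norm (?f n \<xi>))"
          by (rule summable_comparison_test'[where N = 0])
      qed
      show "summable (\<lambda>n. LINT \<xi>|lborel. norm (?f n \<xi>))"
      proof (rule summable_comparison_test)
        have "(LINT \<xi>|lborel. norm (?f n \<xi>)) \<le> (LINT \<xi>|lborel. cmod (g \<xi>)) * (?M ^ n / fact n)" for n
        proof -
          have "(LINT \<xi>|lborel. norm (?f n \<xi>)) \<le> (LINT \<xi>|lborel. cmod (g \<xi>) * (?M ^ n / fact n))"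
            using bd int g by (intro integral_mono integrable_norm) auto
          then show ?thesis by simp
        qed
        then show "\<exists>N. \<forall>n\<ge>N. norm (LINT \<xi>|lborel. norm (?f n \<xi>)) \<le> (LINT \<xi>|lborel. cmod (g \<xi>)) * (?M ^ n / fact n)"
          by simp
        show "summable (\<lambda>n. (LINT \<xi>|lborel. cmod (g \<xi>)) * (?M ^ n / fact n))"
          using summable_exp[of ?M] by (intro summable_mult) (simp add: divide_inverse mult.commute)
      qed
    qed
    moreover have "(\<Sum>n. ?f n \<xi>) = g \<xi> * exp (2 * of_real pi * \<i> * of_real \<xi> * z)" for \<xi>
    proof -
      have "(\<lambda>n. (2 * of_real pi * \<i> * of_real \<xi> * z) ^ n / fact n) sums exp (2 * of_real pi * \<i> * of_real \<xi> * z)"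
        using exp_converges[of "2 * of_real pi * \<i> * of_real \<xi> * z"] by (simp add: scaleR_conv_of_real divide_inverse mult.commute)
      from sums_mult[OF this, of "g \<xi>"] show ?thesis by (simp add: sums_iff)
    qed
    moreover have "integral\<^sup>L lborel (?f n) = c n * z ^ n" for n
    proof -
      have "?f n \<xi> = g \<xi> * ((2 * of_real pi * \<i> * of_real \<xi>) ^ n / fact n) * z ^ n" for \<xi>
        by (simp add: power_mult_distrib)
      then have "integral\<^sup>L lborel (?f n) = (LINT \<xi>|lborel. g \<xi> * ((2 * of_real pi * \<i> * of_real \<xi>) ^ n / fact n) * z ^ n)"
        by (intro Bochner_Integration.integral_cong refl)
      then show ?thesis unfolding c_def by (simp only: integral_mult_left_zero)
    qed
    ultimately show ?thesis by (simp add: lft_def)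
  qed
  then have "lft g holomorphic_on ball 0 r" for r
    using power_series_holomorphic[of 0 r c "lft g"] by simp
  then have "lft g holomorphic_on (\<Union>r. ball 0 r)"
    by (intro holomorphic_on_UN_open) auto
  moreover have "(\<Union>r. ball (0::complex) r) = UNIV"
    using gt_ex by auto
  ultimately show ?thesis by simp
qed

text \<open>Here the half-line matters: for \<open>\<xi>\<close> \<ge> 0 the exponential has modulus
  at most 1 on the closed upper half-plane.\<close>

lemma norm_lft_le:
  assumes g: "integrable lborel g" and supp: "\<And>\<xi>. \<xi> < 0 \<Longrightarrow> g \<xi> = 0" and z: "0 \<le> Im z"
  shows "cmod (lft g z) \<le> (LINT \<xi>|lborel. cmod (g \<xi>))"
proof -
  note [measurable] = borel_measurable_integrable[OF g]
  have bd: "cmod (g \<xi> * exp (2 * of_real pi * \<i> * of_real \<xi> * z)) \<le> cmod (g \<xi>)" for \<xi>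
  proof (cases "\<xi> < 0")
    case False
    then have "exp (- (2 * pi * \<xi> * Im z)) \<le> 1" using z by simp
    then have "cmod (exp (2 * of_real pi * \<i> * of_real \<xi> * z)) \<le> 1" by (simp add: norm_exp_eq_Re)
    then show ?thesis unfolding norm_mult by (intro mult_left_le) auto
  qed (simp add: supp)
  have int: "integrable lborel (\<lambda>\<xi>. g \<xi> * exp (2 * of_real pi * \<i> * of_real \<xi> * z))"
    by (rule Bochner_Integration.integrable_bound[OF g]) (use bd in auto)
  show ?thesis unfolding lft_def
    using bd int g by (intro order_trans[OF integral_norm_bound] integral_mono integrable_norm) auto
qed

lemma cayley_boundary:
  assumes "0 < t" "t < 1"
  shows "1 - expi t \<noteq> 0" "\<i> * (1 + expi t) / (1 - expi t) = of_real (cayley_line t)"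
proof -
  \<comment> \<open>The half angle: \<open>expi t\<close> is minus the square of exp (\<i> u), which
    turns the sum and difference with 1 into multiples of sin u and cos u.\<close>
  define u where "u = pi * (t - 1 / 2)"
  have e: "expi t = - (exp (\<i> * of_real u) * exp (\<i> * of_real u))"
  proof -
    have "exp (\<i> * of_real u) * exp (\<i> * of_real u) = cis (2 * pi * t - pi)"
      by (simp add: u_def exp_add[symmetric] cis_conv_exp algebra_simps)
    then show ?thesis by (simp add: expi_def cis_divide[symmetric])
  qed
  have u: "- (pi / 2) < u" "u < pi / 2" using assms by (auto simp: u_def field_simps)
  have c: "cos u \<noteq> 0" using cos_gt_zero_pi[of u] u by simp
  let ?E = "exp (\<i> * complex_of_real u)" and ?E' = "exp (- (\<i> * complex_of_real u))"
  have EE: "?E * ?E' = 1" by (simp add: exp_add[symmetric])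
  have cc: "?E' + ?E = 2 * of_real (cos u)" by (simp add: cos_of_real[symmetric] cos_exp_eq)
  have ss: "?E' - ?E = - 2 * \<i> * of_real (sin u)" by (simp add: sin_of_real[symmetric] sin_exp_eq)
  have d: "1 - expi t = ?E * (?E' + ?E)" using EE by (simp add: e algebra_simps)
  have n: "1 + expi t = ?E * (?E' - ?E)" using EE by (simp add: e algebra_simps)
  show "1 - expi t \<noteq> 0" unfolding d cc using c by simp
  have "\<i> * (1 + expi t) / (1 - expi t) = \<i> * (?E' - ?E) / (?E' + ?E)"
    unfolding d n by simp
  also have "\<dots> = of_real (sin u) / of_real (cos u)"
    unfolding cc ss using c by (simp add: field_simps)
  finally show "\<i> * (1 + expi t) / (1 - expi t) = of_real (cayley_line t)"
    by (simp add: cayley_line_def u_def[symmetric] tan_def)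
qed

lemma cayley_upper:
  assumes "cmod z < 1"
  shows "1 - z \<noteq> 0" "0 \<le> Im (\<i> * (1 + z) / (1 - z))"
proof -
  show "1 - z \<noteq> 0" using assms by auto
  have "Im (\<i> * (1 + z) / (1 - z)) = Re ((1 + z) * cnj (1 - z)) / (cmod (1 - z))\<^sup>2"
    by (subst complex_div_cnj) (simp add: Im_divide_of_real)
  also have "Re ((1 + z) * cnj (1 - z)) = 1 - (cmod z)\<^sup>2"
    using cmod_power2[of z] by (simp add: power2_eq_square algebra_simps)
  finally show "0 \<le> Im (\<i> * (1 + z) / (1 - z))"
    using assms by (simp add: power_le_one)
qed

lemma cayley_line_measurable [measurable]: "cayley_line \<in> borel_measurable borel"
  unfolding cayley_line_def[abs_def] tan_def[abs_def] by measurable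

text \<open>The Cayley transform sends 0 to \<i>. Shrinking its argument by \<open>r m\<close> gives
  functions that are holomorphic past the unit circle and bounded uniformly in \<open>m\<close>.
  Their limits on the circle exist except at the point 1, which goes to infinity and is
  negligible.\<close>

lemma hardy_powr_mean:
  assumes g: "integrable lborel g" and supp: "\<And>\<xi>. \<xi> < 0 \<or> \<xi> > T \<Longrightarrow> g \<xi> = 0" and q: "0 < q"
  shows "cmod (lft g \<i>) powr q \<le> (LINT t|I01. cmod (ft g (cayley_line t)) powr q)"
proof -
  note [measurable] = borel_measurable_integrable[OF g]
  define r where "r m = 1 - 1 / real (m + 2)" for m
  have r: "0 < r m" "r m < 1" for m by (auto simp: r_def field_simps)
  have rlim: "r \<longlonglongrightarrow> 1"
    unfolding r_def[abs_def] by (rule radii_tendsto_1)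
  define Z where "Z w = \<i> * (1 + w) / (1 - w)" for w :: complex
  define G where "G m w = lft g (Z (of_real (r m) * w))" for m w
  define A where "A = (LINT \<xi>|lborel. cmod (g \<xi>))"
  have inside: "cmod (of_real (r m) * w) < 1" if "cmod w < 1 / r m" for m w
    using that r[of m] by (simp add: norm_mult field_simps)
  have holo: "G m holomorphic_on ball 0 (1 / r m)" for m
  proof -
    have "(\<lambda>w. Z (of_real (r m) * w)) holomorphic_on ball 0 (1 / r m)"
      unfolding Z_def by (intro holomorphic_intros) (use cayley_upper(1)[OF inside] in auto)
    then show ?thesis unfolding G_def
      by (rule holomorphic_on_compose_gen[OF _ lft_holomorphic[OF g supp], unfolded o_def]) auto
  qed
  have R: "1 < 1 / r m" for m using r[of m] by simp
  have mean: "cmod (lft g \<i>) powr q \<le> (LINT t|I01. cmod (G m (expi t)) powr q)" for m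
    using powr_mean_holomorphic[OF holo R q, of m] by (simp add: G_def Z_def)
  have bd: "cmod (G m (expi t)) \<le> A" for m t
    unfolding G_def A_def Z_def using supp cayley_upper(2)[OF inside[of "expi t" m]] R[of m]
    by (intro norm_lft_le[OF g]) auto
  have "(\<lambda>m. LINT t|I01. cmod (G m (expi t)) powr q) \<longlonglongrightarrow> (LINT t|I01. cmod (ft g (cayley_line t)) powr q)"
  proof (rule integral_dominated_convergence[where w = "\<lambda>_. A powr q"])
    have "AE t in lborel. t \<noteq> 0" "AE t in lborel. t \<noteq> (1::real)" by (rule AE_lborel_singleton)+
    then have "AE t in lborel. t \<in> {0..1} \<longrightarrow> 0 < t \<and> t < (1::real)" by eventually_elim auto
    then have "AE t in I01. 0 < t \<and> t < 1" by (subst AE_restrict_space_iff) auto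
    then show "AE t in I01. (\<lambda>m. cmod (G m (expi t)) powr q) \<longlonglongrightarrow> cmod (ft g (cayley_line t)) powr q"
    proof eventually_elim
      fix t :: real assume t: "0 < t \<and> t < 1"
      have "(\<lambda>m. Z (of_real (r m) * expi t)) \<longlonglongrightarrow> Z (of_real 1 * expi t)"
        unfolding Z_def by (intro tendsto_intros rlim) (use cayley_boundary(1) t in auto)
      then have z: "(\<lambda>m. Z (of_real (r m) * expi t)) \<longlonglongrightarrow> of_real (cayley_line t)"
        using cayley_boundary(2)[of t] t by (simp add: Z_def)
      have "isCont (lft g) (of_real (cayley_line t))"
        using holomorphic_on_imp_continuous_on[OF lft_holomorphic[OF g supp]] by (simp add: continuous_on_eq_continuous_at)
      from isCont_tendsto_compose[OF this z]
      have "(\<lambda>m. G m (expi t)) \<longlonglongrightarrow> ft g (cayley_line t)" by (simp add: G_def lft_of_real)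
      then show "(\<lambda>m. cmod (G m (expi t)) powr q) \<longlonglongrightarrow> cmod (ft g (cayley_line t)) powr q"
        using q by (intro tendsto_powr' tendsto_norm tendsto_const) auto
    qed
    show "AE t in I01. norm (cmod (G m (expi t)) powr q) \<le> A powr q" for m
      using bd q by (intro AE_I2) (auto intro!: powr_mono2)
    show "(\<lambda>t. cmod (ft g (cayley_line t)) powr q) \<in> borel_measurable I01"
      by (intro borel_measurable_I01) measurable
    have "continuous_on UNIV (\<lambda>t. G m (expi t))" for m
      by (intro continuous_on_compose2[OF holomorphic_on_imp_continuous_on[OF holo]] continuous_intros) (use R[of m] in auto)
    then have [measurable]: "(\<lambda>t. G m (expi t)) \<in> borel_measurable borel" for m
      by (rule borel_measurable_continuous_onI)
    show "(\<lambda>t. cmod (G m (expi t)) powr q) \<in> borel_measurable I01" for m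
      by (intro borel_measurable_I01) measurable
  qed auto
  then show ?thesis using mean by (intro LIMSEQ_le_const) auto
qed

lemma emeasure_shift:
  fixes V :: "real set"
  assumes [measurable]: "V \<in> sets borel"
  shows "emeasure lborel {x. a + x \<in> V} = emeasure lborel V"
proof -
  have "emeasure lborel V = emeasure (distr lborel borel ((+) a)) V" by (simp add: lborel_distr_plus)
  also have "\<dots> = emeasure lborel {x. a + x \<in> V}"
    by (subst emeasure_distr) (auto simp: vimage_def)
  finally show ?thesis by simp
qed

text \<open>On {1 / 2..b} the function \<open>cayley_line\<close> increases from 0 to
  \<open>\<Delta>\<close> with derivative at most pi * (1 + \<Delta>^2). By substitution, pulling
  back the portion of \<open>E\<close> in the given interval divides its measure by at most this
  factor.\<close>

lemma cayley_line_measure: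
  assumes E: "E \<in> sets borel" and \<Delta>: "0 < \<Delta>" and m: "measure lborel (E \<inter> {x..x + \<Delta>}) \<ge> \<gamma> * \<Delta>"
  shows "measure lborel {t\<in>{0..1}. x + cayley_line t \<in> E} \<ge> \<gamma> * \<Delta> / (pi * (1 + \<Delta>\<^sup>2))"
proof -
  define b where "b = 1 / 2 + arctan \<Delta> / pi"
  define g' where "g' t = pi * (1 + (cayley_line t)\<^sup>2)" for t
  define S where "S = {t\<in>{0..1}. x + cayley_line t \<in> E}"
  have at: "0 < arctan \<Delta>" "arctan \<Delta> < pi / 2" using \<Delta> arctan_ubound[of \<Delta>] by auto
  have b: "1 / 2 < b" "b < 1" using at by (auto simp: b_def field_simps)
  have cl: "cayley_line (1 / 2) = 0" "cayley_line b = \<Delta>"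
    by (auto simp: cayley_line_def b_def tan_arctan)
  have rng: "- (pi / 2) < pi * (t - 1 / 2)" "pi * (t - 1 / 2) < pi / 2" if "t \<in> {1 / 2..b}" for t
  proof -
    have "0 \<le> pi * (t - 1 / 2)" using that by simp
    then show "- (pi / 2) < pi * (t - 1 / 2)" using pi_gt_zero by linarith
    have "pi * (t - 1 / 2) < pi * (1 / 2)" using that b by (intro mult_strict_left_mono) auto
    then show "pi * (t - 1 / 2) < pi / 2" by simp
  qed
  have der: "(cayley_line has_real_derivative g' t) (at t)" if "t \<in> {1 / 2..b}" for t
  proof -
    have c: "cos (pi * (t - 1 / 2)) \<noteq> 0" using cos_gt_zero_pi[OF rng[OF that]] by simp
    have "((\<lambda>t. tan (pi * (t - 1 / 2))) has_real_derivative inverse ((cos (pi * (t - 1 / 2)))\<^sup>2) * pi) (at t)"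
      using c by (auto intro!: derivative_eq_intros)
    moreover have "inverse ((cos (pi * (t - 1 / 2)))\<^sup>2) * pi = g' t"
      using tan_sec[OF c] by (simp add: g'_def cayley_line_def power_inverse)
    ultimately show ?thesis by (simp add: cayley_line_def[abs_def])
  qed
  have cont: "continuous_on {1 / 2..b} cayley_line"
    by (intro continuous_at_imp_continuous_on ballI DERIV_isCont[OF der])
  have mono: "cayley_line t \<le> \<Delta>" "0 \<le> cayley_line t" if "t \<in> {1 / 2..b}" for t
  proof -
    have "cayley_line (1 / 2) \<le> cayley_line t" "cayley_line t \<le> cayley_line b"
    proof -
      have g0: "0 \<le> g' s" for s by (simp add: g'_def)
      show "cayley_line (1 / 2) \<le> cayley_line t"
        using that by (intro DERIV_nonneg_imp_nondecreasing[where f = cayley_line]) (auto intro!: exI[of _ "g' _"] der g0)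
      show "cayley_line t \<le> cayley_line b"
        using that by (intro DERIV_nonneg_imp_nondecreasing[where f = cayley_line]) (auto intro!: exI[of _ "g' _"] der g0)
    qed
    then show "cayley_line t \<le> \<Delta>" "0 \<le> cayley_line t" using cl by auto
  qed
  have Em: "{y. x + y \<in> E} \<in> sets borel"
  proof -
    have "(\<lambda>y. x + y) -` E \<inter> space borel \<in> sets borel" using E by (intro measurable_sets[of _ borel borel]) auto
    then show ?thesis by (simp add: vimage_def)
  qed
  have Sm: "S \<in> sets borel" unfolding S_def using E by measurable
  have ES: "E \<inter> {x..x + \<Delta>} \<in> sets borel" using E by auto
  have "ennreal (\<gamma> * \<Delta>) \<le> ennreal (measure lborel (E \<inter> {x..x + \<Delta>}))" using m by (rule ennreal_leI)
  also have "\<dots> = emeasure lborel (E \<inter> {x..x + \<Delta>})"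
    using emeasure_bounded_finite[OF bounded_subset[OF bounded_closed_interval[of x "x + \<Delta>"]], of "E \<inter> {x..x + \<Delta>}"]
    by (intro emeasure_eq_ennreal_measure[symmetric]) auto
  also have "\<dots> = emeasure lborel {y. x + y \<in> E \<inter> {x..x + \<Delta>}}" using emeasure_shift[OF ES, of x] by simp
  also have "\<dots> = (\<integral>\<^sup>+y. indicator {y. x + y \<in> E \<inter> {x..x + \<Delta>}} y \<partial>lborel)"
    using Em by (subst nn_integral_indicator) (auto simp: Collect_conj_eq)
  also have "\<dots> = (\<integral>\<^sup>+y. ennreal (indicator {y. x + y \<in> E} y) * indicator {cayley_line (1 / 2)..cayley_line b} y \<partial>lborel)"
    by (intro nn_integral_cong) (auto simp: cl indicator_def)
  also have "\<dots> = (\<integral>\<^sup>+y. ennreal (indicator {y. x + y \<in> E} y * indicator {cayley_line (1 / 2)..cayley_line b} y) \<partial>lborel)"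
    by (intro nn_integral_cong) (auto simp: indicator_def)
  also have "\<dots> = (\<integral>\<^sup>+t. ennreal (indicator {y. x + y \<in> E} (cayley_line t) * g' t * indicator {1 / 2..b} t) \<partial>lborel)"
  proof (rule nn_integral_substitution)
    show "set_borel_measurable borel {cayley_line (1 / 2)..cayley_line b} (indicator {y. x + y \<in> E} :: real \<Rightarrow> real)"
      unfolding set_borel_measurable_def using Em
      by (intro borel_measurable_scaleR borel_measurable_indicator) auto
    show "continuous_on {1 / 2..b} g'" unfolding g'_def by (intro continuous_intros cont)
  qed (use b der in \<open>auto simp: g'_def\<close>)
  also have "\<dots> \<le> (\<integral>\<^sup>+t. ennreal (pi * (1 + \<Delta>\<^sup>2)) * indicator S t \<partial>lborel)"
  proof (intro nn_integral_mono)
    fix t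
    show "ennreal (indicator {y. x + y \<in> E} (cayley_line t) * g' t * indicator {1 / 2..b} t) \<le> ennreal (pi * (1 + \<Delta>\<^sup>2)) * indicator S t"
    proof (cases "t \<in> {1 / 2..b} \<and> x + cayley_line t \<in> E")
      case True
      then have "t \<in> S" using b by (auto simp: S_def)
      moreover have "g' t \<le> pi * (1 + \<Delta>\<^sup>2)"
        unfolding g'_def using mono[of t] True by (intro mult_left_mono add_left_mono power_mono) auto
      ultimately show ?thesis using True by (simp add: ennreal_leI)
    qed (auto simp: indicator_def)
  qed
  also have "\<dots> = ennreal (pi * (1 + \<Delta>\<^sup>2)) * emeasure lborel S" using Sm by (simp add: nn_integral_cmult)
  also have "\<dots> = ennreal (pi * (1 + \<Delta>\<^sup>2) * measure lborel S)"
  proof -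
    have "bounded S" by (rule bounded_subset[of "{0..1}"]) (auto simp: S_def)
    then have "emeasure lborel S = ennreal (measure lborel S)"
      using emeasure_bounded_finite[of S] by (intro emeasure_eq_ennreal_measure) auto
    then show ?thesis by (simp add: ennreal_mult'' add_nonneg_nonneg)
  qed
  finally have "\<gamma> * \<Delta> \<le> pi * (1 + \<Delta>\<^sup>2) * measure lborel S"
    by (subst (asm) ennreal_le_iff) (auto intro!: mult_nonneg_nonneg add_nonneg_nonneg)
  moreover have "0 < pi * (1 + \<Delta>\<^sup>2)" by (intro mult_pos_pos add_pos_nonneg) auto
  ultimately have "\<gamma> * \<Delta> / (pi * (1 + \<Delta>\<^sup>2)) \<le> measure lborel S"
    by (simp add: pos_divide_le_eq mult.commute)
  then show ?thesis by (simp only: S_def)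
qed

text \<open>The right side is the tangent at \<open>c\<close> of the concave function y powr
  q.\<close>

lemma powr_le_tangent:
  assumes "0 < q" "q < 1" "0 < (c::real)" "0 \<le> y"
  shows "y powr q \<le> c powr q * (q * (y / c) + (1 - q))"
proof (cases "y = 0")
  case False
  have "(y / c) powr q * 1 powr (1 - q) \<le> q * (y / c) + (1 - q) * 1"
    using assms False by (intro Youngs_inequality_0) auto
  then have "c powr q * (y / c) powr q \<le> c powr q * (q * (y / c) + (1 - q))"
    by (intro mult_left_mono) auto
  then show ?thesis using assms by (simp add: powr_mult[symmetric])
qed (use assms in auto)

text \<open>Apply the mean value inequality for the exponent \<open>1 / n\<close> with \<open>n\<close> large: the complement of \<open>E\<close>
  has weight at most \<open>1 - w\<close>, so its contribution carries a factor at most \<open>(1 - w / 4) ^ n\<close>.\<close>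

lemma two_constant_inequality:
  assumes w: "0 < w" "w \<le> 1" and \<eta>: "0 < \<eta>"
  shows "\<exists>C\<ge>0. \<forall>g T E. integrable lborel g \<longrightarrow> (\<forall>\<xi>. \<xi> < 0 \<or> \<xi> > T \<longrightarrow> g \<xi> = 0) \<longrightarrow> E \<in> sets borel \<longrightarrow>
     w \<le> measure lborel {t\<in>{0..1}. cayley_line t \<in> E} \<longrightarrow>
     (cmod (lft g \<i>))\<^sup>2 \<le> \<eta> * (LINT t|I01. (cmod (ft g (cayley_line t)))\<^sup>2) +
        C * (LINT t|I01. indicator E (cayley_line t) * (cmod (ft g (cayley_line t)))\<^sup>2)"
proof -
  obtain n0 where n0: "(1 - w / 4) ^ n0 < \<eta>"
    using real_arch_pow_inv[OF \<eta>, of "1 - w / 4"] w by auto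
  \<comment> \<open>At least 2, so that q \<le> 1 / 2 and the factor 1 - q keeps half of the weight
    of \<open>E\<close>.\<close>
  define n where "n = n0 + 2"
  have n2: "n \<ge> 2" by (simp add: n_def)
  have n: "(1 - w / 4) ^ n \<le> \<eta>"
  proof -
    have "(1 - w / 4) ^ n \<le> (1 - w / 4) ^ n0" using w by (intro power_decreasing) (auto simp: n_def)
    then show ?thesis using n0 by simp
  qed
  define q where "q = 1 / real n"
  have q: "0 < q" "q \<le> 1 / 2" "q < 1" using n2 by (auto simp: q_def field_simps)
  have qn: "x powr q = root n x" if "0 \<le> x" for x using that n2 by (simp add: q_def root_powr_inverse)
  \<comment> \<open>Chosen to have \<delta> powr q = w / 4: the contribution of \<open>E\<close>
    then costs only half of the gain w / 2 made on its complement.\<close>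
  define \<delta> where "\<delta> = (w / 4) ^ n"
  have \<delta>: "0 < \<delta>" "\<delta> powr q = w / 4" using w n2 by (auto simp: \<delta>_def qn real_root_power_cancel)
  have "(cmod (lft g \<i>))\<^sup>2 \<le> \<eta> * (LINT t|I01. (cmod (ft g (cayley_line t)))\<^sup>2) +
        (1 / \<delta>) * (LINT t|I01. indicator E (cayley_line t) * (cmod (ft g (cayley_line t)))\<^sup>2)"
    if g: "integrable lborel g" and supp: "\<forall>\<xi>. \<xi> < 0 \<or> \<xi> > T \<longrightarrow> g \<xi> = 0" and E[measurable]: "E \<in> sets borel"
      and wE: "w \<le> measure lborel {t\<in>{0..1}. cayley_line t \<in> E}" for g T E
  proof -
    note [measurable] = borel_measurable_integrable[OF g]
    define \<phi> where "\<phi> t = (cmod (ft g (cayley_line t)))\<^sup>2" for t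
    define B where "B = (LINT \<xi>|lborel. cmod (g \<xi>))"
    have \<phi>m[measurable]: "\<phi> \<in> borel_measurable borel" unfolding \<phi>_def by measurable
    have \<phi>0: "0 \<le> \<phi> t" for t by (simp add: \<phi>_def)
    have \<phi>b: "\<phi> t \<le> B\<^sup>2" for t unfolding \<phi>_def B_def using norm_ft_le[OF g] by (intro power_mono) auto
    define b where "b = (LINT t|I01. \<phi> t)"
    define a where "a = (LINT t|I01. indicator E (cayley_line t) * \<phi> t)"
    define w' where "w' = (LINT t|I01. indicator E (cayley_line t) :: real)"
    have i1: "integrable I01 \<phi>" using \<phi>0 \<phi>b by (intro integrable_I01_bounded[where B = "B\<^sup>2"]) auto
    have i2: "integrable I01 (\<lambda>t. indicator E (cayley_line t) * \<phi> t)"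
      using \<phi>0 \<phi>b by (intro integrable_I01_bounded[where B = "B\<^sup>2"]) (auto simp: indicator_def)
    have i3: "integrable I01 (\<lambda>t. indicator E (cayley_line t) :: real)"
      by (intro integrable_I01_bounded[where B = 1]) (auto simp: indicator_def)
    have w': "w \<le> w'"
    proof -
      have "w' = (LINT t|lborel. indicator {0..1} t *\<^sub>R indicator E (cayley_line t))"
        unfolding w'_def by (rule integral_restrict_space) simp
      also have "\<dots> = (LINT t|lborel. indicator {t\<in>{0..1}. cayley_line t \<in> E} t)"
        by (rule Bochner_Integration.integral_cong[OF refl]) (simp add: indicator_def)
      also have "\<dots> = measure lborel {t\<in>{0..1}. cayley_line t \<in> E}"
        using Bochner_Integration.integral_indicator[of lborel "{t\<in>{0..1}. cayley_line t \<in> E}"]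
        by (simp only: space_lborel space_borel Int_UNIV_right)
      finally show ?thesis using wE by simp
    qed
    have w'1: "w' \<le> 1"
    proof -
      have "w' \<le> (LINT t|I01. 1)" unfolding w'_def by (intro integral_mono i3) (auto simp: indicator_def)
      then show ?thesis by (simp add: measure_def emeasure_I01 space_restrict_space)
    qed
    have one: "(LINT t|I01. (1::real)) = 1" by (simp add: measure_def emeasure_I01 space_restrict_space)
    have a0: "0 \<le> a" unfolding a_def using \<phi>0 by (intro integral_nonneg_AE AE_I2) (auto simp: indicator_def)
    have b0: "0 \<le> b" unfolding b_def using \<phi>0 by (intro integral_nonneg_AE AE_I2) auto
    have F2: "(cmod (lft g \<i>))\<^sup>2 \<le> b"
      using hardy_powr_mean[OF g, of T 2] supp by (simp add: b_def \<phi>_def)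
    have Fq: "((cmod (lft g \<i>))\<^sup>2) powr q \<le> (LINT t|I01. \<phi> t powr q)"
    proof -
      have p: "(y\<^sup>2) powr q = y powr (2 * q)" if "0 \<le> y" for y :: real
        using that by (cases "y = 0") (auto simp: powr_powr[symmetric])
      show ?thesis using hardy_powr_mean[OF g, of T "2 * q"] supp q by (simp add: \<phi>_def p)
    qed
    show ?thesis
    \<comment> \<open>If \<open>E\<close> carries more than the fraction \<open>\<delta>\<close> of
      the energy, the mean value inequality with exponent 2 already suffices.\<close>
    proof (cases "a \<le> \<delta> * b")
      case False
      then have "b \<le> a / \<delta>" using \<delta> by (simp add: field_simps)
      moreover have "0 \<le> \<eta> * b" using \<eta> b0 by simp
      ultimately show ?thesis using F2 by (simp add: a_def b_def \<phi>_def)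
    next
      case True
      show ?thesis
      proof (cases "b = 0")
        case True
        then show ?thesis using F2 a0 \<delta> by (simp add: a_def b_def \<phi>_def)
      next
        case False
        then have b: "b > 0" using b0 by simp
        let ?i = "\<lambda>t. indicator E (cayley_line t) :: real"
        \<comment> \<open>Tangents at different points: at the mean \<open>b\<close> off
          \<open>E\<close>, at the smaller value \<open>\<delta> * b\<close> on
          \<open>E\<close>.\<close>
        let ?h = "\<lambda>t. b powr q * ((q / b) * \<phi> t + (1 - q) * (1 - ?i t)) + (\<delta> * b) powr q * ((q / (\<delta> * b)) * (?i t * \<phi> t) + (1 - q) * ?i t)"
        have ih: "integrable I01 ?h"
          using i1 i2 i3 by (intro Bochner_Integration.integrable_add integrable_mult_right Bochner_Integration.integrable_diff) auto
        have "(LINT t|I01. \<phi> t powr q) \<le> (LINT t|I01. ?h t)"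
        proof (rule integral_mono[OF _ ih])
          show "integrable I01 (\<lambda>t. \<phi> t powr q)"
            using \<phi>0 \<phi>b q by (intro integrable_I01_bounded[where B = "(B\<^sup>2) powr q"]) (auto intro!: powr_mono2)
          fix t
          have A: "0 \<le> b powr q * ((q / b) * \<phi> t)" using b q \<phi>0 by simp
          show "\<phi> t powr q \<le> ?h t"
          proof (cases "cayley_line t \<in> E")
            case True
            have "\<phi> t powr q \<le> (\<delta> * b) powr q * (q * (\<phi> t / (\<delta> * b)) + (1 - q))"
              using q \<delta> b \<phi>0 by (intro powr_le_tangent) auto
            then show ?thesis using True A by simp
          next
            case False
            have "\<phi> t powr q \<le> b powr q * (q * (\<phi> t / b) + (1 - q))"
              using q b \<phi>0 by (intro powr_le_tangent) auto
            then show ?thesis using False by simp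
          qed
        qed
        also have "\<dots> = b powr q * ((q / b) * b + (1 - q) * (1 - w')) + (\<delta> * b) powr q * ((q / (\<delta> * b)) * a + (1 - q) * w')"
        proof -
          have "(LINT t|I01. ?h t) = (LINT t|I01. b powr q * ((q / b) * \<phi> t + (1 - q) * (1 - ?i t))) + (LINT t|I01. (\<delta> * b) powr q * ((q / (\<delta> * b)) * (?i t * \<phi> t) + (1 - q) * ?i t))"
            using i1 i2 i3 by (intro Bochner_Integration.integral_add Bochner_Integration.integrable_add integrable_mult_right Bochner_Integration.integrable_diff) auto
          also have "(LINT t|I01. b powr q * ((q / b) * \<phi> t + (1 - q) * (1 - ?i t))) = b powr q * ((q / b) * b + (1 - q) * (1 - w'))"
          proof -
            have "(LINT t|I01. (q / b) * \<phi> t + (1 - q) * (1 - ?i t)) = (LINT t|I01. (q / b) * \<phi> t) + (LINT t|I01. (1 - q) * (1 - ?i t))"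
              using i1 i3 by (intro Bochner_Integration.integral_add integrable_mult_right Bochner_Integration.integrable_diff) auto
            also have "(LINT t|I01. (1 - q) * (1 - ?i t)) = (1 - q) * ((LINT t|I01. 1) - (LINT t|I01. ?i t))"
              using i3 by (subst integral_mult_right_zero, subst Bochner_Integration.integral_diff) auto
            finally show ?thesis by (simp only: integral_mult_right_zero b_def w'_def one)
          qed
          also have "(LINT t|I01. (\<delta> * b) powr q * ((q / (\<delta> * b)) * (?i t * \<phi> t) + (1 - q) * ?i t)) = (\<delta> * b) powr q * ((q / (\<delta> * b)) * a + (1 - q) * w')"
          proof -
            have "(LINT t|I01. (q / (\<delta> * b)) * (?i t * \<phi> t) + (1 - q) * ?i t) = (LINT t|I01. (q / (\<delta> * b)) * (?i t * \<phi> t)) + (LINT t|I01. (1 - q) * ?i t)"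
              using i2 i3 by (intro Bochner_Integration.integral_add integrable_mult_right) auto
            then show ?thesis by (simp only: integral_mult_right_zero a_def w'_def)
          qed
          finally show ?thesis .
        qed
        also have "\<dots> \<le> b powr q * (1 - w / 2) + (\<delta> * b) powr q * 1"
        proof (intro add_mono mult_left_mono)
          have "(1 / 2) * w \<le> (1 - q) * w'" using q w w' by (intro mult_mono) auto
          then show "(q / b) * b + (1 - q) * (1 - w') \<le> 1 - w / 2" using b by (simp add: algebra_simps)
          have "(q / (\<delta> * b)) * a \<le> (q / (\<delta> * b)) * (\<delta> * b)" using True q \<delta> b by (intro mult_left_mono) auto
          also have "\<dots> = q" using \<delta> b by simp
          finally have "(q / (\<delta> * b)) * a \<le> q" .
          moreover have "(1 - q) * w' \<le> (1 - q) * 1" using w'1 q by (intro mult_left_mono) auto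
          ultimately have "(q / (\<delta> * b)) * a + (1 - q) * w' \<le> q + (1 - q) * 1" by (rule add_mono)
          then show "(q / (\<delta> * b)) * a + (1 - q) * w' \<le> 1" by simp
        qed auto
        also have "\<dots> = b powr q * (1 - w / 4)"
          using \<delta> b by (simp add: powr_mult algebra_simps)
        finally have "((cmod (lft g \<i>))\<^sup>2) powr q \<le> b powr q * (1 - w / 4)" using Fq by simp
        then have "root n ((cmod (lft g \<i>))\<^sup>2) \<le> root n b * (1 - w / 4)" using b by (simp add: qn)
        then have "(root n ((cmod (lft g \<i>))\<^sup>2)) ^ n \<le> (root n b * (1 - w / 4)) ^ n"
          using n2 by (intro power_mono) auto
        then have "(cmod (lft g \<i>))\<^sup>2 \<le> b * (1 - w / 4) ^ n" using n2 b by (simp add: power_mult_distrib)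
        also have "\<dots> \<le> b * \<eta>" using n b by (intro mult_left_mono) auto
        finally have "(cmod (lft g \<i>))\<^sup>2 \<le> \<eta> * b" by (simp add: mult.commute)
        moreover have "0 \<le> (1 / \<delta>) * a" using \<delta> a0 by simp
        ultimately show ?thesis by (simp add: a_def b_def \<phi>_def)
      qed
    qed
  qed
  then show ?thesis using \<delta> by (intro exI[of _ "1 / \<delta>"]) auto
qed

text \<open>Borel sets keep the Fubini arguments within product measurable functions; a Lebesgue
  measurable set is exchanged for a Borel set in \<open>thick_norm_controlled\<close>.\<close>

definition thick_borel :: "real \<Rightarrow> real \<Rightarrow> real set \<Rightarrow> bool" where
  "thick_borel \<Delta> \<gamma> E \<longleftrightarrow> E \<in> sets borel \<and> (\<forall>x. measure lborel (E \<inter> {x..x + \<Delta>}) \<ge> \<gamma> * \<Delta>)"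

lemma nn_integral_shift:
  assumes [measurable]: "f \<in> borel_measurable borel"
  shows "(\<integral>\<^sup>+x. f (x + a) \<partial>lborel) = (\<integral>\<^sup>+x. f x \<partial>(lborel :: real measure))"
  using nn_integral_real_affine[of f 1 a] by (simp add: add.commute)

lemma sqn_nn: "integrable lborel (\<lambda>x. (cmod (f x))\<^sup>2) \<Longrightarrow> ennreal (sqn f) = (\<integral>\<^sup>+x. ennreal ((cmod (f x))\<^sup>2) \<partial>lborel)"
  unfolding sqn_def by (subst nn_integral_eq_integral) auto

text \<open>Tonelli and translation invariance, as \<open>t\<close> is distributed with total mass
  1.\<close>

lemma nn_integral_shift_average:
  fixes f :: "real \<Rightarrow> ennreal"
  assumes [measurable]: "f \<in> borel_measurable borel"
  shows "(\<integral>\<^sup>+x. (\<integral>\<^sup>+t. f (x + cayley_line t) \<partial>I01) \<partial>lborel) = (\<integral>\<^sup>+x. f x \<partial>lborel)"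
proof -
  interpret pair_sigma_finite lborel I01 ..
  have m: "(\<lambda>(x, t). f (x + cayley_line t)) \<in> borel_measurable (lborel \<Otimes>\<^sub>M I01)"
  proof -
    have [measurable]: "cayley_line \<in> borel_measurable I01" by (rule borel_measurable_I01) measurable
    show ?thesis by measurable
  qed
  have "(\<integral>\<^sup>+x. (\<integral>\<^sup>+t. f (x + cayley_line t) \<partial>I01) \<partial>lborel) = (\<integral>\<^sup>+t. (\<integral>\<^sup>+x. f (x + cayley_line t) \<partial>lborel) \<partial>I01)"
    using Fubini'[OF m] by simp
  also have "\<dots> = (\<integral>\<^sup>+t. (\<integral>\<^sup>+x. f x \<partial>lborel) \<partial>I01)" by (simp add: nn_integral_shift)
  also have "\<dots> = (\<integral>\<^sup>+x. f x \<partial>lborel)" by (simp add: emeasure_I01 space_restrict_space)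
  finally show ?thesis .
qed

text \<open>The exponential weight moves the evaluation from the real line to height 1: for the
  weighted function \<open>h\<close>, \<open>ft h x\<close> is the Hardy space function of
  \<open>g\<close> at x + \<i>. Thickness makes the two-constant inequality hold at all these points
  with the same weight \<open>w\<close>, and integrating over x turns its terms into Plancherel
  norms.\<close>

lemma hardy_thick:
  assumes \<Delta>: "0 < \<Delta>" and \<gamma>: "0 < \<gamma>" and \<eta>: "0 < \<eta>"
  shows "\<exists>C\<ge>0. \<forall>E g T. thick_borel \<Delta> \<gamma> E \<longrightarrow> L12 g \<longrightarrow> (\<forall>\<xi>. \<xi> < 0 \<or> \<xi> > T \<longrightarrow> g \<xi> = 0) \<longrightarrow>
    (LINT \<xi>|lborel. (cmod (g \<xi>) * exp (- 2 * pi * \<xi>))\<^sup>2) \<le> \<eta> * sqn g + C * (LINT x:E|lborel. (cmod (ft g x))\<^sup>2)"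
proof -
  define w where "w = min 1 (\<gamma> * \<Delta> / (pi * (1 + \<Delta>\<^sup>2)))"
  have "0 < pi * (1 + \<Delta>\<^sup>2)" by (intro mult_pos_pos add_pos_nonneg) auto
  then have w: "0 < w" "w \<le> 1" using \<Delta> \<gamma> by (auto simp: w_def)
  obtain C where C: "C \<ge> 0" and tc: "\<And>g T E. integrable lborel g \<Longrightarrow> (\<forall>\<xi>. \<xi> < 0 \<or> \<xi> > T \<longrightarrow> g \<xi> = 0) \<Longrightarrow> E \<in> sets borel \<Longrightarrow>
     w \<le> measure lborel {t\<in>{0..1}. cayley_line t \<in> E} \<Longrightarrow>
     (cmod (lft g \<i>))\<^sup>2 \<le> \<eta> * (LINT t|I01. (cmod (ft g (cayley_line t)))\<^sup>2) +
        C * (LINT t|I01. indicator E (cayley_line t) * (cmod (ft g (cayley_line t)))\<^sup>2)"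
    using two_constant_inequality[OF w \<eta>] by blast
  have "(LINT \<xi>|lborel. (cmod (g \<xi>) * exp (- 2 * pi * \<xi>))\<^sup>2) \<le> \<eta> * sqn g + C * (LINT x:E|lborel. (cmod (ft g x))\<^sup>2)"
    if th: "thick_borel \<Delta> \<gamma> E" and g: "L12 g" and supp: "\<forall>\<xi>. \<xi> < 0 \<or> \<xi> > T \<longrightarrow> g \<xi> = 0" for E g T
  proof -
    have E[measurable]: "E \<in> sets borel" using th by (simp add: thick_borel_def)
    have gi: "integrable lborel g" using g by (simp add: L12_def)
    note [measurable] = L12_measurable[OF g]
    define h where "h \<xi> = g \<xi> * of_real (exp (- 2 * pi * \<xi>))" for \<xi>
    have hm[measurable]: "h \<in> borel_measurable borel" unfolding h_def by measurable
    have h: "L12 h"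
    proof (rule L12_cong_norm[OF g hm])
      fix \<xi>
      show "cmod (h \<xi>) \<le> cmod (g \<xi>)"
      proof (cases "\<xi> < 0")
        case True then show ?thesis using supp by (simp add: h_def)
      next
        case False
        then have "exp (- 2 * pi * \<xi>) \<le> 1" by simp
        then show ?thesis unfolding h_def norm_mult by (intro mult_left_le) auto
      qed
    qed
    have ftg: "integrable lborel (\<lambda>x. (cmod (ft g x))\<^sup>2)" "sqn (ft g) = sqn g" by (rule plancherel[OF g])+
    have fth: "integrable lborel (\<lambda>x. (cmod (ft h x))\<^sup>2)" "sqn (ft h) = sqn h" by (rule plancherel[OF h])+
    have iE: "integrable lborel (\<lambda>x. indicator E x * (cmod (ft g x))\<^sup>2)"
      using integrable_mult_indicator[of E lborel "\<lambda>x. (cmod (ft g x))\<^sup>2"] ftg(1) by simp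
    have nnE: "(\<integral>\<^sup>+x. ennreal (indicator E x * (cmod (ft g x))\<^sup>2) \<partial>lborel) = ennreal (LINT x:E|lborel. (cmod (ft g x))\<^sup>2)"
      using iE by (subst nn_integral_eq_integral) (auto simp: set_lebesgue_integral_def)
    have pt: "ennreal ((cmod (ft h x))\<^sup>2) \<le> ennreal \<eta> * (\<integral>\<^sup>+t. ennreal ((cmod (ft g (x + cayley_line t)))\<^sup>2) \<partial>I01)
       + ennreal C * (\<integral>\<^sup>+t. ennreal (indicator E (x + cayley_line t) * (cmod (ft g (x + cayley_line t)))\<^sup>2) \<partial>I01)" for x
    proof -
      \<comment> \<open>Modulation moves the base point \<i> to x + \<i>.\<close>
      define gx where "gx \<xi> = g \<xi> * expi (x * \<xi>)" for \<xi>
      define Ex where "Ex = {y. x + y \<in> E}"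
      have gxi: "integrable lborel gx" unfolding gx_def by (rule ft_integrand_integrable[OF gi])
      have gxs: "\<forall>\<xi>. \<xi> < 0 \<or> \<xi> > T \<longrightarrow> gx \<xi> = 0" using supp by (simp add: gx_def)
      have Exm: "Ex \<in> sets borel"
      proof -
        have "(\<lambda>y. x + y) -` E \<inter> space borel \<in> sets borel" using E by (intro measurable_sets[of _ borel borel]) auto
        then show ?thesis by (simp add: vimage_def Ex_def)
      qed
      have wx: "w \<le> measure lborel {t\<in>{0..1}. cayley_line t \<in> Ex}"
        using cayley_line_measure[OF E \<Delta>, of \<gamma> x] th by (auto simp: thick_borel_def Ex_def w_def)
      have fgx: "ft gx y = ft g (x + y)" for y unfolding gx_def by (simp add: ft_modulate add.commute)
      have lfh: "lft gx \<i> = ft h x"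
        unfolding lft_def ft_def gx_def h_def
        by (intro Bochner_Integration.integral_cong refl) (simp add: exp_of_real[symmetric] mult_ac)
      let ?p = "\<lambda>t. (cmod (ft g (x + cayley_line t)))\<^sup>2"
      define B where "B = (LINT \<xi>|lborel. cmod (g \<xi>))"
      have pb: "?p t \<le> B\<^sup>2" for t unfolding B_def using norm_ft_le[OF gi] by (intro power_mono) auto
      have i1: "integrable I01 ?p" using pb by (intro integrable_I01_bounded[where B = "B\<^sup>2"]) auto
      have i2: "integrable I01 (\<lambda>t. indicator E (x + cayley_line t) * ?p t)"
        using pb by (intro integrable_I01_bounded[where B = "B\<^sup>2"]) (auto simp: indicator_def)
      have "(cmod (ft h x))\<^sup>2 \<le> \<eta> * (LINT t|I01. ?p t) + C * (LINT t|I01. indicator E (x + cayley_line t) * ?p t)"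
        using tc[OF gxi gxs Exm wx] by (simp add: fgx lfh Ex_def indicator_def)
      then have "ennreal ((cmod (ft h x))\<^sup>2) \<le> ennreal (\<eta> * (LINT t|I01. ?p t) + C * (LINT t|I01. indicator E (x + cayley_line t) * ?p t))"
        by (rule ennreal_leI)
      also have "\<dots> = ennreal \<eta> * ennreal (LINT t|I01. ?p t) + ennreal C * ennreal (LINT t|I01. indicator E (x + cayley_line t) * ?p t)"
        using C \<eta> by (subst ennreal_plus) (auto simp: ennreal_mult' intro!: mult_nonneg_nonneg integral_nonneg_AE AE_I2)
      also have "ennreal (LINT t|I01. ?p t) = (\<integral>\<^sup>+t. ennreal (?p t) \<partial>I01)"
        using i1 by (intro nn_integral_eq_integral[symmetric]) auto
      also have "ennreal (LINT t|I01. indicator E (x + cayley_line t) * ?p t) = (\<integral>\<^sup>+t. ennreal (indicator E (x + cayley_line t) * ?p t) \<partial>I01)"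
        using i2 by (intro nn_integral_eq_integral[symmetric]) auto
      finally show ?thesis .
    qed
    have Im: "(\<lambda>x. \<integral>\<^sup>+t. f (x + cayley_line t) \<partial>I01) \<in> borel_measurable lborel" if [measurable]: "f \<in> borel_measurable borel" for f :: "real \<Rightarrow> ennreal"
    proof -
      have [measurable]: "cayley_line \<in> borel_measurable I01" by (rule borel_measurable_I01) measurable
      show ?thesis by (rule I01.borel_measurable_nn_integral) measurable
    qed
    have "ennreal (sqn h) = (\<integral>\<^sup>+x. ennreal ((cmod (ft h x))\<^sup>2) \<partial>lborel)"
      using sqn_nn[OF fth(1)] fth(2) by simp
    also have "\<dots> \<le> (\<integral>\<^sup>+x. ennreal \<eta> * (\<integral>\<^sup>+t. ennreal ((cmod (ft g (x + cayley_line t)))\<^sup>2) \<partial>I01)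
       + ennreal C * (\<integral>\<^sup>+t. ennreal (indicator E (x + cayley_line t) * (cmod (ft g (x + cayley_line t)))\<^sup>2) \<partial>I01) \<partial>lborel)"
      by (intro nn_integral_mono pt)
    also have "\<dots> = ennreal \<eta> * (\<integral>\<^sup>+x. (\<integral>\<^sup>+t. ennreal ((cmod (ft g (x + cayley_line t)))\<^sup>2) \<partial>I01) \<partial>lborel)
       + ennreal C * (\<integral>\<^sup>+x. (\<integral>\<^sup>+t. ennreal (indicator E (x + cayley_line t) * (cmod (ft g (x + cayley_line t)))\<^sup>2) \<partial>I01) \<partial>lborel)"
      using Im[of "\<lambda>x. ennreal ((cmod (ft g x))\<^sup>2)"] Im[of "\<lambda>x. ennreal (indicator E x * (cmod (ft g x))\<^sup>2)"]
      by (subst nn_integral_add) (auto simp: nn_integral_cmult)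
    also have "\<dots> = ennreal \<eta> * ennreal (sqn g) + ennreal C * ennreal (LINT x:E|lborel. (cmod (ft g x))\<^sup>2)"
      using nn_integral_shift_average[of "\<lambda>x. ennreal ((cmod (ft g x))\<^sup>2)"]
        nn_integral_shift_average[of "\<lambda>x. ennreal (indicator E x * (cmod (ft g x))\<^sup>2)"]
        sqn_nn[OF ftg(1)] ftg(2) nnE by simp
    also have "\<dots> = ennreal (\<eta> * sqn g + C * (LINT x:E|lborel. (cmod (ft g x))\<^sup>2))"
      using C \<eta> by (subst ennreal_plus) (auto simp: ennreal_mult' set_lebesgue_integral_def intro!: mult_nonneg_nonneg integral_nonneg_AE AE_I2)
    finally have "sqn h \<le> \<eta> * sqn g + C * (LINT x:E|lborel. (cmod (ft g x))\<^sup>2)"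
      using C \<eta> by (subst (asm) ennreal_le_iff) (auto simp: set_lebesgue_integral_def intro!: add_nonneg_nonneg mult_nonneg_nonneg integral_nonneg_AE AE_I2)
    then show ?thesis by (simp add: sqn_def h_def norm_mult)
  qed
  then show ?thesis using C by blast
qed

section \<open>Functions with lacunary spectrum\<close>

lemma emeasure_lborel_bounded: "bounded (A :: real set) \<Longrightarrow> emeasure lborel A = ennreal (measure lborel A)"
  using emeasure_bounded_finite[of A] by (intro emeasure_eq_ennreal_measure) auto

lemma emeasure_Int_Icc: "emeasure lborel (A \<inter> {a..b}) = ennreal (measure lborel (A \<inter> {a..b :: real}))"
  by (rule emeasure_lborel_bounded, rule bounded_subset[OF bounded_closed_interval Int_lower2])

section \<open>Windows of a thick set that are filled substantially\<close>

definition window :: "real \<Rightarrow> real set \<Rightarrow> real \<Rightarrow> real set" where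
  "window r E y = {u\<in>{0..1}. y + r * u \<in> E}"

definition dense_points :: "real \<Rightarrow> real \<Rightarrow> real set \<Rightarrow> real set" where
  "dense_points r \<gamma> E = {y. \<gamma> \<le> measure lborel (window r E y)}"

lemma window_borel [measurable]:
  assumes [measurable]: "E \<in> sets borel"
  shows "window r E y \<in> sets borel"
  unfolding window_def by measurable

lemma window_subset: "window r E y \<subseteq> {0..1}"
  by (auto simp: window_def)

lemma window_emeasure: "emeasure lborel (window r E y) = ennreal (measure lborel (window r E y))"
  by (rule emeasure_lborel_bounded, rule bounded_subset[OF bounded_closed_interval window_subset])

lemma window_measurable [measurable]:
  assumes [measurable]: "E \<in> sets borel"
  shows "(\<lambda>y. emeasure lborel (window r E y)) \<in> borel_measurable borel"
proof -
  have eq: "emeasure lborel (window r E y) = (\<integral>\<^sup>+u. indicator {0..1} u * indicator E (y + r * u) \<partial>lborel)" for y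
  proof -
    have "emeasure lborel (window r E y) = (\<integral>\<^sup>+u. indicator (window r E y) u \<partial>lborel)" by simp
    also have "\<dots> = (\<integral>\<^sup>+u. indicator {0..1} u * indicator E (y + r * u) \<partial>lborel)"
      by (intro nn_integral_cong) (auto simp: window_def indicator_def)
    finally show ?thesis .
  qed
  have "(\<lambda>y. \<integral>\<^sup>+u. indicator {0..1} u * indicator E (y + r * u) \<partial>lborel) \<in> borel_measurable borel"
    by (rule lborel.borel_measurable_nn_integral) measurable
  then show ?thesis by (simp add: eq)
qed

lemma dense_points_borel [measurable]:
  assumes [measurable]: "E \<in> sets borel"
  shows "dense_points r \<gamma> E \<in> sets borel"
proof (cases "0 \<le> \<gamma>")
  case True
  have "dense_points r \<gamma> E = {y. ennreal \<gamma> \<le> emeasure lborel (window r E y)}"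
    using True by (auto simp: dense_points_def window_emeasure)
  also have "\<dots> \<in> sets borel" by measurable
  finally show ?thesis .
next
  case False
  then have "dense_points r \<gamma> E = UNIV"
    using measure_nonneg by (auto simp: dense_points_def intro: order_trans[of _ 0])
  then show ?thesis by simp
qed

text \<open>Each translate of the interval by \<open>r * u\<close> meets \<open>E\<close> in measure
  at least \<gamma> \<Delta>. Averaging over \<open>u\<close>, Tonelli shows that the window
  measures integrate to at least this over the interval, and the points outside the dense set
  contribute at most half of it.\<close>

lemma thick_dense_points:
  assumes th: "thick_borel \<Delta> \<gamma> E" and \<Delta>: "0 < \<Delta>" and \<gamma>: "0 < \<gamma>"
  shows "thick_borel \<Delta> (\<gamma> / 2) (dense_points r (\<gamma> / 2) E)"
  unfolding thick_borel_def
proof (intro conjI allI)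
  have E[measurable]: "E \<in> sets borel" using th by (simp add: thick_borel_def)
  let ?G = "dense_points r (\<gamma> / 2) E"
  show G[measurable]: "?G \<in> sets borel" by measurable
  fix x
  let ?I = "{x..x + \<Delta>}"
  have "ennreal (\<gamma> * \<Delta>) = (\<integral>\<^sup>+u. indicator {0..1} u * ennreal (\<gamma> * \<Delta>) \<partial>(lborel :: real measure))"
    by (subst nn_integral_multc) auto
  also have "\<dots> \<le> (\<integral>\<^sup>+u. indicator {0..1} u * (\<integral>\<^sup>+y. indicator ?I y * indicator E (y + r * u) \<partial>lborel) \<partial>lborel)"
  proof (intro nn_integral_mono mult_left_mono)
    fix u :: real
    have "ennreal (\<gamma> * \<Delta>) \<le> ennreal (measure lborel (E \<inter> {x + r * u..x + r * u + \<Delta>}))"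
      using th by (intro ennreal_leI) (auto simp: thick_borel_def)
    also have "\<dots> = (\<integral>\<^sup>+y. indicator (E \<inter> {x + r * u..x + r * u + \<Delta>}) y \<partial>lborel)"
      by (simp add: emeasure_Int_Icc)
    also have "\<dots> = (\<integral>\<^sup>+y. indicator (E \<inter> {x + r * u..x + r * u + \<Delta>}) (y + r * u) \<partial>lborel)"
      by (rule nn_integral_shift[symmetric]) measurable
    also have "\<dots> = (\<integral>\<^sup>+y. indicator ?I y * indicator E (y + r * u) \<partial>lborel)"
      by (intro nn_integral_cong) (auto simp: indicator_def)
    finally show "ennreal (\<gamma> * \<Delta>) \<le> (\<integral>\<^sup>+y. indicator ?I y * indicator E (y + r * u) \<partial>lborel)" .
  qed auto
  also have "\<dots> = (\<integral>\<^sup>+u. (\<integral>\<^sup>+y. indicator {0..1} u * (indicator ?I y * indicator E (y + r * u)) \<partial>lborel) \<partial>lborel)"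
    by (intro nn_integral_cong) (simp add: nn_integral_cmult)
  also have "\<dots> = (\<integral>\<^sup>+y. (\<integral>\<^sup>+u. indicator {0..1} u * (indicator ?I y * indicator E (y + r * u)) \<partial>lborel) \<partial>lborel)"
    by (rule lborel_pair.Fubini') measurable
  also have "\<dots> = (\<integral>\<^sup>+y. indicator ?I y * emeasure lborel (window r E y) \<partial>lborel)"
  proof (intro nn_integral_cong)
    fix y
    have "(\<integral>\<^sup>+u. indicator {0..1} u * (indicator ?I y * indicator E (y + r * u)) \<partial>lborel) = (\<integral>\<^sup>+u. indicator ?I y * indicator (window r E y) u \<partial>lborel)"
      by (intro nn_integral_cong) (auto simp: window_def indicator_def)
    then show "(\<integral>\<^sup>+u. indicator {0..1} u * (indicator ?I y * indicator E (y + r * u)) \<partial>lborel) = indicator ?I y * emeasure lborel (window r E y)"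
      by (simp add: nn_integral_cmult)
  qed
  also have "\<dots> \<le> (\<integral>\<^sup>+y. indicator (?G \<inter> ?I) y + ennreal (\<gamma> / 2) * indicator ?I y \<partial>lborel)"
  proof (intro nn_integral_mono)
    fix y
    have "measure lborel (window r E y) \<le> measure lborel {0..1::real}"
      by (intro measure_lborel_mono window_subset window_borel E) auto
    then have "emeasure lborel (window r E y) \<le> 1" by (simp add: window_emeasure)
    moreover have "emeasure lborel (window r E y) \<le> ennreal (\<gamma> / 2)" if "y \<notin> ?G"
      using that by (auto simp: window_emeasure dense_points_def intro!: ennreal_leI)
    ultimately show "indicator ?I y * emeasure lborel (window r E y) \<le> indicator (?G \<inter> ?I) y + ennreal (\<gamma> / 2) * indicator ?I y"
      by (auto simp: indicator_def add_increasing2)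
  qed
  also have "\<dots> = emeasure lborel (?G \<inter> ?I) + ennreal (\<gamma> / 2) * ennreal \<Delta>"
    using \<Delta> by (subst nn_integral_add) (auto simp: nn_integral_cmult)
  also have "\<dots> = ennreal (measure lborel (?G \<inter> ?I) + \<gamma> / 2 * \<Delta>)"
  proof -
    have p: "0 \<le> \<gamma> / 2 * \<Delta>" "0 \<le> \<gamma> / 2" using \<gamma> \<Delta> by auto
    show ?thesis by (simp only: emeasure_Int_Icc ennreal_plus[OF measure_nonneg p(1)] ennreal_mult'[OF p(2)])
  qed
  finally have "\<gamma> * \<Delta> \<le> measure lborel (?G \<inter> ?I) + \<gamma> / 2 * \<Delta>"
    using \<gamma> \<Delta> by (subst (asm) ennreal_le_iff) auto
  then show "\<gamma> / 2 * \<Delta> \<le> measure lborel (?G \<inter> ?I)" by (simp add: algebra_simps)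
qed

text \<open>An inequality of Logvinenko-Sereda type, uniform in the position of the band. When the
  band is moved to {0..1}, the squared Hardy weight is at least exp (- 4 pi) there;
  \<open>\<eta>\<close> is half of this, so that the error is absorbed.\<close>

lemma unit_band_lower_bound:
  assumes \<Delta>: "0 < \<Delta>" and \<gamma>: "0 < \<gamma>"
  shows "\<exists>D\<ge>0. \<forall>E g a. thick_borel \<Delta> \<gamma> E \<longrightarrow> L12 g \<longrightarrow> (\<forall>\<xi>. \<xi> < a \<or> \<xi> > a + 1 \<longrightarrow> g \<xi> = 0) \<longrightarrow>
    sqn g \<le> D * (LINT x:E|lborel. (cmod (ft g x))\<^sup>2)"
proof -
  define \<eta> where "\<eta> = exp (- 4 * pi) / 2"
  have \<eta>: "0 < \<eta>" by (simp add: \<eta>_def)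
  obtain C where C: "C \<ge> 0" and hl: "\<And>E g T. thick_borel \<Delta> \<gamma> E \<Longrightarrow> L12 g \<Longrightarrow> (\<forall>\<xi>. \<xi> < 0 \<or> \<xi> > T \<longrightarrow> g \<xi> = 0) \<Longrightarrow>
    (LINT \<xi>|lborel. (cmod (g \<xi>) * exp (- 2 * pi * \<xi>))\<^sup>2) \<le> \<eta> * sqn g + C * (LINT x:E|lborel. (cmod (ft g x))\<^sup>2)"
    using hardy_thick[OF \<Delta> \<gamma> \<eta>] by blast
  define D where "D = 2 * exp (4 * pi) * C"
  have "sqn g \<le> D * (LINT x:E|lborel. (cmod (ft g x))\<^sup>2)"
    if E: "thick_borel \<Delta> \<gamma> E" and g: "L12 g" and supp: "\<forall>\<xi>. \<xi> < a \<or> \<xi> > a + 1 \<longrightarrow> g \<xi> = 0" for E g a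
  proof -
    note [measurable] = L12_measurable[OF g]
    define h where "h \<xi> = g (\<xi> + a)" for \<xi>
    have gi: "integrable lborel g" "integrable lborel (\<lambda>x. (cmod (g x))\<^sup>2)" using g by (auto simp: L12_def)
    have h2: "integrable lborel (\<lambda>x. (cmod (h x))\<^sup>2)" "sqn h = sqn g" unfolding h_def using shift_sq[OF gi(2), of a] by auto
    have h: "L12 h"
      unfolding L12_def using h2 lborel_integrable_real_affine[OF gi(1), of 1 a] by (simp add: h_def[abs_def] add.commute)
    have hs: "\<forall>\<xi>. \<xi> < 0 \<or> \<xi> > 1 \<longrightarrow> h \<xi> = 0" using supp by (auto simp: h_def)
    have fth: "cmod (ft h y) = cmod (ft g y)" for y
    proof -
      have "ft g y = (LINT \<xi>|lborel. h \<xi> * expi (y * (\<xi> + a)))"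
        unfolding ft_def h_def using lborel_integral_real_affine[of 1 "\<lambda>\<xi>. g \<xi> * expi (y * \<xi>)" a] by (simp add: add.commute)
      also have "\<dots> = expi (y * a) * ft h y"
        unfolding ft_def by (simp add: ring_distribs expi_add mult_ac flip: integral_mult_right_zero)
      finally show ?thesis by (simp add: norm_mult)
    qed
    have "exp (- 4 * pi) * sqn h = (LINT \<xi>|lborel. exp (- 4 * pi) * (cmod (h \<xi>))\<^sup>2)" by (simp add: sqn_def)
    also have "\<dots> \<le> (LINT \<xi>|lborel. (cmod (h \<xi>) * exp (- 2 * pi * \<xi>))\<^sup>2)"
    proof (rule integral_mono)
      have ex: "exp (- 4 * pi) * (cmod (h \<xi>))\<^sup>2 \<le> (cmod (h \<xi>) * exp (- 2 * pi * \<xi>))\<^sup>2" "(cmod (h \<xi>) * exp (- 2 * pi * \<xi>))\<^sup>2 \<le> (cmod (h \<xi>))\<^sup>2" for \<xi>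
      proof -
        have e2: "(exp (- 2 * pi * \<xi>))\<^sup>2 = exp (- 4 * pi * \<xi>)" by (simp add: exp_double[symmetric] power2_eq_square exp_add[symmetric])
        have "(exp (- 4 * pi) \<le> exp (- 4 * pi * \<xi>) \<and> exp (- 4 * pi * \<xi>) \<le> 1) \<or> h \<xi> = 0"
        proof (cases "\<xi> < 0 \<or> 1 < \<xi>")
          case False
          then have "pi * \<xi> \<le> pi * 1" "0 \<le> pi * \<xi>" by (auto intro!: mult_left_mono)
          then show ?thesis by simp
        qed (use hs in auto)
        then have "exp (- 4 * pi) * (cmod (h \<xi>))\<^sup>2 \<le> exp (- 4 * pi * \<xi>) * (cmod (h \<xi>))\<^sup>2 \<and>
            exp (- 4 * pi * \<xi>) * (cmod (h \<xi>))\<^sup>2 \<le> 1 * (cmod (h \<xi>))\<^sup>2"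
          using mult_right_mono[of "exp (- 4 * pi)" "exp (- 4 * pi * \<xi>)" "(cmod (h \<xi>))\<^sup>2"]
            mult_right_mono[of "exp (- 4 * pi * \<xi>)" 1 "(cmod (h \<xi>))\<^sup>2"] by (elim disjE) (simp_all only: zero_le_power2, auto)
        then show "exp (- 4 * pi) * (cmod (h \<xi>))\<^sup>2 \<le> (cmod (h \<xi>) * exp (- 2 * pi * \<xi>))\<^sup>2" "(cmod (h \<xi>) * exp (- 2 * pi * \<xi>))\<^sup>2 \<le> (cmod (h \<xi>))\<^sup>2"
          unfolding power_mult_distrib e2 by (simp_all only: mult.commute mult_1)
      qed
      show "exp (- 4 * pi) * (cmod (h \<xi>))\<^sup>2 \<le> (cmod (h \<xi>) * exp (- 2 * pi * \<xi>))\<^sup>2" for \<xi> by (rule ex)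
      show "integrable lborel (\<lambda>\<xi>. (cmod (h \<xi>) * exp (- 2 * pi * \<xi>))\<^sup>2)"
        by (rule Bochner_Integration.integrable_bound[OF h2(1)]) (use ex(2) in \<open>auto simp: h_def\<close>)
    qed (use h2 in auto)
    also have "\<dots> \<le> \<eta> * sqn h + C * (LINT x:E|lborel. (cmod (ft h x))\<^sup>2)" by (rule hl[OF E h hs])
    finally have "exp (- 4 * pi) * sqn g / 2 \<le> C * (LINT x:E|lborel. (cmod (ft g x))\<^sup>2)"
      by (simp add: h2 fth \<eta>_def field_simps)
    then have "exp (4 * pi) * (exp (- 4 * pi) * sqn g / 2) \<le> exp (4 * pi) * (C * (LINT x:E|lborel. (cmod (ft g x))\<^sup>2))"
      by (intro mult_left_mono) auto
    moreover have "exp (4 * pi) * exp (- 4 * pi) = 1" by (simp add: exp_add[symmetric])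
    ultimately have "sqn g / 2 \<le> exp (4 * pi) * (C * (LINT x:E|lborel. (cmod (ft g x))\<^sup>2))"
      by (simp only: times_divide_eq_right mult.assoc[symmetric] mult_1)
    then show ?thesis by (simp add: D_def)
  qed
  then show ?thesis using C by (intro exI[of _ D]) (auto simp: D_def)
qed

text \<open>With \<open>gk k\<close> the part of \<open>g\<close> on the \<open>k\<close>-th interval, \<open>ft g (y + r * u)\<close> differs from the exponential sum
  \<open>\<Phi> u y\<close> by at most \<open>2 * pi * r\<close> in relative mean square, since frequencies within one interval differ by at most 1.
  The lower bound for exponential sums is used at the points \<open>y\<close> whose window is filled by \<open>E\<close> substantially; these
  form again a thick set, where each \<open>ft (gk k)\<close> can be controlled.\<close>

lemma tail_lower_bound:
  assumes \<Delta>: "0 < \<Delta>" and \<gamma>: "0 < \<gamma>"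
  shows "\<exists>C\<ge>0. \<exists>L\<ge>1. \<forall>E (K::nat set) lam g. thick_borel \<Delta> \<gamma> E \<longrightarrow> finite K \<longrightarrow>
    (\<forall>k\<in>K. \<forall>j\<in>K. k \<noteq> j \<longrightarrow> \<bar>lam k - lam j\<bar> > L) \<longrightarrow>
    (\<forall>k\<in>K. \<forall>j\<in>K. k \<noteq> j \<longrightarrow> card {(k', j')\<in>Sigma K (\<lambda>k. K - {k}). \<bar>(lam k - lam j) - (lam k' - lam j')\<bar> \<le> L} \<le> N) \<longrightarrow>
    L12 g \<longrightarrow> (\<forall>\<xi>. \<xi> \<notin> (\<Union>k\<in>K. {lam k..lam k + 1}) \<longrightarrow> g \<xi> = 0) \<longrightarrow>
    sqn g \<le> C * (LINT x:E|lborel. (cmod (ft g x))\<^sup>2)"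
proof -
  have \<gamma>2: "0 < \<gamma> / 2" using \<gamma> by simp
  obtain c B where c: "c > 0" and B: "B > 0" and esl: "\<forall>(K::nat set) l. finite K \<longrightarrow> (\<forall>k\<in>K. \<forall>j\<in>K. k \<noteq> j \<longrightarrow> \<bar>l k - l j\<bar> \<ge> B) \<longrightarrow>
    (\<forall>k\<in>K. \<forall>j\<in>K. k \<noteq> j \<longrightarrow> card {(k', j')\<in>Sigma K (\<lambda>k. K - {k}). \<bar>(l k - l j) - (l k' - l j')\<bar> \<le> 1} \<le> N) \<longrightarrow>
    (\<forall>X a. X \<in> sets borel \<longrightarrow> X \<subseteq> {0..1} \<longrightarrow> \<gamma> / 2 \<le> measure lborel X \<longrightarrow>
       c * (\<Sum>k\<in>K. (cmod (a k))\<^sup>2) \<le> (LINT x:X|lborel. (cmod (\<Sum>k\<in>K. a k * expi (l k * x)))\<^sup>2))"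
    using exponential_sum_lower_bound[OF \<gamma>2, of N] by (elim exE conjE) (rule that)
  obtain D where D: "D \<ge> 0" and ub: "\<And>E g a. thick_borel \<Delta> (\<gamma> / 2) E \<Longrightarrow> L12 g \<Longrightarrow> (\<forall>\<xi>. \<xi> < a \<or> \<xi> > a + 1 \<longrightarrow> g \<xi> = 0) \<Longrightarrow>
    sqn g \<le> D * (LINT x:E|lborel. (cmod (ft g x))\<^sup>2)"
    using unit_band_lower_bound[OF \<Delta> \<gamma>2] by blast
  \<comment> \<open>Replacing \<open>\<xi>\<close> by \<open>lam k\<close> within a window costs 2 *
    (2 pi r)^2 in relative mean square; this \<open>r\<close> keeps the cost at most 1 / 2 after the
    amplification by D / c.\<close>
  define r where "r = min 1 (sqrt (c / (16 * pi\<^sup>2 * (D + 1))))"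
  have q: "0 < 16 * pi\<^sup>2 * (D + 1)" using D by (intro mult_pos_pos) auto
  have r: "0 < r" "r \<le> 1" using c q by (auto simp: r_def)
  have r2: "D / c * (2 * (2 * pi * r)\<^sup>2) \<le> 1 / 2"
  proof -
    have "r\<^sup>2 \<le> (sqrt (c / (16 * pi\<^sup>2 * (D + 1))))\<^sup>2" using r by (intro power_mono) (auto simp: r_def)
    also have "\<dots> = c / (16 * pi\<^sup>2 * (D + 1))" using c q by simp
    finally have "D / c * (8 * pi\<^sup>2 * r\<^sup>2) \<le> D / c * (8 * pi\<^sup>2 * (c / (16 * pi\<^sup>2 * (D + 1))))"
      using D c by (intro mult_left_mono) auto
    also have "\<dots> = D / (D + 1) / 2"
    proof -
      have "D / c * (8 * P * (c / (16 * P * E))) = D / E / 2" if "0 < P" "0 < E" for P E :: real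
        using that c by (simp add: field_simps)
      note * = this
      show ?thesis by (rule *) (use D in auto)
    qed
    also have "\<dots> \<le> 1 / 2" using D by (simp add: field_simps)
    finally show ?thesis by (simp add: power_mult_distrib mult_ac)
  qed
  \<comment> \<open>The bound 1 makes the intervals disjoint. When frequencies are multiplied by
    \<open>r\<close>, a gap B / r becomes the gap \<open>B\<close> and the counting radius 1 / r
    becomes 1.\<close>
  define L where "L = max 1 (max (B / r) (1 / r))"
  have "sqn g \<le> (4 * D / c) * (LINT x:E|lborel. (cmod (ft g x))\<^sup>2)"
    if E: "thick_borel \<Delta> \<gamma> E" and K: "finite K"
      and gap: "\<forall>k\<in>K. \<forall>j\<in>K. k \<noteq> j \<longrightarrow> \<bar>lam k - lam j\<bar> > L"
      and cnt: "\<forall>k\<in>K. \<forall>j\<in>K. k \<noteq> j \<longrightarrow> card {(k', j')\<in>Sigma K (\<lambda>k. K - {k}). \<bar>(lam k - lam j) - (lam k' - lam j')\<bar> \<le> L} \<le> N"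
      and g: "L12 g" and supp: "\<forall>\<xi>. \<xi> \<notin> (\<Union>k\<in>K. {lam k..lam k + 1}) \<longrightarrow> g \<xi> = 0"
    for E and K :: "nat set" and lam :: "nat \<Rightarrow> real" and g
  proof -
    note [measurable] = L12_measurable[OF g]
    have Em[measurable]: "E \<in> sets borel" using E by (simp add: thick_borel_def)
    have gi: "integrable lborel g" "integrable lborel (\<lambda>x. (cmod (g x))\<^sup>2)" using g by (auto simp: L12_def)
    define I where "I k = {lam k..lam k + 1}" for k
    define G where "G = dense_points r (\<gamma> / 2) E"
    have Gm[measurable]: "G \<in> sets borel" unfolding G_def by measurable
    have Gth: "thick_borel \<Delta> (\<gamma> / 2) G" unfolding G_def by (rule thick_dense_points[OF E \<Delta> \<gamma>])
    define gk where "gk k \<xi> = indicator (I k) \<xi> * g \<xi>" for k \<xi>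
    have gkm[measurable]: "gk k \<in> borel_measurable borel" for k unfolding gk_def I_def by measurable
    have gk12: "L12 (gk k)" for k
      by (rule L12_cong_norm[OF g gkm]) (auto simp: gk_def indicator_def)
    have gki: "integrable lborel (gk k)" "integrable lborel (\<lambda>x. (cmod (gk k x))\<^sup>2)" for k using gk12 by (auto simp: L12_def)
    have disj: "k = j" if "k \<in> K" "j \<in> K" "\<xi> \<in> I k" "\<xi> \<in> I j" for k j \<xi>
    proof (rule ccontr)
      assume "k \<noteq> j"
      then have "\<bar>lam k - lam j\<bar> > 1" using gap that by (force simp: L_def)
      then show False using that by (auto simp: I_def)
    qed
    have single: "(\<Sum>k\<in>K. F k \<xi> * gk k \<xi>) = F k0 \<xi> * g \<xi>" if "k0 \<in> K" "\<xi> \<in> I k0" for F :: "nat \<Rightarrow> real \<Rightarrow> complex" and k0 \<xi>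
    proof -
      have "(\<Sum>k\<in>K. F k \<xi> * gk k \<xi>) = (\<Sum>k\<in>K. if k = k0 then F k0 \<xi> * g \<xi> else 0)"
      proof (rule sum.cong[OF refl])
        fix k assume k: "k \<in> K"
        show "F k \<xi> * gk k \<xi> = (if k = k0 then F k0 \<xi> * g \<xi> else 0)"
        proof (cases "k = k0")
          case True then show ?thesis using that(2) by (simp add: gk_def)
        next
          case False
          then have "\<xi> \<notin> I k" using disj[OF that(1) k that(2)] by auto
          then show ?thesis using False by (simp add: gk_def)
        qed
      qed
      then show ?thesis using K that by simp
    qed
    have out: "g \<xi> = 0 \<and> (\<forall>k\<in>K. gk k \<xi> = 0)" if "\<forall>k\<in>K. \<xi> \<notin> I k" for \<xi>
      using supp that by (auto simp: gk_def I_def)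
    have gsum: "g \<xi> = (\<Sum>k\<in>K. gk k \<xi>)" for \<xi>
    proof (cases "\<forall>k\<in>K. \<xi> \<notin> I k")
      case True then show ?thesis using out[OF True] by simp
    next
      case False
      then obtain k0 where "k0 \<in> K" "\<xi> \<in> I k0" by auto
      from single[OF this, of "\<lambda>_ _. 1"] show ?thesis by simp
    qed
    have sqsum: "sqn g = (\<Sum>k\<in>K. sqn (gk k))"
    proof -
      have "(cmod (g \<xi>))\<^sup>2 = (\<Sum>k\<in>K. (cmod (gk k \<xi>))\<^sup>2)" for \<xi>
      proof (cases "\<forall>k\<in>K. \<xi> \<notin> I k")
        case True then show ?thesis using out[OF True] by simp
      next
        case False
        then obtain k0 where k0: "k0 \<in> K" "\<xi> \<in> I k0" by auto
        have "(\<Sum>k\<in>K. (cmod (gk k \<xi>))\<^sup>2) = (\<Sum>k\<in>K. if k = k0 then (cmod (g \<xi>))\<^sup>2 else 0)"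
        proof (rule sum.cong[OF refl])
          fix k assume k: "k \<in> K"
          show "(cmod (gk k \<xi>))\<^sup>2 = (if k = k0 then (cmod (g \<xi>))\<^sup>2 else 0)"
          proof (cases "k = k0")
            case True then show ?thesis using k0(2) by (simp add: gk_def)
          next
            case False
            then have "\<xi> \<notin> I k" using disj[OF k0(1) k k0(2)] by auto
            then show ?thesis using False by (simp add: gk_def)
          qed
        qed
        then show ?thesis using K k0 by simp
      qed
      then show ?thesis unfolding sqn_def using gki(2) by (simp add: Bochner_Integration.integral_sum)
    qed
    define \<Phi> where "\<Phi> u y = (\<Sum>k\<in>K. ft (gk k) y * expi (r * lam k * u))" for u y
    \<comment> \<open>\<open>\<Phi> u y - ft g (y + r * u)\<close> is \<open>ft (d u) y\<close>, so
      Plancherel in \<open>y\<close> measures the error on the frequency side, where it is pointwise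
      small relative to \<open>g\<close>.\<close>
    define d where "d u \<xi> = (\<Sum>k\<in>K. (expi (r * lam k * u) - expi (r * u * \<xi>)) * gk k \<xi>)" for u \<xi>
    have dm: "d u \<in> borel_measurable borel" for u unfolding d_def by measurable
    have dbound: "cmod (d u \<xi>) \<le> 2 * pi * r * cmod (g \<xi>)" if u: "u \<in> {0..1}" for u \<xi>
    proof (cases "\<forall>k\<in>K. \<xi> \<notin> I k")
      case True then show ?thesis using out[OF True] by (simp add: d_def)
    next
      case False
      then obtain k0 where k0: "k0 \<in> K" "\<xi> \<in> I k0" by auto
      have du: "d u \<xi> = (expi (r * lam k0 * u) - expi (r * u * \<xi>)) * g \<xi>"
        unfolding d_def by (rule single[OF k0])
      moreover have "cmod (expi (r * lam k0 * u) - expi (r * u * \<xi>)) \<le> 2 * pi * \<bar>r * lam k0 * u - r * u * \<xi>\<bar>"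
        by (rule norm_expi_diff_le)
      moreover have "\<bar>r * lam k0 * u - r * u * \<xi>\<bar> = r * (u * \<bar>lam k0 - \<xi>\<bar>)"
      proof -
        have "r * lam k0 * u - r * u * \<xi> = (r * u) * (lam k0 - \<xi>)" by (simp add: algebra_simps)
        then show ?thesis using r u by (simp add: abs_mult)
      qed
      moreover have "r * (u * \<bar>lam k0 - \<xi>\<bar>) \<le> r * (1 * 1)"
        using u k0 r by (intro mult_left_mono mult_mono) (auto simp: I_def)
      moreover have "2 * pi * (r * (u * \<bar>lam k0 - \<xi>\<bar>)) \<le> 2 * pi * r"
        using calculation(4) by (intro mult_left_mono) auto
      ultimately have "cmod (expi (r * lam k0 * u) - expi (r * u * \<xi>)) \<le> 2 * pi * r" by (metis order_trans)
      then show ?thesis using du by (simp add: norm_mult mult_right_mono)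
    qed
    have d12: "L12 (d u)" and dsq: "sqn (d u) \<le> (2 * pi * r)\<^sup>2 * sqn g" if u: "u \<in> {0..1}" for u
    proof -
      have "L12 (\<lambda>\<xi>. of_real (2 * pi * r) * g \<xi>)"
        unfolding L12_def using gi by (simp add: norm_mult power_mult_distrib)
      then show d12: "L12 (d u)"
        by (rule L12_cong_norm[OF _ dm]) (use dbound[OF u] r in \<open>simp add: norm_mult\<close>)
      have "sqn (d u) \<le> (LINT \<xi>|lborel. (2 * pi * r)\<^sup>2 * (cmod (g \<xi>))\<^sup>2)"
        unfolding sqn_def
      proof (rule integral_mono)
        show "(cmod (d u x))\<^sup>2 \<le> (2 * pi * r)\<^sup>2 * (cmod (g x))\<^sup>2" for x
          unfolding power_mult_distrib[symmetric] by (intro power_mono dbound[OF u]) auto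
      qed (use d12 gi in \<open>auto simp: L12_def\<close>)
      then show "sqn (d u) \<le> (2 * pi * r)\<^sup>2 * sqn g" by (simp add: sqn_def)
    qed
    have ftd: "ft (d u) y = \<Phi> u y - ft g (y + r * u)" for u y
    proof -
      have e1: "d u = (\<lambda>\<xi>. (\<Sum>k\<in>K. expi (r * lam k * u) * gk k \<xi>) - (\<Sum>k\<in>K. gk k \<xi> * expi ((r * u) * \<xi>)))"
        unfolding d_def left_diff_distrib sum_subtractf by (simp add: mult_ac)
      have i1: "integrable lborel (\<lambda>\<xi>. expi (r * lam k * u) * gk k \<xi>)" for k using gki by simp
      have i2: "integrable lborel (\<lambda>\<xi>. gk k \<xi> * expi ((r * u) * \<xi>))" for k using gki by (intro ft_integrand_integrable)
      have "ft (d u) y = (\<Sum>k\<in>K. ft (\<lambda>\<xi>. expi (r * lam k * u) * gk k \<xi>) y) - (\<Sum>k\<in>K. ft (\<lambda>\<xi>. gk k \<xi> * expi ((r * u) * \<xi>)) y)"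
        unfolding e1 using i1 i2 K by (subst ft_diff) (auto simp: ft_sum)
      also have "(\<Sum>k\<in>K. ft (\<lambda>\<xi>. gk k \<xi> * expi ((r * u) * \<xi>)) y) = ft g (y + r * u)"
        unfolding ft_modulate using gki K by (subst gsum[abs_def]) (simp add: ft_sum)
      finally have e2: "ft (d u) y = (\<Sum>k\<in>K. ft (\<lambda>\<xi>. expi (r * lam k * u) * gk k \<xi>) y) - ft g (y + r * u)" .
      show ?thesis unfolding e2 \<Phi>_def ft_cmult by (simp only: mult.commute)
    qed
    let ?A = "LINT x:E|lborel. (cmod (ft g x))\<^sup>2"
    have ftg: "integrable lborel (\<lambda>x. (cmod (ft g x))\<^sup>2)" by (rule plancherel[OF g])
    have iE: "integrable lborel (\<lambda>x. indicator E x * (cmod (ft g x))\<^sup>2)"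
      using integrable_mult_indicator[of E lborel "\<lambda>x. (cmod (ft g x))\<^sup>2"] ftg by simp
    have A0: "0 \<le> ?A" unfolding set_lebesgue_integral_def by (intro integral_nonneg_AE AE_I2) auto
    have nnE: "(\<integral>\<^sup>+x. ennreal (indicator E x * (cmod (ft g x))\<^sup>2) \<partial>lborel) = ennreal ?A"
      using iE by (subst nn_integral_eq_integral) (auto simp: set_lebesgue_integral_def)
    have \<Phi>m[measurable]: "(\<lambda>(u, y). \<Phi> u y) \<in> borel_measurable (borel \<Otimes>\<^sub>M borel)"
      unfolding \<Phi>_def by measurable
    \<comment> \<open>For fixed \<open>y\<close> the integration is in \<open>u\<close>: the numbers
      \<open>ft (gk k) y\<close> are the coefficients of an exponential sum in \<open>u\<close>,
      observed on a well filled window.\<close>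
    have row: "ennreal (indicator G y * (c * (\<Sum>k\<in>K. (cmod (ft (gk k) y))\<^sup>2))) \<le>
       (\<integral>\<^sup>+u. indicator {0..1} u * ennreal (indicator E (y + r * u) * (cmod (\<Phi> u y))\<^sup>2) \<partial>lborel)" for y
    proof (cases "y \<in> G")
      case True
      let ?X = "window r E y"
      have X: "?X \<in> sets borel" "?X \<subseteq> {0..1}" "\<gamma> / 2 \<le> measure lborel ?X"
        using True window_subset window_borel[OF Em] by (auto simp: G_def dense_points_def)
      have g1: "\<forall>k\<in>K. \<forall>j\<in>K. k \<noteq> j \<longrightarrow> \<bar>r * lam k - r * lam j\<bar> \<ge> B"
      proof (intro ballI impI)
        fix k j assume kj: "k \<in> K" "j \<in> K" "k \<noteq> j"
        have "B / r \<le> L" by (simp add: L_def)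
        then have "B / r \<le> \<bar>lam k - lam j\<bar>" using gap kj by force
        then have "B \<le> r * \<bar>lam k - lam j\<bar>" using r by (simp add: field_simps)
        then show "\<bar>r * lam k - r * lam j\<bar> \<ge> B" using r by (simp add: right_diff_distrib[symmetric] abs_mult)
      qed
      have g2: "\<forall>k\<in>K. \<forall>j\<in>K. k \<noteq> j \<longrightarrow> card {(k', j')\<in>Sigma K (\<lambda>k. K - {k}). \<bar>(r * lam k - r * lam j) - (r * lam k' - r * lam j')\<bar> \<le> 1} \<le> N"
      proof (intro ballI impI)
        fix k j assume kj: "k \<in> K" "j \<in> K" "k \<noteq> j"
        have "card {(k', j')\<in>Sigma K (\<lambda>k. K - {k}). \<bar>(r * lam k - r * lam j) - (r * lam k' - r * lam j')\<bar> \<le> 1} \<le>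
          card {(k', j')\<in>Sigma K (\<lambda>k. K - {k}). \<bar>(lam k - lam j) - (lam k' - lam j')\<bar> \<le> L}"
        proof (rule card_mono)
          have "finite (Sigma K (\<lambda>k. K - {k}))" using K by auto
          then show "finite {(k', j')\<in>Sigma K (\<lambda>k. K - {k}). \<bar>(lam k - lam j) - (lam k' - lam j')\<bar> \<le> L}"
            by (rule finite_subset[rotated]) auto
          have "\<bar>(lam k - lam j) - (lam k' - lam j')\<bar> \<le> L" if "\<bar>(r * lam k - r * lam j) - (r * lam k' - r * lam j')\<bar> \<le> 1" for k' j'
          proof -
            have "r * \<bar>(lam k - lam j) - (lam k' - lam j')\<bar> = \<bar>(r * lam k - r * lam j) - (r * lam k' - r * lam j')\<bar>"
              using r by (simp add: right_diff_distrib[symmetric] abs_mult)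
            then have "\<bar>(lam k - lam j) - (lam k' - lam j')\<bar> \<le> 1 / r" using that r by (simp add: field_simps)
            then show ?thesis by (simp add: L_def)
          qed
          then show "{(k', j')\<in>Sigma K (\<lambda>k. K - {k}). \<bar>(r * lam k - r * lam j) - (r * lam k' - r * lam j')\<bar> \<le> 1} \<subseteq>
             {(k', j')\<in>Sigma K (\<lambda>k. K - {k}). \<bar>(lam k - lam j) - (lam k' - lam j')\<bar> \<le> L}" by auto
        qed
        then show "card {(k', j')\<in>Sigma K (\<lambda>k. K - {k}). \<bar>(r * lam k - r * lam j) - (r * lam k' - r * lam j')\<bar> \<le> 1} \<le> N"
          using cnt kj by (meson order_trans)
      qed
      have "c * (\<Sum>k\<in>K. (cmod (ft (gk k) y))\<^sup>2) \<le> (LINT u:?X|lborel. (cmod (\<Phi> u y))\<^sup>2)"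
        using esl[THEN spec, THEN spec, THEN mp, OF K, THEN mp, OF g1, THEN mp, OF g2, THEN spec, THEN spec, THEN mp, OF X(1),
            THEN mp, OF X(2), THEN mp, OF X(3), of "\<lambda>k. ft (gk k) y"] by (simp add: \<Phi>_def)
      then have "ennreal (c * (\<Sum>k\<in>K. (cmod (ft (gk k) y))\<^sup>2)) \<le> ennreal (LINT u:?X|lborel. (cmod (\<Phi> u y))\<^sup>2)"
        by (rule ennreal_leI)
      also have "\<dots> = (\<integral>\<^sup>+u. ennreal (indicator ?X u * (cmod (\<Phi> u y))\<^sup>2) \<partial>lborel)"
      proof -
        have "set_integrable lborel ?X (\<lambda>u. (cmod (\<Phi> u y))\<^sup>2)"
          unfolding \<Phi>_def by (intro set_integrable_continuous_unit X continuous_intros)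
        then show ?thesis
          unfolding set_integrable_def set_lebesgue_integral_def by (subst nn_integral_eq_integral) auto
      qed
      also have "\<dots> = (\<integral>\<^sup>+u. indicator {0..1} u * ennreal (indicator E (y + r * u) * (cmod (\<Phi> u y))\<^sup>2) \<partial>lborel)"
        by (intro nn_integral_cong) (auto simp: window_def indicator_def)
      finally show ?thesis using True by simp
    qed simp
    \<comment> \<open>For fixed \<open>u\<close> the integration is in \<open>y\<close>, where
      translation invariance and Plancherel are available.\<close>
    have col: "(\<integral>\<^sup>+y. ennreal (indicator E (y + r * u) * (cmod (\<Phi> u y))\<^sup>2) \<partial>lborel) \<le> ennreal (2 * ?A + 2 * ((2 * pi * r)\<^sup>2 * sqn g))" if u: "u \<in> {0..1}" for u
    proof -
      have pl: "(\<integral>\<^sup>+y. ennreal ((cmod (ft (d u) y))\<^sup>2) \<partial>lborel) = ennreal (sqn (d u))"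
        using sqn_nn[OF plancherel(1)[OF d12[OF u]]] plancherel(2)[OF d12[OF u]] by simp
      have [measurable]: "ft (d u) \<in> borel_measurable borel" by (rule measurable_ft[OF dm])
      have sh: "(\<integral>\<^sup>+y. ennreal (indicator E (y + r * u) * (cmod (ft g (y + r * u)))\<^sup>2) \<partial>lborel) = ennreal ?A"
        using nn_integral_shift[of "\<lambda>x. ennreal (indicator E x * (cmod (ft g x))\<^sup>2)" "r * u"] nnE by simp
      have "(\<integral>\<^sup>+y. ennreal (indicator E (y + r * u) * (cmod (\<Phi> u y))\<^sup>2) \<partial>lborel) \<le>
        (\<integral>\<^sup>+y. ennreal 2 * ennreal (indicator E (y + r * u) * (cmod (ft g (y + r * u)))\<^sup>2) + ennreal 2 * ennreal ((cmod (ft (d u) y))\<^sup>2) \<partial>lborel)"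
      proof (intro nn_integral_mono)
        fix y
        have "(cmod (\<Phi> u y))\<^sup>2 \<le> 2 * (cmod (ft g (y + r * u)))\<^sup>2 + 2 * (cmod (ft (d u) y))\<^sup>2"
          using square_add_le[of "ft g (y + r * u)" "ft (d u) y"] by (simp add: ftd)
        then have "indicator E (y + r * u) * (cmod (\<Phi> u y))\<^sup>2 \<le> 2 * (indicator E (y + r * u) * (cmod (ft g (y + r * u)))\<^sup>2) + 2 * (cmod (ft (d u) y))\<^sup>2"
          by (auto simp: indicator_def)
        then have "ennreal (indicator E (y + r * u) * (cmod (\<Phi> u y))\<^sup>2) \<le> ennreal (2 * (indicator E (y + r * u) * (cmod (ft g (y + r * u)))\<^sup>2) + 2 * (cmod (ft (d u) y))\<^sup>2)"
          by (rule ennreal_leI)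
        then show "ennreal (indicator E (y + r * u) * (cmod (\<Phi> u y))\<^sup>2) \<le> ennreal 2 * ennreal (indicator E (y + r * u) * (cmod (ft g (y + r * u)))\<^sup>2) + ennreal 2 * ennreal ((cmod (ft (d u) y))\<^sup>2)"
          by (subst (asm) ennreal_plus) (auto simp: ennreal_mult)
      qed
      also have "\<dots> = ennreal 2 * ennreal ?A + ennreal 2 * ennreal (sqn (d u))"
        by (subst nn_integral_add) (auto simp: nn_integral_cmult sh pl)
      also have "\<dots> \<le> ennreal (2 * ?A + 2 * ((2 * pi * r)\<^sup>2 * sqn g))"
      proof -
        have "ennreal 2 * ennreal ?A + ennreal 2 * ennreal (sqn (d u)) = ennreal (2 * ?A + 2 * sqn (d u))"
          using A0 by (simp add: ennreal_mult' ennreal_plus)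
        also have "\<dots> \<le> ennreal (2 * ?A + 2 * ((2 * pi * r)\<^sup>2 * sqn g))"
          using dsq[OF u] by (intro ennreal_leI) simp
        finally show ?thesis .
      qed
      finally show ?thesis .
    qed
    have iG: "integrable lborel (\<lambda>y. indicator G y * (cmod (ft (gk k) y))\<^sup>2)" for k
      using integrable_mult_indicator[of G lborel "\<lambda>x. (cmod (ft (gk k) x))\<^sup>2"] plancherel(1)[OF gk12] by simp
    have iS: "integrable lborel (\<lambda>y. indicator G y * (c * (\<Sum>k\<in>K. (cmod (ft (gk k) y))\<^sup>2)))"
    proof -
      have "integrable lborel (\<lambda>y. c * (\<Sum>k\<in>K. indicator G y * (cmod (ft (gk k) y))\<^sup>2))"
        using iG by (intro integrable_mult_right Bochner_Integration.integrable_sum)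
      then show ?thesis by (simp add: sum_distrib_left mult.left_commute)
    qed
    have "ennreal (LINT y|lborel. indicator G y * (c * (\<Sum>k\<in>K. (cmod (ft (gk k) y))\<^sup>2))) =
       (\<integral>\<^sup>+y. ennreal (indicator G y * (c * (\<Sum>k\<in>K. (cmod (ft (gk k) y))\<^sup>2))) \<partial>lborel)"
      using iS c by (intro nn_integral_eq_integral[symmetric]) (auto intro!: AE_I2 mult_nonneg_nonneg sum_nonneg)
    also have "\<dots> \<le> (\<integral>\<^sup>+y. (\<integral>\<^sup>+u. indicator {0..1} u * ennreal (indicator E (y + r * u) * (cmod (\<Phi> u y))\<^sup>2) \<partial>lborel) \<partial>lborel)"
      by (intro nn_integral_mono row)
    also have "\<dots> = (\<integral>\<^sup>+u. (\<integral>\<^sup>+y. indicator {0..1} u * ennreal (indicator E (y + r * u) * (cmod (\<Phi> u y))\<^sup>2) \<partial>lborel) \<partial>lborel)"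
      by (rule lborel_pair.Fubini') measurable
    also have "\<dots> \<le> (\<integral>\<^sup>+u. indicator {0..1} u * ennreal (2 * ?A + 2 * ((2 * pi * r)\<^sup>2 * sqn g)) \<partial>(lborel :: real measure))"
    proof (intro nn_integral_mono)
      fix u :: real
      show "(\<integral>\<^sup>+y. indicator {0..1} u * ennreal (indicator E (y + r * u) * (cmod (\<Phi> u y))\<^sup>2) \<partial>lborel) \<le> indicator {0..1} u * ennreal (2 * ?A + 2 * ((2 * pi * r)\<^sup>2 * sqn g))"
        using col[of u] by (cases "u \<in> {0..1}") auto
    qed
    also have "\<dots> = ennreal (2 * ?A + 2 * ((2 * pi * r)\<^sup>2 * sqn g))" by (subst nn_integral_multc) auto
    finally have le: "(LINT y|lborel. indicator G y * (c * (\<Sum>k\<in>K. (cmod (ft (gk k) y))\<^sup>2))) \<le> 2 * ?A + 2 * ((2 * pi * r)\<^sup>2 * sqn g)"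
      using A0 by (subst (asm) ennreal_le_iff) auto
    have eq: "(LINT y|lborel. indicator G y * (c * (\<Sum>k\<in>K. (cmod (ft (gk k) y))\<^sup>2))) = c * (\<Sum>k\<in>K. LINT y:G|lborel. (cmod (ft (gk k) y))\<^sup>2)"
    proof -
      have "(LINT y|lborel. indicator G y * (c * (\<Sum>k\<in>K. (cmod (ft (gk k) y))\<^sup>2))) = (LINT y|lborel. c * (\<Sum>k\<in>K. indicator G y * (cmod (ft (gk k) y))\<^sup>2))"
        by (simp add: sum_distrib_left mult.left_commute)
      also have "\<dots> = c * (\<Sum>k\<in>K. LINT y|lborel. indicator G y * (cmod (ft (gk k) y))\<^sup>2)"
        unfolding integral_mult_right_zero using iG by (subst Bochner_Integration.integral_sum) auto
      finally show ?thesis by (simp add: set_lebesgue_integral_def)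
    qed
    \<comment> \<open>Each piece has its spectrum in a band of length 1, so its energy on the thick
      set \<open>G\<close> controls its norm, with the same \<open>D\<close> for all bands.\<close>
    have "sqn g \<le> (\<Sum>k\<in>K. D * (LINT y:G|lborel. (cmod (ft (gk k) y))\<^sup>2))"
      unfolding sqsum
    proof (intro sum_mono)
      fix k
      show "sqn (gk k) \<le> D * (LINT y:G|lborel. (cmod (ft (gk k) y))\<^sup>2)"
        by (rule ub[OF Gth gk12, of "lam k"]) (auto simp: gk_def I_def)
    qed
    also have "\<dots> = D / c * (c * (\<Sum>k\<in>K. LINT y:G|lborel. (cmod (ft (gk k) y))\<^sup>2))"
      using c by (simp add: sum_distrib_left)
    also have "\<dots> \<le> D / c * (2 * ?A + 2 * ((2 * pi * r)\<^sup>2 * sqn g))"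
      using le c D unfolding eq by (intro mult_left_mono) auto
    also have "\<dots> = 2 * D / c * ?A + (D / c * (2 * (2 * pi * r)\<^sup>2)) * sqn g"
      by (simp add: algebra_simps)
    also have "\<dots> \<le> 2 * D / c * ?A + 1 / 2 * sqn g"
      using r2 by (intro add_left_mono mult_right_mono) auto
    finally show ?thesis by (simp add: field_simps)
  qed
  moreover have "0 \<le> 4 * D / c" "1 \<le> L" using D c by (auto simp: L_def)
  ultimately show ?thesis by blast
qed

section \<open>Approximation by functions with bounded spectrum\<close>

lemma borel_representative:
  fixes f :: "real \<Rightarrow> complex"
  assumes "f \<in> borel_measurable lebesgue"
  obtains f' where "f' \<in> borel_measurable borel" "AE x in lebesgue. f x = f' x"
proof -
  have "(\<lambda>x. Re (f x)) \<in> borel_measurable lebesgue" "(\<lambda>x. Im (f x)) \<in> borel_measurable lebesgue"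
    using assms by measurable
  then obtain u v where u: "u \<in> borel_measurable lborel" "AE x in lborel. Re (f x) = u x"
    and v: "v \<in> borel_measurable lborel" "AE x in lborel. Im (f x) = v x"
    by (metis completion_ex_borel_measurable_real)
  show thesis
  proof
    show "(\<lambda>x. of_real (u x) + \<i> * of_real (v x)) \<in> borel_measurable borel"
      using u(1) v(1) by measurable
    have "AE x in lborel. f x = of_real (u x) + \<i> * of_real (v x)"
      using u(2) v(2) by eventually_elim (simp add: complex_eq_iff)
    then show "AE x in lebesgue. f x = of_real (u x) + \<i> * of_real (v x)" by (rule AE_completion)
  qed
qed

lemma integrable_lebesgue_borel:
  fixes f :: "real \<Rightarrow> 'a::{banach, second_countable_topology}"
  assumes "integrable lebesgue f" "f' \<in> borel_measurable borel" "AE x in lebesgue. f x = f' x"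
  shows "integrable lborel f'" "integral\<^sup>L lebesgue f = integral\<^sup>L lborel f'"
proof -
  have m: "f' \<in> borel_measurable lebesgue" using assms(2) by (simp add: measurable_completion)
  have "integrable lebesgue f'"
    using integrable_cong_AE_imp[OF assms(1) m] assms(3) by (auto elim: AE_mp)
  then show "integrable lborel f'" using assms(2) by (simp add: integrable_completion)
  have "integral\<^sup>L lebesgue f = integral\<^sup>L lebesgue f'"
    using assms m by (intro integral_cong_AE) auto
  also have "\<dots> = integral\<^sup>L lborel f'" using assms(2) by (simp add: integral_completion)
  finally show "integral\<^sup>L lebesgue f = integral\<^sup>L lborel f'" .
qed

lemma L2_representative:
  assumes "f \<in> L2"
  obtains f' where "f' \<in> borel_measurable borel" "AE x in lebesgue. f x = f' x"
    "integrable lborel (\<lambda>x. (cmod (f' x))\<^sup>2)" "(LINT x|lebesgue. (cmod (f x))\<^sup>2) = sqn f'"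
proof -
  obtain f' where f': "f' \<in> borel_measurable borel" "AE x in lebesgue. f x = f' x"
    using borel_representative[of f] assms unfolding L2_def by blast
  have ae: "AE x in lebesgue. (cmod (f x))\<^sup>2 = (cmod (f' x))\<^sup>2" using f'(2) by eventually_elim simp
  have "(\<lambda>x. (cmod (f' x))\<^sup>2) \<in> borel_measurable borel" using f'(1) by measurable
  from integrable_lebesgue_borel[OF _ this ae] assms show thesis
    by (intro that[OF f']) (auto simp: L2_def sqn_def)
qed

text \<open>\<open>ft\<close> carries the opposite sign in the exponent, hence the
  reflection.\<close>

lemma fourier_borel:
  assumes F: "integrable lebesgue F" and F': "F' \<in> borel_measurable borel" and ae: "AE x in lebesgue. F x = F' x"
  shows "fourier F \<xi> = ft F' (- \<xi>)"
proof -
  note [measurable] = F'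
  have iF': "integrable lborel F'" by (rule integrable_lebesgue_borel[OF F F' ae])
  have e: "exp (- 2 * of_real pi * \<i> * of_real x * of_real \<xi>) = expi (- \<xi> * x)" for x
    by (simp add: expi_def cis_conv_exp mult_ac)
  have m: "(\<lambda>x. F' x * expi (- \<xi> * x)) \<in> borel_measurable lborel" by measurable
  have "fourier F \<xi> = (LINT x|lebesgue. F x * expi (- \<xi> * x))" unfolding fourier_def e ..
  also have "\<dots> = (LINT x|lebesgue. F' x * expi (- \<xi> * x))"
  proof (rule integral_cong_AE)
    show "(\<lambda>x. F' x * expi (- \<xi> * x)) \<in> borel_measurable lebesgue" using m by (rule measurable_completion)
    have "(\<lambda>x. expi (- \<xi> * x)) \<in> borel_measurable lborel" by measurable
    from measurable_completion[OF this] show "(\<lambda>x. F x * expi (- \<xi> * x)) \<in> borel_measurable lebesgue"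
      using borel_measurable_integrable[OF F] by measurable
    show "AE x in lebesgue. F x * expi (- \<xi> * x) = F' x * expi (- \<xi> * x)" using ae by eventually_elim simp
  qed
  also have "\<dots> = (LINT x|lborel. F' x * expi (- \<xi> * x))" by (rule integral_completion[OF m])
  finally show ?thesis by (simp add: ft_def)
qed

lemma sqn_diff_expand:
  fixes u v :: "real \<Rightarrow> complex"
  assumes [measurable]: "u \<in> borel_measurable borel" "v \<in> borel_measurable borel"
    and u: "integrable lborel (\<lambda>x. (cmod (u x))\<^sup>2)" and v: "integrable lborel (\<lambda>x. (cmod (v x))\<^sup>2)"
  shows "sqn (\<lambda>x. u x - v x) = sqn u + sqn v - 2 * Re (LINT x|lborel. u x * cnj (v x))"
proof -
  have p: "integrable lborel (\<lambda>x. u x * cnj (v x))" using u v by (intro integrable_sq_prod) auto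
  have "sqn (\<lambda>x. u x - v x) = (LINT x|lborel. ((cmod (u x))\<^sup>2 + (cmod (v x))\<^sup>2) - 2 * Re (u x * cnj (v x)))"
    unfolding sqn_def
    by (intro Bochner_Integration.integral_cong refl) (simp add: cmod_power2, simp add: power2_eq_square algebra_simps)
  also have "\<dots> = (LINT x|lborel. (cmod (u x))\<^sup>2 + (cmod (v x))\<^sup>2) - (LINT x|lborel. 2 * Re (u x * cnj (v x)))"
    using u v p by (intro Bochner_Integration.integral_diff integrable_mult_right integrable_Re Bochner_Integration.integrable_add)
  also have "\<dots> = sqn u + sqn v - 2 * Re (LINT x|lborel. u x * cnj (v x))"
    unfolding sqn_def Bochner_Integration.integral_add[OF u v] integral_mult_right_zero integral_Re[OF p] ..
  finally show ?thesis .
qed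

lemma reflect_sqn:
  fixes f :: "real \<Rightarrow> complex"
  assumes "integrable lborel (\<lambda>x. (cmod (f x))\<^sup>2)"
  shows "integrable lborel (\<lambda>x. (cmod (f (- x)))\<^sup>2)" "sqn (\<lambda>x. f (- x)) = sqn f"
  using lborel_integrable_real_affine[OF assms, of "-1" 0]
    lborel_integral_real_affine[of "-1" "\<lambda>x. (cmod (f x))\<^sup>2" 0]
  by (simp_all add: sqn_def)

text \<open>A substitute for the inversion formula: \<open>F\<close> is close to \<open>ft h\<close>
  exactly when its transform is close to \<open>h\<close>. After expanding the squares the norms
  agree by Plancherel and the cross terms by Fubini.\<close>

lemma fourier_isometry:
  assumes F: "L12 F" and h: "L12 h"
  shows "integrable lborel (\<lambda>\<xi>. (cmod (ft F (- \<xi>) - h \<xi>))\<^sup>2)" "integrable lborel (\<lambda>x. (cmod (F x - ft h x))\<^sup>2)"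
    "sqn (\<lambda>\<xi>. ft F (- \<xi>) - h \<xi>) = sqn (\<lambda>x. F x - ft h x)"
proof -
  note [measurable] = L12_measurable[OF F] L12_measurable[OF h]
  have iF: "integrable lborel F" "integrable lborel (\<lambda>x. (cmod (F x))\<^sup>2)" using F by (auto simp: L12_def)
  have ih: "integrable lborel h" "integrable lborel (\<lambda>x. (cmod (h x))\<^sup>2)" using h by (auto simp: L12_def)
  have pF: "integrable lborel (\<lambda>\<xi>. (cmod (ft F (- \<xi>)))\<^sup>2)" "sqn (\<lambda>\<xi>. ft F (- \<xi>)) = sqn F"
    using reflect_sqn[OF plancherel(1)[OF F]] plancherel(2)[OF F] by auto
  note ph = plancherel[OF h]
  show "integrable lborel (\<lambda>\<xi>. (cmod (ft F (- \<xi>) - h \<xi>))\<^sup>2)" "integrable lborel (\<lambda>x. (cmod (F x - ft h x))\<^sup>2)"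
    using pF ih iF ph by (auto intro!: integrable_sq_diff)
  have ch: "integrable lborel (\<lambda>\<xi>. cnj (h \<xi>))" using ih by simp
  have cn: "cnj (ft h x) = (LINT \<xi>|lborel. cnj (h \<xi>) * expi (- (x * \<xi>)))" for x
  proof -
    have "cnj (ft h x) = (LINT y|lborel. cnj (h y * expi (x * y)))"
      unfolding ft_def by (rule Bochner_Integration.integral_cnj[symmetric])
    then show ?thesis by (simp del: Bochner_Integration.integral_cnj)
  qed
  have "(LINT x|lborel. F x * cnj (ft h x)) = (LINT x|lborel. F x * (LINT \<xi>|lborel. cnj (h \<xi>) * expi (- (x * \<xi>))))"
    by (simp only: cn)
  also have "\<dots> = (LINT \<xi>|lborel. cnj (h \<xi>) * (LINT x|lborel. F x * expi (- (x * \<xi>))))"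
    by (rule fubini_bounded_kernel[OF iF(1) ch]) auto
  also have "\<dots> = (LINT \<xi>|lborel. ft F (- \<xi>) * cnj (h \<xi>))"
    by (simp add: ft_def mult.commute[of _ "cnj _"] mult.commute[of _ "_ :: real"])
  finally have cross: "(LINT x|lborel. F x * cnj (ft h x)) = (LINT \<xi>|lborel. ft F (- \<xi>) * cnj (h \<xi>))" .
  have "sqn (\<lambda>\<xi>. ft F (- \<xi>) - h \<xi>) = sqn (\<lambda>\<xi>. ft F (- \<xi>)) + sqn h - 2 * Re (LINT \<xi>|lborel. ft F (- \<xi>) * cnj (h \<xi>))"
    using pF ih by (intro sqn_diff_expand) auto
  also have "\<dots> = sqn F + sqn (ft h) - 2 * Re (LINT x|lborel. F x * cnj (ft h x))"
    using pF(2) ph(2) cross by simp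
  also have "\<dots> = sqn (\<lambda>x. F x - ft h x)"
    using iF ph by (intro sqn_diff_expand[symmetric]) auto
  finally show "sqn (\<lambda>\<xi>. ft F (- \<xi>) - h \<xi>) = sqn (\<lambda>x. F x - ft h x)" .
qed

lemma nn_sq_add_le:
  fixes f g :: "real \<Rightarrow> complex"
  assumes [measurable]: "f \<in> borel_measurable M" "g \<in> borel_measurable M"
  shows "(\<integral>\<^sup>+x. ennreal ((cmod (f x + g x))\<^sup>2) \<partial>M) \<le> 2 * (\<integral>\<^sup>+x. ennreal ((cmod (f x))\<^sup>2) \<partial>M) + 2 * (\<integral>\<^sup>+x. ennreal ((cmod (g x))\<^sup>2) \<partial>M)"
proof -
  have "(\<integral>\<^sup>+x. ennreal ((cmod (f x + g x))\<^sup>2) \<partial>M) \<le> (\<integral>\<^sup>+x. 2 * ennreal ((cmod (f x))\<^sup>2) + 2 * ennreal ((cmod (g x))\<^sup>2) \<partial>M)"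
  proof (intro nn_integral_mono)
    fix x
    have "ennreal ((cmod (f x + g x))\<^sup>2) \<le> ennreal (2 * (cmod (f x))\<^sup>2 + 2 * (cmod (g x))\<^sup>2)"
      by (intro ennreal_leI square_add_le)
    then show "ennreal ((cmod (f x + g x))\<^sup>2) \<le> 2 * ennreal ((cmod (f x))\<^sup>2) + 2 * ennreal ((cmod (g x))\<^sup>2)"
      by (simp add: ennreal_mult)
  qed
  also have "\<dots> = 2 * (\<integral>\<^sup>+x. ennreal ((cmod (f x))\<^sup>2) \<partial>M) + 2 * (\<integral>\<^sup>+x. ennreal ((cmod (g x))\<^sup>2) \<partial>M)"
    by (subst nn_integral_add) (auto simp: nn_integral_cmult)
  finally show ?thesis .
qed

lemma truncation_converges:
  fixes g :: "real \<Rightarrow> complex"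
  assumes [measurable]: "g \<in> borel_measurable borel" and g: "integrable lborel (\<lambda>x. (cmod (g x))\<^sup>2)"
  shows "(\<lambda>n. LINT x|lborel. (cmod (g x - indicator {- real n..real n} x * g x))\<^sup>2) \<longlonglongrightarrow> 0"
proof -
  have "(\<lambda>n. LINT x|lborel. (cmod (g x - indicator {- real n..real n} x * g x))\<^sup>2) \<longlonglongrightarrow> (LINT x|(lborel::real measure). (0::real))"
  proof (rule integral_dominated_convergence[where w = "\<lambda>x. (cmod (g x))\<^sup>2"])
    show "AE x in lborel. (\<lambda>n. (cmod (g x - indicator {- real n..real n} x * g x))\<^sup>2) \<longlonglongrightarrow> 0"
    proof (intro AE_I2 tendsto_eventually)
      fix x :: real
      obtain m :: nat where m: "\<bar>x\<bar> < real m" using reals_Archimedean2 by blast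
      show "\<forall>\<^sub>F n in sequentially. (cmod (g x - indicator {- real n..real n} x * g x))\<^sup>2 = 0"
        unfolding eventually_sequentially by (rule exI[of _ m]) (use m in \<open>auto simp: indicator_def\<close>)
    qed
    show "AE x in lborel. norm ((cmod (g x - indicator {- real n..real n} x * g x))\<^sup>2) \<le> (cmod (g x))\<^sup>2" for n
      by (intro AE_I2) (auto simp: indicator_def)
  qed (use g in auto)
  then show ?thesis by simp
qed

lemma truncation_L12:
  fixes g :: "real \<Rightarrow> complex"
  assumes [measurable]: "g \<in> borel_measurable borel" and g: "integrable lborel (\<lambda>x. (cmod (g x))\<^sup>2)"
  shows "L12 (\<lambda>x. indicator {- real n..real n} x * g x)"
  unfolding L12_def
proof
  have i: "integrable lborel (indicator {- real n..real n} :: real \<Rightarrow> real)" by simp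
  show "integrable lborel (\<lambda>x. indicator {- real n..real n} x * g x)"
  proof (rule Bochner_Integration.integrable_bound)
    show "integrable lborel (\<lambda>x. indicator {- real n..real n} x + (cmod (g x))\<^sup>2)" using i g by simp
    have "cmod (g x) \<le> 1 + (cmod (g x))\<^sup>2" for x
      using sum_squares_bound[of 1 "cmod (g x)"] norm_ge_zero[of "g x"] by (simp del: norm_ge_zero)
    then show "AE x in lborel. norm (indicator {- real n..real n} x * g x) \<le> norm (indicator {- real n..real n} x + (cmod (g x))\<^sup>2)"
      by (intro AE_I2) (auto simp: indicator_def)
  qed measurable
  show "integrable lborel (\<lambda>x. (cmod (indicator {- real n..real n} x * g x))\<^sup>2)"
    by (rule Bochner_Integration.integrable_bound[OF g]) (auto simp: indicator_def)
qed

lemma nn_lebesgue_borel: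
  assumes "f' \<in> borel_measurable borel" "AE x in lebesgue. f x = f' x"
  shows "(\<integral>\<^sup>+x. ennreal ((cmod (f x))\<^sup>2) \<partial>lebesgue) = (\<integral>\<^sup>+x. ennreal ((cmod (f' x :: complex))\<^sup>2) \<partial>lborel)"
proof -
  have "(\<integral>\<^sup>+x. ennreal ((cmod (f x))\<^sup>2) \<partial>lebesgue) = (\<integral>\<^sup>+x. ennreal ((cmod (f' x))\<^sup>2) \<partial>lebesgue)"
    using assms(2) by (intro nn_integral_cong_AE) (auto elim: AE_mp)
  then show ?thesis by (simp add: nn_integral_completion)
qed

text \<open>\<open>ft h\<close> need not be integrable, so its truncations serve as approximants;
  \<open>fourier_isometry\<close> transfers their convergence to the frequency side.\<close>

lemma has_fourier_L2_ft:
  assumes h: "L12 h"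
  shows "has_fourier_L2 (ft h) h"
proof -
  note [measurable] = L12_measurable[OF h]
  have lebm: "f \<in> borel_measurable borel \<Longrightarrow> f \<in> borel_measurable lebesgue" for f :: "real \<Rightarrow> complex"
    by (simp add: measurable_completion)
  have inL2: "f \<in> L2" if "f \<in> borel_measurable borel" "integrable lborel (\<lambda>x. (cmod (f x))\<^sup>2)" for f
    using that by (auto simp: L2_def lebm integrable_completion)
  note ph = plancherel(1)[OF h]
  define F where "F n x = indicator {- real n..real n} x * ft h x" for n x
  have Fm[measurable]: "F n \<in> borel_measurable borel" for n unfolding F_def by measurable
  have F12: "L12 (F n)" for n unfolding F_def by (rule truncation_L12[OF _ ph]) measurable
  have FL: "F n \<in> L2" "integrable lebesgue (F n)" for n
    using F12[of n] inL2[OF Fm] Fm by (auto simp: L12_def integrable_completion)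
  have "(\<lambda>n. sqn (\<lambda>x. ft h x - F n x)) \<longlonglongrightarrow> 0"
    unfolding sqn_def F_def by (rule truncation_converges[OF _ ph]) measurable
  moreover have "sqn (\<lambda>x. ft h x - F n x) = sqn (\<lambda>x. F n x - ft h x)" for n
    by (simp add: sqn_def norm_minus_commute)
  ultimately have lim: "(\<lambda>n. ennreal (sqn (\<lambda>x. F n x - ft h x))) \<longlonglongrightarrow> 0"
    using tendsto_ennrealI[of "\<lambda>n. sqn (\<lambda>x. F n x - ft h x)" 0 sequentially] by simp
  have "tendsto_L2 F (ft h)"
    unfolding tendsto_L2_def using lim fourier_isometry(2)[OF F12 h]
    by (simp add: nn_integral_completion sqn_nn[symmetric])
  moreover have "tendsto_L2 (\<lambda>n. fourier (F n)) h"
  proof -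
    have "fourier (F n) \<xi> = ft (F n) (- \<xi>)" for n \<xi> by (rule fourier_borel[OF FL(2) Fm]) simp
    then show ?thesis
      unfolding tendsto_L2_def using lim fourier_isometry(1,3)[OF F12 h]
      by (simp add: nn_integral_completion sqn_nn[symmetric])
  qed
  ultimately show ?thesis
    unfolding has_fourier_L2_def using FL inL2[OF _ ph] inL2[of h] h by (auto simp: L12_def)
qed

text \<open>A transform of \<open>f\<close> is cut off to \<open>S\<close> and to a bounded
  interval, which gives \<open>h\<close>. Since \<open>f\<close> is tied to its transform only
  through approximants, one of these is compared with \<open>ft h\<close> by the isometry.\<close>

lemma spectrum_approximation:
  assumes f: "f \<in> L2_spectrum_in S" and S[measurable]: "S \<in> sets borel" and e: "0 < e"
  shows "\<exists>h T. L12 h \<and> (\<forall>\<xi>. \<xi> \<notin> S \<or> \<xi> > T \<longrightarrow> h \<xi> = 0) \<and>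
     (\<integral>\<^sup>+x. ennreal ((cmod (f x - ft h x))\<^sup>2) \<partial>lebesgue) \<le> ennreal e"
proof -
  obtain g F where fL: "f \<in> L2" and gL: "g \<in> L2" and FL: "\<And>n. F n \<in> L2" "\<And>n. integrable lebesgue (F n)"
    and tf: "tendsto_L2 F f" and tg: "tendsto_L2 (\<lambda>n. fourier (F n)) g" and gS: "AE \<xi> in lebesgue. \<xi> \<notin> S \<longrightarrow> g \<xi> = 0"
    using f by (auto simp: L2_spectrum_in_def has_fourier_L2_def)
  obtain g0 where g0: "g0 \<in> borel_measurable borel" "AE x in lebesgue. g x = g0 x" "integrable lborel (\<lambda>x. (cmod (g0 x))\<^sup>2)"
    using L2_representative[OF gL] by metis
  note [measurable] = g0(1)
  define g1 where "g1 x = indicator S x * g0 x" for x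
  have g1m[measurable]: "g1 \<in> borel_measurable borel" unfolding g1_def by measurable
  have gg1: "AE x in lebesgue. g x = g1 x" using g0(2) gS by eventually_elim (auto simp: g1_def indicator_def)
  have g1i: "integrable lborel (\<lambda>x. (cmod (g1 x))\<^sup>2)"
    by (rule Bochner_Integration.integrable_bound[OF g0(3)]) (auto simp: g1_def indicator_def)
  define h where "h n x = indicator {- real n..real n} x * g1 x" for n x
  have h12: "L12 (h n)" for n unfolding h_def by (rule truncation_L12[OF g1m g1i])
  \<comment> \<open>The inequality for the square of a sum is used twice, and the three errors add
    up to 10 / 16 of \<open>e\<close>.\<close>
  have e8: "e / 16 > 0" using e by simp
  obtain n where n: "sqn (\<lambda>x. g1 x - h n x) < e / 16"
    using LIMSEQ_D[OF truncation_converges[OF g1m g1i] e8] by (auto simp: sqn_def h_def abs_less_iff)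
  note [measurable] = L12_measurable[OF h12]
  have fm: "f \<in> borel_measurable lebesgue" and gm: "g \<in> borel_measurable lebesgue" and Fm: "F m \<in> borel_measurable lebesgue" for m
    using fL gL FL by (auto simp: L2_def)
  have lebm: "u \<in> borel_measurable borel \<Longrightarrow> u \<in> borel_measurable lebesgue" for u :: "real \<Rightarrow> complex"
    by (simp add: measurable_completion)
  let ?N = "\<lambda>u. \<integral>\<^sup>+x. ennreal ((cmod (u x))\<^sup>2) \<partial>lebesgue"
  have e8': "ennreal (e / 16) > 0" using e by simp
  have "eventually (\<lambda>m. ?N (\<lambda>x. F m x - f x) < ennreal (e / 16)) sequentially"
    "eventually (\<lambda>m. ?N (\<lambda>x. fourier (F m) x - g x) < ennreal (e / 16)) sequentially"
    using tf tg e8' unfolding tendsto_L2_def by (auto intro: order_tendstoD(2))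
  then have "eventually (\<lambda>m. ?N (\<lambda>x. F m x - f x) < ennreal (e / 16) \<and> ?N (\<lambda>x. fourier (F m) x - g x) < ennreal (e / 16)) sequentially"
    by eventually_elim simp
  then obtain m where m1: "?N (\<lambda>x. F m x - f x) < ennreal (e / 16)" and m2: "?N (\<lambda>x. fourier (F m) x - g x) < ennreal (e / 16)"
    by (auto dest: eventually_happens)
  obtain F' where F': "F' \<in> borel_measurable borel" "AE x in lebesgue. F m x = F' x" "integrable lborel (\<lambda>x. (cmod (F' x))\<^sup>2)"
    using L2_representative[OF FL(1)] by metis
  note [measurable] = F'(1)
  have F'12: "L12 F'" unfolding L12_def using integrable_lebesgue_borel(1)[OF FL(2) F'(1,2)] F'(3) by simp
  have fF: "fourier (F m) = (\<lambda>\<xi>. ft F' (- \<xi>))" using fourier_borel[OF FL(2) F'(1,2)] by (intro ext)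
  have iso: "?N (\<lambda>x. F m x - ft (h n) x) = ?N (\<lambda>\<xi>. fourier (F m) \<xi> - h n \<xi>)"
  proof -
    have "?N (\<lambda>x. F m x - ft (h n) x) = (\<integral>\<^sup>+x. ennreal ((cmod (F' x - ft (h n) x))\<^sup>2) \<partial>lborel)"
      using F'(2) by (intro nn_lebesgue_borel) (auto elim: AE_mp)
    also have "\<dots> = (\<integral>\<^sup>+x. ennreal ((cmod (ft F' (- x) - h n x))\<^sup>2) \<partial>lborel)"
      using fourier_isometry[OF F'12 h12] by (simp add: sqn_nn[symmetric])
    also have "\<dots> = ?N (\<lambda>\<xi>. fourier (F m) \<xi> - h n \<xi>)" unfolding fF by (simp add: nn_integral_completion)
    finally show ?thesis .
  qed
  have gh: "?N (\<lambda>x. g x - h n x) < ennreal (e / 16)"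
  proof -
    have "?N (\<lambda>x. g x - h n x) = (\<integral>\<^sup>+x. ennreal ((cmod (g1 x - h n x))\<^sup>2) \<partial>lborel)"
      using gg1 by (intro nn_lebesgue_borel) (auto elim: AE_mp)
    also have "\<dots> = ennreal (sqn (\<lambda>x. g1 x - h n x))"
      using g1i h12[of n] by (intro sqn_nn[symmetric] integrable_sq_diff) (auto simp: L12_def)
    finally show ?thesis using n e by (simp add: ennreal_less_iff)
  qed
  have fFm: "fourier (F m) \<in> borel_measurable lebesgue" unfolding fF by (rule lebm) measurable
  have hm: "h n \<in> borel_measurable lebesgue" "ft (h n) \<in> borel_measurable lebesgue"
    using L12_measurable[OF h12] by (auto intro!: lebm)
  have "?N (\<lambda>\<xi>. fourier (F m) \<xi> - h n \<xi>) \<le> 2 * ?N (\<lambda>x. fourier (F m) x - g x) + 2 * ?N (\<lambda>x. g x - h n x)"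
    using nn_sq_add_le[of "\<lambda>x. fourier (F m) x - g x" lebesgue "\<lambda>x. g x - h n x"] fFm gm hm by simp
  also have "\<dots> \<le> 2 * ennreal (e / 16) + 2 * ennreal (e / 16)"
    using m2 gh by (intro add_mono mult_left_mono) auto
  finally have a: "?N (\<lambda>x. F m x - ft (h n) x) \<le> 2 * ennreal (e / 16) + 2 * ennreal (e / 16)" unfolding iso .
  have "?N (\<lambda>x. f x - ft (h n) x) \<le> 2 * ?N (\<lambda>x. f x - F m x) + 2 * ?N (\<lambda>x. F m x - ft (h n) x)"
    using nn_sq_add_le[of "\<lambda>x. f x - F m x" lebesgue "\<lambda>x. F m x - ft (h n) x"] fm Fm hm by simp
  also have "?N (\<lambda>x. f x - F m x) = ?N (\<lambda>x. F m x - f x)" by (simp add: norm_minus_commute)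
  also have "2 * ?N (\<lambda>x. F m x - f x) + 2 * ?N (\<lambda>x. F m x - ft (h n) x) \<le> 2 * ennreal (e / 16) + 2 * (2 * ennreal (e / 16) + 2 * ennreal (e / 16))"
    using m1 a by (intro add_mono mult_left_mono) auto
  also have "\<dots> = ennreal (2 * (e / 16) + 2 * (2 * (e / 16) + 2 * (e / 16)))"
  proof -
    have two: "2 * ennreal y = ennreal (2 * y)" if "0 \<le> y" for y
      using that by (simp add: ennreal_mult)
    have "0 \<le> e / 16" using e by simp
    then show ?thesis by (simp only: two ennreal_plus[symmetric] add_nonneg_nonneg mult_nonneg_nonneg zero_le_numeral)
  qed
  also have "\<dots> \<le> ennreal e" using e by (intro ennreal_leI) simp
  finally have "?N (\<lambda>x. f x - ft (h n) x) \<le> ennreal e" .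
  moreover have "\<forall>\<xi>. \<xi> \<notin> S \<or> \<xi> > real n \<longrightarrow> h n \<xi> = 0" by (auto simp: h_def g1_def indicator_def)
  ultimately show ?thesis using h12 by blast
qed

section \<open>The equivalence\<close>

text \<open>The pairs (i, i) have difference 0. If two terms were within \<open>L\<close> of each
  other, all these infinitely many pairs would be counted.\<close>

lemma lacunary_gap:
  assumes Z: "strong_Zygmund_lacunary_with M N lam" and L: "1 \<le> L"
    and kj: "k \<noteq> j" "k \<ge> M L" "j \<ge> M L"
  shows "real L < \<bar>lam k - lam j\<bar>"
proof (rule ccontr)
  assume small: "\<not> real L < \<bar>lam k - lam j\<bar>"
  let ?P = "{(k', l'). k' \<ge> M L \<and> l' \<ge> M L \<and> \<bar>lam k - lam j - (lam k' - lam l')\<bar> \<le> real L}"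
  have "finite ?P" using Z L kj unfolding strong_Zygmund_lacunary_with_def Let_def by blast
  moreover have "(\<lambda>i. (i, i)) ` {M L..} \<subseteq> ?P" using small by auto
  ultimately have "finite ((\<lambda>i. (i, i)) ` {M L..})" by (rule finite_subset[rotated])
  then have "finite {M L..}" by (rule finite_imageD) (auto simp: inj_on_def)
  then show False using infinite_Ici by blast
qed

lemma lacunary_count:
  assumes Z: "strong_Zygmund_lacunary_with M N lam" and L: "1 \<le> L" and K: "K \<subseteq> {M L..}"
    and kj: "k \<in> K" "j \<in> K" "k \<noteq> j" and r: "r \<le> real L"
  shows "card {(k', j')\<in>Sigma K (\<lambda>k. K - {k}). \<bar>(lam k - lam j) - (lam k' - lam j')\<bar> \<le> r} \<le> N"
proof -
  let ?P = "{(k', l'). k' \<ge> M L \<and> l' \<ge> M L \<and> \<bar>lam k - lam j - (lam k' - lam l')\<bar> \<le> real L}"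
  have "k \<ge> M L" "j \<ge> M L" using K kj by auto
  then have P: "finite ?P" "card ?P \<le> N"
    using Z L kj(3) unfolding strong_Zygmund_lacunary_with_def Let_def by blast+
  have "card {(k', j')\<in>Sigma K (\<lambda>k. K - {k}). \<bar>(lam k - lam j) - (lam k' - lam j')\<bar> \<le> r} \<le> card ?P"
    by (rule card_mono[OF P(1)]) (use K r in force)
  then show ?thesis using P(2) by linarith
qed

lemma separated_finite:
  fixes lam :: "'a \<Rightarrow> real"
  assumes sep: "\<forall>k\<in>K. \<forall>j\<in>K. k \<noteq> j \<longrightarrow> 1 < \<bar>lam k - lam j\<bar>" and bd: "\<forall>k\<in>K. 0 \<le> lam k \<and> lam k \<le> T"
  shows "finite K"
proof (rule finite_imageD)
  have "(\<lambda>k. \<lfloor>lam k\<rfloor>) ` K \<subseteq> {0..\<lfloor>T\<rfloor>}" using bd by (auto simp: floor_mono)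
  then show "finite ((\<lambda>k. \<lfloor>lam k\<rfloor>) ` K)" by (rule finite_subset) simp
  show "inj_on (\<lambda>k. \<lfloor>lam k\<rfloor>) K"
  proof (rule inj_onI)
    fix k j assume kj: "k \<in> K" "j \<in> K" "\<lfloor>lam k\<rfloor> = \<lfloor>lam j\<rfloor>"
    have "\<bar>lam k - lam j\<bar> < 1" using floor_correct[of "lam k"] floor_correct[of "lam j"] kj(3) by linarith
    then show "k = j" using sep kj by force
  qed
qed

lemma set_sq_add_le:
  fixes u v :: "real \<Rightarrow> complex"
  assumes [measurable]: "u \<in> borel_measurable borel" "v \<in> borel_measurable borel" "E \<in> sets borel"
    and u: "integrable lborel (\<lambda>x. (cmod (u x))\<^sup>2)" and v: "integrable lborel (\<lambda>x. (cmod (v x))\<^sup>2)"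
  shows "(LINT x:E|lborel. (cmod (u x + v x))\<^sup>2) \<le> 2 * (LINT x:E|lborel. (cmod (u x))\<^sup>2) + 2 * sqn v"
proof -
  have uv: "integrable lborel (\<lambda>x. (cmod (u x + v x))\<^sup>2)" using u v by (intro integrable_sq_add) auto
  have iu: "integrable lborel (\<lambda>x. indicator E x *\<^sub>R (cmod (u x))\<^sup>2)"
    and iuv: "integrable lborel (\<lambda>x. indicator E x *\<^sub>R (cmod (u x + v x))\<^sup>2)"
    by (rule integrable_mult_indicator[OF _ u], simp, rule integrable_mult_indicator[OF _ uv], simp)
  have "(LINT x|lborel. indicator E x *\<^sub>R (cmod (u x + v x))\<^sup>2) \<le>
      (LINT x|lborel. 2 * (indicator E x *\<^sub>R (cmod (u x))\<^sup>2) + 2 * (cmod (v x))\<^sup>2)"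
  proof (rule integral_mono[OF iuv])
    show "integrable lborel (\<lambda>x. 2 * (indicator E x *\<^sub>R (cmod (u x))\<^sup>2) + 2 * (cmod (v x))\<^sup>2)"
      using iu v by (intro Bochner_Integration.integrable_add integrable_mult_right)
    show "indicator E x *\<^sub>R (cmod (u x + v x))\<^sup>2 \<le> 2 * (indicator E x *\<^sub>R (cmod (u x))\<^sup>2) + 2 * (cmod (v x))\<^sup>2" for x
      using square_add_le[of "u x" "v x"] by (auto simp: indicator_def)
  qed
  also have "\<dots> = 2 * (LINT x|lborel. indicator E x *\<^sub>R (cmod (u x))\<^sup>2) + 2 * (LINT x|lborel. (cmod (v x))\<^sup>2)"
    by (simp only: Bochner_Integration.integral_add[OF integrable_mult_right[OF iu] integrable_mult_right[OF v]] integral_mult_right_zero)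
  finally show ?thesis by (simp add: set_lebesgue_integral_def sqn_def)
qed

lemma union_lower_bound:
  fixes lam :: "nat \<Rightarrow> real"
  assumes Z: "strong_Zygmund_lacunary_with M N lam" and pos: "\<forall>k\<ge>1. 0 \<le> lam k"
    and \<Delta>: "0 < \<Delta>" and \<gamma>: "0 < \<gamma>"
  shows "\<exists>C\<ge>0. \<forall>E h T. thick_borel \<Delta> \<gamma> E \<longrightarrow> L12 h \<longrightarrow>
    (\<forall>\<xi>. \<xi> \<notin> (\<Union>k\<in>{1..}. {lam k..lam k + 1}) \<or> \<xi> > T \<longrightarrow> h \<xi> = 0) \<longrightarrow>
    sqn h \<le> C * (LINT x:E|lborel. (cmod (ft h x))\<^sup>2)"
proof -
  obtain D L where D: "D \<ge> 0" and L: "L \<ge> 1" and tl: "\<forall>E (K::nat set) lam g. thick_borel \<Delta> \<gamma> E \<longrightarrow> finite K \<longrightarrow>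
    (\<forall>k\<in>K. \<forall>j\<in>K. k \<noteq> j \<longrightarrow> \<bar>lam k - lam j\<bar> > L) \<longrightarrow>
    (\<forall>k\<in>K. \<forall>j\<in>K. k \<noteq> j \<longrightarrow> card {(k', j')\<in>Sigma K (\<lambda>k. K - {k}). \<bar>(lam k - lam j) - (lam k' - lam j')\<bar> \<le> L} \<le> N) \<longrightarrow>
    L12 g \<longrightarrow> (\<forall>\<xi>. \<xi> \<notin> (\<Union>k\<in>K. {lam k..lam k + 1}) \<longrightarrow> g \<xi> = 0) \<longrightarrow>
    sqn g \<le> D * (LINT x:E|lborel. (cmod (ft g x))\<^sup>2)"
    using tail_lower_bound[OF \<Delta> \<gamma>, of N] by (elim exE conjE) (rule that)
  \<comment> \<open>The lacunarity condition is indexed by integers, so \<open>L\<close> is rounded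
    up.\<close>
  define n where "n = nat \<lceil>L\<rceil>"
  have n: "L \<le> real n" "1 \<le> n" using L by (auto simp: n_def le_nat_iff)
  define m where "m = M n"
  have m1: "1 \<le> m" using Z n(2) by (simp add: strong_Zygmund_lacunary_with_def m_def)
  \<comment> \<open>A crude common bound for the right ends of the exceptional intervals, valid
    because all summands are nonnegative.\<close>
  define R where "R = (\<Sum>k\<in>{1..<m}. lam k + 1)"
  have R: "lam k + 1 \<le> R" if "1 \<le> k" "k < m" for k
    unfolding R_def using that pos by (intro member_le_sum) (auto simp: add_nonneg_nonneg)
  define e where "e = exp (4 * pi * R)"
  have e0: "0 < e" by (simp add: e_def)
  \<comment> \<open>The norm of the first part is at most \<open>e\<close> times the weighted norm,
    and it enters the tail estimate again with the factor 2 D; this choice makes the total error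
    half of \<open>sqn h\<close>.\<close>
  define \<eta> where "\<eta> = 1 / (2 * (1 + 2 * D) * e)"
  have \<eta>: "0 < \<eta>" using D e0 by (simp add: \<eta>_def)
  obtain B where B: "B \<ge> 0" and hl: "\<And>E g T. thick_borel \<Delta> \<gamma> E \<Longrightarrow> L12 g \<Longrightarrow> (\<forall>\<xi>. \<xi> < 0 \<or> \<xi> > T \<longrightarrow> g \<xi> = 0) \<Longrightarrow>
    (LINT \<xi>|lborel. (cmod (g \<xi>) * exp (- 2 * pi * \<xi>))\<^sup>2) \<le> \<eta> * sqn g + B * (LINT x:E|lborel. (cmod (ft g x))\<^sup>2)"
    using hardy_thick[OF \<Delta> \<gamma> \<eta>] by blast
  define C where "C = 2 * ((1 + 2 * D) * (e * B) + 2 * D)"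
  have "sqn h \<le> C * (LINT x:E|lborel. (cmod (ft h x))\<^sup>2)"
    if E: "thick_borel \<Delta> \<gamma> E" and h: "L12 h"
      and supp: "\<forall>\<xi>. \<xi> \<notin> (\<Union>k\<in>{1..}. {lam k..lam k + 1}) \<or> \<xi> > T \<longrightarrow> h \<xi> = 0" for E h T
  proof -
    note [measurable] = L12_measurable[OF h]
    have Em[measurable]: "E \<in> sets borel" using E by (simp add: thick_borel_def)
    have hi: "integrable lborel (\<lambda>x. (cmod (h x))\<^sup>2)" using h by (simp add: L12_def)
    let ?A = "LINT x:E|lborel. (cmod (ft h x))\<^sup>2"
    \<comment> \<open>Cutting at \<open>T\<close> makes the index set of the tail finite, as
      \<open>tail_lower_bound\<close> requires; the constants involve neither \<open>T\<close> nor
      the size of \<open>K\<close>.\<close>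
    define K where "K = {k. m \<le> k \<and> lam k \<le> T}"
    have KM: "K \<subseteq> {M n..}" by (auto simp: K_def m_def)
    have gap: "\<forall>k\<in>K. \<forall>j\<in>K. k \<noteq> j \<longrightarrow> L < \<bar>lam k - lam j\<bar>"
    proof (intro ballI impI)
      fix k j assume "k \<in> K" "j \<in> K" "k \<noteq> j"
      then show "L < \<bar>lam k - lam j\<bar>" using lacunary_gap[OF Z n(2), of k j] n(1) by (auto simp: K_def m_def)
    qed
    have fK: "finite K"
    proof (rule separated_finite[of K lam T])
      show "\<forall>k\<in>K. \<forall>j\<in>K. k \<noteq> j \<longrightarrow> 1 < \<bar>lam k - lam j\<bar>" using gap L by force
      show "\<forall>k\<in>K. 0 \<le> lam k \<and> lam k \<le> T" using pos m1 by (auto simp: K_def)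
    qed
    define U where "U = (\<Union>k\<in>K. {lam k..lam k + 1})"
    have Um[measurable]: "U \<in> sets borel" unfolding U_def using fK by (intro sets.finite_UN) auto
    \<comment> \<open>Where exceptional and tail intervals overlap, the mass goes to
      \<open>u\<close>, so that the remainder \<open>v\<close> lives on exceptional intervals
      only.\<close>
    define u where "u \<xi> = indicator U \<xi> * h \<xi>" for \<xi>
    define v where "v \<xi> = indicator (- U) \<xi> * h \<xi>" for \<xi>
    have um[measurable]: "u \<in> borel_measurable borel" and vm[measurable]: "v \<in> borel_measurable borel"
      unfolding u_def v_def by measurable
    have u12: "L12 u" by (rule L12_cong_norm[OF h um]) (auto simp: u_def indicator_def)
    have v12: "L12 v" by (rule L12_cong_norm[OF h vm]) (auto simp: v_def indicator_def)
    have ui: "integrable lborel u" "integrable lborel (\<lambda>x. (cmod (u x))\<^sup>2)"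
      and vi: "integrable lborel v" "integrable lborel (\<lambda>x. (cmod (v x))\<^sup>2)"
      using u12 v12 by (auto simp: L12_def)
    have huv: "h = (\<lambda>\<xi>. u \<xi> + v \<xi>)" by (auto simp: u_def v_def indicator_def)
    have fth: "ft h x = ft u x + ft v x" for x by (subst huv) (rule ft_add[OF ui(1) vi(1)])
    have split: "sqn h = sqn u + sqn v"
    proof -
      have "(cmod (h \<xi>))\<^sup>2 = (cmod (u \<xi>))\<^sup>2 + (cmod (v \<xi>))\<^sup>2" for \<xi> by (auto simp: u_def v_def indicator_def)
      then have "sqn h = (LINT \<xi>|lborel. (cmod (u \<xi>))\<^sup>2 + (cmod (v \<xi>))\<^sup>2)" unfolding sqn_def by presburger
      also have "\<dots> = sqn u + sqn v" unfolding sqn_def by (rule Bochner_Integration.integral_add[OF ui(2) vi(2)])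
      finally show ?thesis .
    qed
    have hneg: "h \<xi> = 0" if "\<xi> < 0" for \<xi> using supp pos that by force
    have vsupp: "v \<xi> = 0" if "R < \<xi>" for \<xi>
    proof (rule ccontr)
      assume "v \<xi> \<noteq> 0"
      then have nz: "h \<xi> \<noteq> 0" "\<xi> \<notin> U" by (auto simp: v_def indicator_def split: if_splits)
      then obtain k where k: "1 \<le> k" "lam k \<le> \<xi>" "\<xi> \<le> lam k + 1" "\<xi> \<le> T" using supp by force
      then have "k \<notin> K" using nz(2) by (auto simp: U_def)
      then have "k < m" using k by (auto simp: K_def)
      then show False using R[OF k(1)] k(3) that by simp
    qed
    have vle: "sqn v \<le> e * (LINT \<xi>|lborel. (cmod (h \<xi>) * exp (- 2 * pi * \<xi>))\<^sup>2)"
    proof -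
      have hw: "integrable lborel (\<lambda>\<xi>. (cmod (h \<xi>) * exp (- 2 * pi * \<xi>))\<^sup>2)"
      proof (rule Bochner_Integration.integrable_bound[OF hi])
        have "(cmod (h \<xi>) * exp (- 2 * pi * \<xi>))\<^sup>2 \<le> (cmod (h \<xi>))\<^sup>2" for \<xi>
        proof (cases "\<xi> < 0")
          case True then show ?thesis using hneg by simp
        next
          case False
          then show ?thesis by (intro power_mono mult_left_le) auto
        qed
        then show "AE \<xi> in lborel. norm ((cmod (h \<xi>) * exp (- 2 * pi * \<xi>))\<^sup>2) \<le> norm ((cmod (h \<xi>))\<^sup>2)"
          by (intro AE_I2) simp
      qed measurable
      have "sqn v \<le> (LINT \<xi>|lborel. e * (cmod (h \<xi>) * exp (- 2 * pi * \<xi>))\<^sup>2)"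
        unfolding sqn_def
      proof (rule integral_mono[OF vi(2) integrable_mult_right[OF hw]])
        fix \<xi> :: real
        show "(cmod (v \<xi>))\<^sup>2 \<le> e * (cmod (h \<xi>) * exp (- 2 * pi * \<xi>))\<^sup>2"
        proof (cases "R < \<xi>")
          case True then show ?thesis using vsupp e0 by simp
        next
          case False
          have "(exp (- 2 * pi * \<xi>))\<^sup>2 = exp (- (4 * pi * \<xi>))" by (simp add: power2_eq_square exp_add[symmetric])
          then have "e * (cmod (h \<xi>) * exp (- 2 * pi * \<xi>))\<^sup>2 = exp (4 * pi * (R - \<xi>)) * (cmod (h \<xi>))\<^sup>2"
            by (simp add: e_def power_mult_distrib exp_diff exp_minus right_diff_distrib field_simps)
          moreover have "1 * (cmod (h \<xi>))\<^sup>2 \<le> exp (4 * pi * (R - \<xi>)) * (cmod (h \<xi>))\<^sup>2"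
            using False by (intro mult_right_mono) auto
          moreover have "(cmod (v \<xi>))\<^sup>2 \<le> (cmod (h \<xi>))\<^sup>2" by (auto simp: v_def indicator_def)
          ultimately show ?thesis by linarith
        qed
      qed
      then show ?thesis by simp
    qed
    \<comment> \<open>Applied to \<open>h\<close> rather than to \<open>v\<close>, since only the
      energy of \<open>ft h\<close> on \<open>E\<close> may appear on the right.\<close>
    have "(LINT \<xi>|lborel. (cmod (h \<xi>) * exp (- 2 * pi * \<xi>))\<^sup>2) \<le> \<eta> * sqn h + B * ?A"
      by (rule hl[OF E h, of T]) (use hneg supp in blast)
    then have "e * (LINT \<xi>|lborel. (cmod (h \<xi>) * exp (- 2 * pi * \<xi>))\<^sup>2) \<le> e * (\<eta> * sqn h + B * ?A)"
      using e0 by (intro mult_left_mono) auto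
    with vle have v1: "sqn v \<le> e * (\<eta> * sqn h + B * ?A)" by linarith
    have "sqn u \<le> D * (LINT x:E|lborel. (cmod (ft u x))\<^sup>2)"
    proof (rule tl[THEN spec, THEN spec, THEN spec, THEN spec, THEN mp, OF E, THEN mp, OF fK, THEN mp, OF gap, THEN mp, THEN mp, OF _ u12, THEN mp])
      show "\<forall>k\<in>K. \<forall>j\<in>K. k \<noteq> j \<longrightarrow> card {(k', j')\<in>Sigma K (\<lambda>k. K - {k}). \<bar>(lam k - lam j) - (lam k' - lam j')\<bar> \<le> L} \<le> N"
        using lacunary_count[OF Z n(2) KM _ _ _ n(1)] by blast
      show "\<forall>\<xi>. \<xi> \<notin> (\<Union>k\<in>K. {lam k..lam k + 1}) \<longrightarrow> u \<xi> = 0" by (auto simp: u_def U_def indicator_def)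
    qed
    also have "(LINT x:E|lborel. (cmod (ft u x))\<^sup>2) \<le> 2 * ?A + 2 * sqn v"
    proof -
      have "(LINT x:E|lborel. (cmod (ft h x + (- ft v x)))\<^sup>2) \<le> 2 * ?A + 2 * sqn (\<lambda>x. - ft v x)"
        using plancherel(1)[OF h] plancherel(1)[OF v12] by (intro set_sq_add_le) auto
      moreover have "sqn (\<lambda>x. - ft v x) = sqn v" using plancherel(2)[OF v12] by (simp add: sqn_def)
      ultimately show ?thesis by (simp add: fth)
    qed
    finally have u1: "sqn u \<le> D * (2 * ?A + 2 * sqn v)" using D by (simp add: mult_left_mono)
    have "sqn h \<le> (1 + 2 * D) * sqn v + 2 * D * ?A" using u1 split by (simp add: algebra_simps)
    also have "\<dots> \<le> (1 + 2 * D) * (e * (\<eta> * sqn h + B * ?A)) + 2 * D * ?A"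
      using v1 D by (intro add_right_mono mult_left_mono) auto
    also have "\<dots> = ((1 + 2 * D) * e * \<eta>) * sqn h + C / 2 * ?A" by (simp add: C_def algebra_simps)
    also have "(1 + 2 * D) * e * \<eta> = 1 / 2"
    proof -
      have "a * b * (1 / (2 * a * b)) = 1 / 2" if "0 < a" "0 < b" for a b :: real using that by simp
      note half = this
      show ?thesis unfolding \<eta>_def by (rule half) (use D e0 in auto)
    qed
    finally show ?thesis by simp
  qed
  moreover have "0 \<le> C" using D B e0 by (simp add: C_def)
  ultimately show ?thesis by blast
qed

lemma lebesgue_borel_set:
  fixes E :: "real set"
  assumes "E \<in> sets lebesgue"
  obtains E' where "E' \<in> sets borel" "AE x in lebesgue. x \<in> E \<longleftrightarrow> x \<in> E'"
proof -
  have "(indicator E :: real \<Rightarrow> complex) \<in> borel_measurable lebesgue" using assms by simp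
  then obtain f where f: "f \<in> borel_measurable borel" "AE x in lebesgue. (indicator E x :: complex) = f x"
    using borel_representative by blast
  show thesis
  proof
    show "f -` {1} \<in> sets borel" using measurable_sets[OF f(1), of "{1}"] by simp
    show "AE x in lebesgue. x \<in> E \<longleftrightarrow> x \<in> f -` {1}"
      using f(2) by eventually_elim (auto simp: indicator_def split: if_splits)
  qed
qed

text \<open>The bound passes from \<open>ft h\<close> to every \<open>f\<close> in the spectral
  space by approximation. The inequality for the square of a sum costs a factor 2 on each side,
  hence \<open>4 * C\<close>, and the additive error tends to 0.\<close>

lemma thick_norm_controlled:
  fixes lam :: "nat \<Rightarrow> real"
  assumes Z: "strong_Zygmund_lacunary lam" and pos: "\<forall>k\<ge>1. 0 \<le> lam k"
    and S: "S = (\<Union>k\<in>{1..}. {lam k..lam k + 1})" and \<Delta>: "0 < \<Delta>" and \<gamma>: "0 < \<gamma>"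
  shows "\<exists>C. \<forall>E. thick_with \<Delta> \<gamma> E \<longrightarrow> norm_controlled S E C"
proof -
  have Sm: "S \<in> sets borel" unfolding S by (intro sets.countable_UN') auto
  obtain M N where Z': "strong_Zygmund_lacunary_with M N lam" using Z by (auto simp: strong_Zygmund_lacunary_def)
  obtain C where C: "C \<ge> 0" and lb: "\<And>E h T. thick_borel \<Delta> \<gamma> E \<Longrightarrow> L12 h \<Longrightarrow>
    (\<forall>\<xi>. \<xi> \<notin> S \<or> \<xi> > T \<longrightarrow> h \<xi> = 0) \<Longrightarrow> sqn h \<le> C * (LINT x:E|lborel. (cmod (ft h x))\<^sup>2)"
    using union_lower_bound[OF Z' pos \<Delta> \<gamma>] unfolding S by blast
  have "norm_controlled S E (4 * C)" if E: "thick_with \<Delta> \<gamma> E" for E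
    unfolding norm_controlled_def
  proof
    have Em[measurable]: "E \<in> sets lebesgue" using E by (simp add: thick_with_def)
    obtain E' where E'[measurable]: "E' \<in> sets borel" and EE': "AE x in lebesgue. x \<in> E \<longleftrightarrow> x \<in> E'"
      using lebesgue_borel_set[OF Em] .
    have E'l[measurable]: "E' \<in> sets lebesgue" using E' by simp
    have th: "thick_borel \<Delta> \<gamma> E'"
      unfolding thick_borel_def
    proof (intro conjI allI E')
      fix x
      have "measure lebesgue (E \<inter> {x..x + \<Delta>}) = measure lebesgue (E' \<inter> {x..x + \<Delta>})"
        by (rule measure_eq_AE) (use EE' in \<open>auto elim: AE_mp\<close>)
      also have "\<dots> = measure lborel (E' \<inter> {x..x + \<Delta>})" by (simp add: measure_completion)
      finally have m: "measure lebesgue (E \<inter> {x..x + \<Delta>}) = measure lborel (E' \<inter> {x..x + \<Delta>})" .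
      show "measure lborel (E' \<inter> {x..x + \<Delta>}) \<ge> \<gamma> * \<Delta>" using E unfolding thick_with_def m[symmetric] by blast
    qed
    fix f assume f: "f \<in> L2_spectrum_in S"
    then have fL: "f \<in> L2" by (simp add: L2_spectrum_in_def)
    obtain g where g: "g \<in> borel_measurable borel" "AE x in lebesgue. f x = g x"
      "integrable lborel (\<lambda>x. (cmod (g x))\<^sup>2)" "(LINT x|lebesgue. (cmod (f x))\<^sup>2) = sqn g"
      using L2_representative[OF fL] .
    note [measurable] = g(1)
    let ?A = "LINT x:E'|lborel. (cmod (g x))\<^sup>2"
    have A: "(LINT x:E|lebesgue. (cmod (f x))\<^sup>2) = ?A"
      unfolding set_lebesgue_integral_def
    proof (rule integrable_lebesgue_borel(2))
      have "integrable lebesgue (\<lambda>x. (cmod (f x))\<^sup>2)" using fL by (simp add: L2_def)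
      then show "integrable lebesgue (\<lambda>x. indicator E x *\<^sub>R (cmod (f x))\<^sup>2)" by (rule integrable_mult_indicator[OF Em])
      show "AE x in lebesgue. indicator E x *\<^sub>R (cmod (f x))\<^sup>2 = indicator E' x *\<^sub>R (cmod (g x))\<^sup>2"
        using EE' g(2) by eventually_elim (auto simp: indicator_def)
    qed measurable
    have approx: "sqn g \<le> 4 * C * ?A + (4 * C + 2) * e" if e: "0 < e" for e
    proof -
      obtain h T where h: "L12 h" and hs: "\<forall>\<xi>. \<xi> \<notin> S \<or> \<xi> > T \<longrightarrow> h \<xi> = 0"
        and ap: "(\<integral>\<^sup>+x. ennreal ((cmod (f x - ft h x))\<^sup>2) \<partial>lebesgue) \<le> ennreal e"
        using spectrum_approximation[OF f Sm e] by blast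
      note [measurable] = L12_measurable[OF h]
      note ph = plancherel[OF h]
      have di: "integrable lborel (\<lambda>x. (cmod (g x - ft h x))\<^sup>2)" using g(3) ph(1) by (intro integrable_sq_diff) auto
      have "(\<integral>\<^sup>+x. ennreal ((cmod (f x - ft h x))\<^sup>2) \<partial>lebesgue) = (\<integral>\<^sup>+x. ennreal ((cmod (g x - ft h x))\<^sup>2) \<partial>lborel)"
        using g(2) by (intro nn_lebesgue_borel) (auto elim: AE_mp)
      then have d: "sqn (\<lambda>x. g x - ft h x) \<le> e" using ap e by (simp add: sqn_nn[OF di, symmetric])
      have d': "sqn (\<lambda>x. ft h x - g x) = sqn (\<lambda>x. g x - ft h x)" by (simp add: sqn_def norm_minus_commute)
      have "(LINT x:UNIV|lborel. (cmod (ft h x + (g x - ft h x)))\<^sup>2) \<le>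
          2 * (LINT x:UNIV|lborel. (cmod (ft h x))\<^sup>2) + 2 * sqn (\<lambda>x. g x - ft h x)"
        using ph(1) di by (intro set_sq_add_le) auto
      then have 1: "sqn g \<le> 2 * sqn h + 2 * e" using d ph(2) by (simp add: set_lebesgue_integral_def sqn_def)
      have "integrable lborel (\<lambda>x. (cmod (ft h x - g x))\<^sup>2)" using g(3) ph(1) by (intro integrable_sq_diff) auto
      then have "(LINT x:E'|lborel. (cmod (g x + (ft h x - g x)))\<^sup>2) \<le> 2 * ?A + 2 * sqn (\<lambda>x. ft h x - g x)"
        using g(3) by (intro set_sq_add_le) auto
      then have "(LINT x:E'|lborel. (cmod (ft h x))\<^sup>2) \<le> 2 * ?A + 2 * e" using d d' by simp
      then have "C * (LINT x:E'|lborel. (cmod (ft h x))\<^sup>2) \<le> C * (2 * ?A + 2 * e)" using C by (rule mult_left_mono)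
      then have "sqn h \<le> C * (2 * ?A + 2 * e)" using lb[OF th h hs] by linarith
      then show ?thesis using 1 by (simp add: algebra_simps)
    qed
    have "sqn g \<le> 4 * C * ?A"
    proof (rule field_le_epsilon)
      fix e :: real assume e: "0 < e"
      have c: "0 < 4 * C + 2" using C by simp
      then have "0 < e / (4 * C + 2)" using e by simp
      from approx[OF this] show "sqn g \<le> 4 * C * ?A + e" using c by simp
    qed
    then show "(LINT x|lebesgue. (cmod (f x))\<^sup>2) \<le> 4 * C * (LINT x:E|lebesgue. (cmod (f x))\<^sup>2)"
      unfolding g(4) A .
  qed
  then show ?thesis by blast
qed

text \<open>All but 1 / (2 C) of the energy of \<open>\<phi>\<close> lies in {- n..n}. A translate
  to \<open>a\<close> has energy at least 1 / C on \<open>E\<close>, so at least 1 / (2 C) of it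
  comes from the points of \<open>E\<close> within \<open>n\<close> of \<open>a\<close>; as
  \<open>\<phi>\<close> is bounded by 1, their measure is at least 1 / (2 C).\<close>

lemma norm_controlled_imp_thick:
  assumes E: "E \<in> sets lebesgue" and nc: "norm_controlled S E C" and I: "{b..b + 1} \<subseteq> S"
  shows "thick E"
proof -
  note [measurable] = E
  define h0 :: "real \<Rightarrow> complex" where "h0 = indicator {b..b + 1}"
  \<comment> \<open>Modulation on the frequency side translates the function by \<open>a\<close>
    without moving the spectrum.\<close>
  define h where "h a \<xi> = h0 \<xi> * expi (- a * \<xi>)" for a \<xi>
  have h0m[measurable]: "h0 \<in> borel_measurable borel" unfolding h0_def by measurable
  have hm[measurable]: "h a \<in> borel_measurable borel" for a unfolding h_def by measurable
  have ii: "integrable lborel (indicator {b..b + 1} :: real \<Rightarrow> real)" by simp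
  have c1: "cmod (h a \<xi>) = indicator {b..b + 1} \<xi>" "(cmod (h a \<xi>))\<^sup>2 = indicator {b..b + 1} \<xi>" for a \<xi>
    by (auto simp: h_def h0_def norm_mult indicator_def)
  have c0: "cmod (h0 \<xi>) = indicator {b..b + 1} \<xi>" "(cmod (h0 \<xi>))\<^sup>2 = indicator {b..b + 1} \<xi>" for \<xi>
    by (auto simp: h0_def indicator_def)
  have h012: "L12 h0"
    unfolding L12_def c0 using ii by (auto intro!: Bochner_Integration.integrable_bound[OF ii] simp: h0_def indicator_def)
  have h12: "L12 (h a)" for a
    by (rule L12_cong_norm[OF h012 hm]) (simp add: c0 c1)
  have one: "(LINT \<xi>|lborel. indicator {b..b + 1} \<xi>) = (1::real)" by simp
  have sq1: "sqn (h a) = 1" for a unfolding sqn_def c1(2) by (rule one)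
  define \<phi> where "\<phi> = ft h0"
  have \<phi>m[measurable]: "\<phi> \<in> borel_measurable borel" unfolding \<phi>_def by measurable
  have fth: "ft (h a) x = \<phi> (x - a)" for a x
    unfolding h_def \<phi>_def using ft_modulate[of h0 "- a" x] by simp
  have \<phi>1: "(cmod (\<phi> x))\<^sup>2 \<le> 1" for x
  proof -
    have "cmod (\<phi> x) \<le> (LINT \<xi>|lborel. cmod (h0 \<xi>))"
      unfolding \<phi>_def using h012 by (intro norm_ft_le) (simp add: L12_def)
    then have "cmod (\<phi> x) \<le> 1" unfolding c0 one .
    then show ?thesis by (simp add: power_le_one)
  qed
  have \<phi>i: "integrable lborel (\<lambda>x. (cmod (\<phi> x))\<^sup>2)" unfolding \<phi>_def by (rule plancherel(1)[OF h012])
  have \<phi>a: "integrable lborel (\<lambda>x. (cmod (\<phi> (x - a)))\<^sup>2)" for a using plancherel(1)[OF h12, of a] by (simp add: fth)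
  have \<phi>al: "integrable lebesgue (\<lambda>x. (cmod (\<phi> (x - a)))\<^sup>2)" for a
    using \<phi>a[of a] by (subst integrable_completion) measurable
  have key: "1 \<le> C * (LINT x:E|lebesgue. (cmod (\<phi> (x - a)))\<^sup>2)" for a
  proof -
    have hf: "has_fourier_L2 (ft (h a)) (h a)" by (rule has_fourier_L2_ft[OF h12])
    then have "ft (h a) \<in> L2" by (simp add: has_fourier_L2_def)
    moreover have "\<xi> \<notin> S \<longrightarrow> h a \<xi> = 0" for \<xi> using I by (auto simp: h_def h0_def indicator_def)
    ultimately have "ft (h a) \<in> L2_spectrum_in S"
      unfolding L2_spectrum_in_def using hf by (auto intro!: exI[of _ "h a"])
    then have "(LINT x|lebesgue. (cmod (ft (h a) x))\<^sup>2) \<le> C * (LINT x:E|lebesgue. (cmod (ft (h a) x))\<^sup>2)"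
      using nc by (simp add: norm_controlled_def)
    moreover have "(LINT x|lebesgue. (cmod (ft (h a) x))\<^sup>2) = sqn (ft (h a))"
      unfolding sqn_def by (rule integral_completion) measurable
    ultimately show ?thesis using plancherel(2)[OF h12, of a] sq1[of a] by (simp add: fth)
  qed
  \<comment> \<open>\<open>norm_controlled\<close> admits any real constant, so positivity has to
    come from a nonzero test function.\<close>
  have C: "0 < C"
  proof (rule ccontr)
    assume "\<not> 0 < C"
    moreover have "0 \<le> (LINT x:E|lebesgue. (cmod (\<phi> (x - 0)))\<^sup>2)"
      unfolding set_lebesgue_integral_def by (rule integral_nonneg_AE) (auto simp: indicator_def)
    ultimately have "C * (LINT x:E|lebesgue. (cmod (\<phi> (x - 0)))\<^sup>2) \<le> 0" by (intro mult_nonpos_nonneg) auto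
    then show False using key[of 0] by linarith
  qed
  define \<psi> where "\<psi> n x = \<phi> x - indicator {- real n..real n} x * \<phi> x" for n x
  have \<psi>m[measurable]: "\<psi> n \<in> borel_measurable borel" for n unfolding \<psi>_def by measurable
  have "1 / (2 * C) > 0" using C by simp
  from LIMSEQ_D[OF truncation_converges[OF \<phi>m \<phi>i] this] obtain n0
    where n0: "\<And>n. n \<ge> n0 \<Longrightarrow> sqn (\<psi> n) < 1 / (2 * C)" by (auto simp: sqn_def \<psi>_def)
  define n where "n = max 1 n0"
  have n: "1 \<le> n" "sqn (\<psi> n) < 1 / (2 * C)" using n0[of n] by (auto simp: n_def)
  have \<psi>i: "integrable lborel (\<lambda>x. (cmod (\<psi> n x))\<^sup>2)"
    by (rule Bochner_Integration.integrable_bound[OF \<phi>i]) (auto simp: \<psi>_def indicator_def)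
  have low: "1 / (2 * C) \<le> measure lebesgue (E \<inter> {a - real n..a + real n})" for a
  proof -
    let ?X = "E \<inter> {a - real n..a + real n}"
    have X: "?X \<in> lmeasurable"
      by (subst Int_commute, rule fmeasurable_Int_fmeasurable) (use E in auto)
    have s: "integrable lborel (\<lambda>x. (cmod (\<psi> n (x - a)))\<^sup>2)" "sqn (\<lambda>x. \<psi> n (x - a)) = sqn (\<psi> n)"
      using shift_sq[OF \<psi>i, of "- a"] by auto
    have sl: "integrable lebesgue (\<lambda>x. (cmod (\<psi> n (x - a)))\<^sup>2)"
      using s(1) by (subst integrable_completion) measurable
    have eq: "(LINT x|lebesgue. (cmod (\<psi> n (x - a)))\<^sup>2) = sqn (\<psi> n)"
      by (subst s(2)[symmetric], unfold sqn_def, rule integral_completion) measurable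
    have iX: "integrable lebesgue (indicator ?X :: real \<Rightarrow> real)"
      using X by (intro integrable_real_indicator) (auto simp: fmeasurable_def)
    have "(LINT x:E|lebesgue. (cmod (\<phi> (x - a)))\<^sup>2) \<le> (LINT x|lebesgue. indicator ?X x + (cmod (\<psi> n (x - a)))\<^sup>2)"
      unfolding set_lebesgue_integral_def
    proof (rule integral_mono)
      show "integrable lebesgue (\<lambda>x. indicator E x *\<^sub>R (cmod (\<phi> (x - a)))\<^sup>2)" by (rule integrable_mult_indicator[OF E \<phi>al])
      show "integrable lebesgue (\<lambda>x. indicator ?X x + (cmod (\<psi> n (x - a)))\<^sup>2)"
        using iX sl by (rule Bochner_Integration.integrable_add)
      show "indicator E x *\<^sub>R (cmod (\<phi> (x - a)))\<^sup>2 \<le> indicator ?X x + (cmod (\<psi> n (x - a)))\<^sup>2" for x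
        using \<phi>1[of "x - a"] by (auto simp: \<psi>_def indicator_def)
    qed
    also have "\<dots> = measure lebesgue ?X + sqn (\<psi> n)"
      using X by (simp add: Bochner_Integration.integral_add[OF iX sl] eq)
    also have "\<dots> \<le> measure lebesgue ?X + 1 / (2 * C)" using n(2) by simp
    finally have "C * (LINT x:E|lebesgue. (cmod (\<phi> (x - a)))\<^sup>2) \<le> C * (measure lebesgue ?X + 1 / (2 * C))"
      using C by (intro mult_left_mono) auto
    with key[of a] have "1 \<le> C * (measure lebesgue ?X + 1 / (2 * C))" by linarith
    then show ?thesis using C by (simp add: field_simps)
  qed
  \<comment> \<open>Chosen so that \<gamma> * \<Delta> equals the bound 1 / (2 C) in
    \<open>low\<close>.\<close>
  have "thick_with (2 * real n) (1 / (4 * real n * C)) E"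
    unfolding thick_with_def
  proof (intro conjI allI E)
    show "0 < 2 * real n" "0 < 1 / (4 * real n * C)" using n(1) C by auto
    fix x
    have "1 / (4 * real n * C) * (2 * real n) = 1 / (2 * C)" using n(1) C by (simp add: field_simps)
    also have "\<dots> \<le> measure lebesgue (E \<inter> {x + real n - real n..x + real n + real n})" by (rule low)
    finally show "1 / (4 * real n * C) * (2 * real n) \<le> measure lebesgue (E \<inter> {x..x + 2 * real n})"
      by (simp add: algebra_simps)
  qed
  then show ?thesis unfolding thick_def by blast
qed

theorem theorem1p4:
  fixes lam :: "nat \<Rightarrow> real" and S :: "real set"
  assumes "\<forall>k\<ge>1. lam k \<ge> 0"
    and "strong_Zygmund_lacunary lam"
    and "S = (\<Union>k\<in>{1..}. {lam k..lam k + 1})"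
  shows "(\<forall>E\<in>sets lebesgue. (\<exists>C. norm_controlled S E C) \<longleftrightarrow> thick E) \<and>
         (\<forall>\<Delta>>0. \<forall>\<gamma>>0. \<exists>C. \<forall>E. thick_with \<Delta> \<gamma> E \<longrightarrow> norm_controlled S E C)"
proof (intro conjI ballI allI impI iffI)
  show "\<exists>C. \<forall>E. thick_with \<Delta> \<gamma> E \<longrightarrow> norm_controlled S E C" if "0 < \<Delta>" "0 < \<gamma>" for \<Delta> \<gamma> :: real
    by (rule thick_norm_controlled[OF assms(2,1,3) that])
  fix E :: "real set" assume E: "E \<in> sets lebesgue"
  show "thick E" if "\<exists>C. norm_controlled S E C"
  proof -
    have "{lam 1..lam 1 + 1} \<subseteq> S" unfolding assms(3) by (rule UN_upper) simp
    then show ?thesis using that norm_controlled_imp_thick[OF E] by blast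
  qed
  show "\<exists>C. norm_controlled S E C" if "thick E"
  proof -
    from that obtain \<Delta> \<gamma> where th: "thick_with \<Delta> \<gamma> E" unfolding thick_def by blast
    then have "0 < \<Delta>" "0 < \<gamma>" by (auto simp: thick_with_def)
    from thick_norm_controlled[OF assms(2,1,3) this] th show ?thesis by blast
  qed
qed

end
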